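(* Let $n \ge 5$, and let $w$ be a proper quasi-Coxeter element of the Coxeter group $W[D_n]$ of type $D_n$. Then the interval group $G([1,w])$ admits no surjective group homomorphism onto the braid group $\mathcal{B}_n$ on $n$ strands.
   Context: Coxeter group of type $D_n$. $W[D_n]$ is the Coxeter group with generating set $S=\{s_1,\dots,s_n\}$ and defining relations $s_i^2=1$ for all $i$ and $(s_is_j)^{m_{i,j}}=1$ for $i\ne j$, where $m_{i,j}=3$ if $\{s_i,s_j\}$ is an edge of the Coxeter graph $D_n$ and $m_{i,j}=2$ otherwise. The edges of $D_n$ are $\{s_i,s_{i+1}\}$ for $1\le i\le n-2$, together with $\{s_{n-2},s_n\}$. Reflections and absolute order. The set of reflections of $W=W[D_n]$ is $T=\{usu^{-1} \mid u\in W,\ s\in S\}$. Let $\ell_T: W\to\mathbb{N}$ be the word length with respect to the generating set $T$. The absolute order $\preceq$ on $W$ is defined by $u\preceq v$ if and only if $\ell_T(v)=\ell_T(u)+\ell_T(u^{-1}v)$. For $w\in W$, put $[1,w]=\{u\in W\mid u\preceq w\}$. Interval group. For $w\in W$, the interval group $G([1,w])$ is the group with generating set $\{d_u\mid u\in[1,w]\}$ (abstract symbols in one-to-one correspondence with $[1,w]$) and defining relations $d_ud_v=d_{uv}$ for all $u,v\in[1,w]$ such that $uv\in[1,w]$ and $\ell_T(u)+\ell_T(v)=\ell_T(uv)$. Quasi-Coxeter elements. A Coxeter element of $W$ is a product of all the elements of $S$ (each exactly once) in some order. An element $w\in W$ is a quasi-Coxeter element if $\ell_T(w)=|S|=n$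 and there is an expression $w=t_1t_2\cdots t_n$ with $t_1,\dots,t_n\in T$ such that $\{t_1,\dots,t_n\}$ generates $W$. A quasi-Coxeter element is proper if it is not conjugate in $W$ to a Coxeter element. Braid group. $\mathcal{B}_n$ is the group with generators $t_1,\dots,t_{n-1}$ and defining relations $t_it_{i+1}t_i=t_{i+1}t_it_{i+1}$ for $1\le i\le n-2$ and $t_it_j=t_jt_i$ for $|i-j|\ge2$. *)

theory Defs
  imports "HOL-Algebra.Generated_Groups"
begin

section \<open>Groups given by generators and relations\<close>

text \<open>A letter \<open>(x, True)\<close> stands for the generator \<open>x\<close>, and \<open>(x, False)\<close> for its formal inverse.\<close>

type_synonym 'a gword = "('a \<times> bool) list"

definition gwords :: "'a set \<Rightarrow> 'a gword set" where
  "gwords X = lists (X \<times> UNIV)"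

text \<open>A pair \<open>(r, r')\<close> in \<open>R\<close> encodes the relation \<open>r = r'\<close>. Demanding that \<open>r\<close> and \<open>r'\<close> are
  words over \<open>X\<close> makes \<open>pres_rel X R\<close> an equivalence on \<open>gwords X\<close> for every \<open>R\<close>; for the
  presentations below no relation is lost thereby (see \<open>coxeter_rels_wf\<close>, \<open>interval_rels_wf\<close>
  and \<open>braid_rels_wf\<close>).\<close>

inductive_set pres_rel ::
  "'a set \<Rightarrow> ('a gword \<times> 'a gword) set \<Rightarrow> ('a gword \<times> 'a gword) set"
  for X :: "'a set" and R :: "('a gword \<times> 'a gword) set" where
  refl: "u \<in> gwords X \<Longrightarrow> (u, u) \<in> pres_rel X R"
| sym: "(u, v) \<in> pres_rel X R \<Longrightarrow> (v, u) \<in> pres_rel X R"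
| trans: "(u, v) \<in> pres_rel X R \<Longrightarrow> (v, w) \<in> pres_rel X R \<Longrightarrow> (u, w) \<in> pres_rel X R"
| cancel: "u \<in> gwords X \<Longrightarrow> v \<in> gwords X \<Longrightarrow> x \<in> X
    \<Longrightarrow> (u @ [(x, b), (x, \<not> b)] @ v, u @ v) \<in> pres_rel X R"
| rel: "u \<in> gwords X \<Longrightarrow> v \<in> gwords X \<Longrightarrow> (r, r') \<in> R \<Longrightarrow> r \<in> gwords X \<Longrightarrow> r' \<in> gwords X
    \<Longrightarrow> (u @ r @ v, u @ r' @ v) \<in> pres_rel X R"

definition presented_group :: "'a set \<Rightarrow> ('a gword \<times> 'a gword) set \<Rightarrow> 'a gword set monoid" where
  "presented_group X R =
    \<lparr>carrier = gwords X // pres_rel X R,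
     mult = (\<lambda>A B. \<Union>a\<in>A. \<Union>b\<in>B. pres_rel X R `` {a @ b}),
     one = pres_rel X R `` {[]}\<rparr>"

definition pres_gen :: "'a set \<Rightarrow> ('a gword \<times> 'a gword) set \<Rightarrow> 'a \<Rightarrow> 'a gword set" where
  "pres_gen X R x = pres_rel X R `` {[(x, True)]}"

lemma gwords_simps [simp]:
  "[] \<in> gwords X"
  "p # u \<in> gwords X \<longleftrightarrow> fst p \<in> X \<and> u \<in> gwords X"
  "u @ v \<in> gwords X \<longleftrightarrow> u \<in> gwords X \<and> v \<in> gwords X"
  by (cases p; auto simp: gwords_def)+

lemma pres_rel_gwords: "(u, v) \<in> pres_rel X R \<Longrightarrow> u \<in> gwords X \<and> v \<in> gwords X"
  by (induction rule: pres_rel.induct) auto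

lemma equiv_pres_rel: "equiv (gwords X) (pres_rel X R)"
  by (rule equivI)
     (auto intro!: refl_onI symI transI dest: pres_rel_gwords
           intro: pres_rel.refl pres_rel.sym pres_rel.trans)

lemma pres_rel_context:
  assumes "(u, v) \<in> pres_rel X R" "a \<in> gwords X" "b \<in> gwords X"
  shows "(a @ u @ b, a @ v @ b) \<in> pres_rel X R"
  using assms
proof (induction rule: pres_rel.induct)
  case (cancel u v x c)
  then show ?case using pres_rel.cancel[of "a @ u" X "v @ b" x c R] by simp
next
  case (rel u v r r')
  then show ?case using pres_rel.rel[of "a @ u" X "v @ b" r r' R] by simp
qed (auto intro: pres_rel.refl pres_rel.sym pres_rel.trans)

lemma pres_rel_append:
  assumes "(u, u') \<in> pres_rel X R" "(v, v') \<in> pres_rel X R"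
  shows "(u @ v, u' @ v') \<in> pres_rel X R"
proof -
  have "(u @ v, u' @ v) \<in> pres_rel X R"
    using pres_rel_context[OF assms(1), of "[]" v] pres_rel_gwords[OF assms(2)] by simp
  moreover have "(u' @ v, u' @ v') \<in> pres_rel X R"
    using pres_rel_context[OF assms(2), of u' "[]"] pres_rel_gwords[OF assms(1)] by simp
  ultimately show ?thesis by (rule pres_rel.trans)
qed

lemma presented_group_mult:
  assumes "u \<in> gwords X" "v \<in> gwords X"
  shows "pres_rel X R `` {u} \<otimes>\<^bsub>presented_group X R\<^esub> pres_rel X R `` {v} = pres_rel X R `` {u @ v}"
proof -
  have "congruent2 (pres_rel X R) (pres_rel X R) (\<lambda>a b. pres_rel X R `` {a @ b})"
    by (auto intro!: congruent2I' equiv_class_eq[OF equiv_pres_rel] pres_rel_append)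
  then show ?thesis
    using UN_equiv_class2[OF equiv_pres_rel equiv_pres_rel _ assms, of R R]
    by (simp add: presented_group_def)
qed

definition inv_gword :: "'a gword \<Rightarrow> 'a gword" where
  "inv_gword u = rev (map (\<lambda>(x, b). (x, \<not> b)) u)"

lemma inv_gword_left: "u \<in> gwords X \<Longrightarrow> inv_gword u \<in> gwords X \<and> (inv_gword u @ u, []) \<in> pres_rel X R"
proof (induction u)
  case Nil
  then show ?case by (auto simp: inv_gword_def intro: pres_rel.refl)
next
  case (Cons p u)
  obtain x b where p: "p = (x, b)" by (cases p)
  have "(inv_gword u @ [(x, \<not> b), (x, \<not> \<not> b)] @ u, inv_gword u @ u) \<in> pres_rel X R"
    using Cons p by (intro pres_rel.cancel) auto
  then show ?case
    using Cons p by (auto simp: inv_gword_def intro: pres_rel.trans)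
qed

theorem group_presented_group: "group (presented_group X R)"
proof (rule groupI)
  show "\<one>\<^bsub>presented_group X R\<^esub> \<in> carrier (presented_group X R)"
    by (auto simp: presented_group_def intro: quotientI)
next
  fix A B assume "A \<in> carrier (presented_group X R)" "B \<in> carrier (presented_group X R)"
  then obtain a b where "a \<in> gwords X" "b \<in> gwords X"
    "A = pres_rel X R `` {a}" "B = pres_rel X R `` {b}"
    by (auto simp: presented_group_def elim!: quotientE)
  then show "A \<otimes>\<^bsub>presented_group X R\<^esub> B \<in> carrier (presented_group X R)"
    by (simp add: presented_group_mult) (simp add: presented_group_def quotientI)
next
  fix A B C assume "A \<in> carrier (presented_group X R)" "B \<in> carrier (presented_group X R)"
    "C \<in> carrier (presented_group X R)"
  then obtain a b c where "a \<in> gwords X" "b \<in> gwords X" "c \<in> gwords X"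
    "A = pres_rel X R `` {a}" "B = pres_rel X R `` {b}" "C = pres_rel X R `` {c}"
    by (auto simp: presented_group_def elim!: quotientE)
  then show "A \<otimes>\<^bsub>presented_group X R\<^esub> B \<otimes>\<^bsub>presented_group X R\<^esub> C
      = A \<otimes>\<^bsub>presented_group X R\<^esub> (B \<otimes>\<^bsub>presented_group X R\<^esub> C)"
    by (simp add: presented_group_mult)
next
  fix A assume "A \<in> carrier (presented_group X R)"
  then obtain a where a: "a \<in> gwords X" "A = pres_rel X R `` {a}"
    by (auto simp: presented_group_def elim!: quotientE)
  have one: "\<one>\<^bsub>presented_group X R\<^esub> = pres_rel X R `` {[]}"
    by (simp add: presented_group_def)
  show "\<one>\<^bsub>presented_group X R\<^esub> \<otimes>\<^bsub>presented_group X R\<^esub> A = A"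
    using a by (simp add: presented_group_mult one)
  have "pres_rel X R `` {inv_gword a} \<in> carrier (presented_group X R)"
    using inv_gword_left[OF a(1)] by (simp add: presented_group_def quotientI)
  moreover have "pres_rel X R `` {inv_gword a} \<otimes>\<^bsub>presented_group X R\<^esub> A = \<one>\<^bsub>presented_group X R\<^esub>"
    using a inv_gword_left[OF a(1)]
    by (simp add: presented_group_mult one equiv_class_eq[OF equiv_pres_rel])
  ultimately show "\<exists>B\<in>carrier (presented_group X R).
      B \<otimes>\<^bsub>presented_group X R\<^esub> A = \<one>\<^bsub>presented_group X R\<^esub>"
    by blast
qed

text \<open>The universal property of \<open>presented_group\<close>: a map on generators under which all relations
  hold extends to a homomorphism.\<close>

definition gword_eval :: "('b, 'c) monoid_scheme \<Rightarrow> ('a \<Rightarrow> 'b) \<Rightarrow> 'a gword \<Rightarrow> 'b" where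
  "gword_eval H f u =
    foldr (\<lambda>(x, b) h. (if b then f x else inv\<^bsub>H\<^esub> f x) \<otimes>\<^bsub>H\<^esub> h) u \<one>\<^bsub>H\<^esub>"

lemma (in group) gword_eval_closed:
  "f \<in> X \<rightarrow> carrier G \<Longrightarrow> u \<in> gwords X \<Longrightarrow> gword_eval G f u \<in> carrier G"
  by (induction u) (auto simp: gword_eval_def Pi_iff split: prod.splits)

lemma (in group) gword_eval_append:
  assumes f: "f \<in> X \<rightarrow> carrier G" and v: "v \<in> gwords X"
  shows "u \<in> gwords X \<Longrightarrow> gword_eval G f (u @ v) = gword_eval G f u \<otimes> gword_eval G f v"
proof (induction u)
  case Nil
  then show ?case using gword_eval_closed[OF f v] by (simp add: gword_eval_def)
next
  case (Cons p u)
  obtain x b where p: "p = (x, b)" by (cases p)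
  have "f x \<in> carrier G" using Cons p f by auto
  moreover have "gword_eval G f u \<in> carrier G" "gword_eval G f v \<in> carrier G"
    using gword_eval_closed[OF f] Cons v by auto
  ultimately show ?case
    using Cons p by (simp add: gword_eval_def m_assoc)
qed

theorem (in group) presented_group_universal:
  assumes f: "f \<in> X \<rightarrow> carrier G"
    and rels: "\<And>r r'. (r, r') \<in> R \<Longrightarrow> gword_eval G f r = gword_eval G f r'"
  shows "\<exists>h \<in> hom (presented_group X R) G. \<forall>x\<in>X. h (pres_gen X R x) = f x"
proof -
  have eval: "gword_eval G f u = gword_eval G f v" if "(u, v) \<in> pres_rel X R" for u v
    using that
  proof (induction rule: pres_rel.induct)
    case (cancel u v x b)
    have "f x \<in> carrier G" using cancel f by auto
    moreover from this have "gword_eval G f [(x, b), (x, \<not> b)] = \<one>"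
      by (cases b) (simp_all add: gword_eval_def)
    moreover have "gword_eval G f u \<in> carrier G" "gword_eval G f v \<in> carrier G"
      using gword_eval_closed[OF f] cancel by auto
    ultimately show ?case
      using cancel gword_eval_append[OF f, of "[(x, b), (x, \<not> b)] @ v" u]
        gword_eval_append[OF f, of v "[(x, b), (x, \<not> b)]"] gword_eval_append[OF f, of v u]
      by simp
  next
    case (rel u v r r')
    then show ?case
      by (simp add: gword_eval_append[OF f] rels)
  qed auto
  define h where "h = (\<lambda>A. the_elem (gword_eval G f ` A))"
  have h: "h (pres_rel X R `` {u}) = gword_eval G f u" if "u \<in> gwords X" for u
  proof -
    have "gword_eval G f ` (pres_rel X R `` {u}) = {gword_eval G f u}"
      using eval that by (force intro: pres_rel.refl)
    then show ?thesis by (simp add: h_def)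
  qed
  have "h \<in> hom (presented_group X R) G"
  proof (rule homI)
    fix A assume "A \<in> carrier (presented_group X R)"
    then show "h A \<in> carrier G"
      by (auto simp: presented_group_def h gword_eval_closed[OF f] elim!: quotientE)
  next
    fix A B assume "A \<in> carrier (presented_group X R)" "B \<in> carrier (presented_group X R)"
    then obtain a b where "a \<in> gwords X" "b \<in> gwords X"
      "A = pres_rel X R `` {a}" "B = pres_rel X R `` {b}"
      by (auto simp: presented_group_def elim!: quotientE)
    then show "h (A \<otimes>\<^bsub>presented_group X R\<^esub> B) = h A \<otimes> h B"
      by (simp add: presented_group_mult h gword_eval_append[OF f])
  qed
  moreover have "h (pres_gen X R x) = f x" if "x \<in> X" for x
  proof -
    have "f x \<in> carrier G" using that f by auto
    then show ?thesis using that by (simp add: pres_gen_def h) (simp add: gword_eval_def)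
  qed
  ultimately show ?thesis by blast
qed


section \<open>Coxeter groups and type D\<close>

text \<open>Only the entries \<open>m i j\<close> with \<open>i \<noteq> j\<close> of the Coxeter matrix are used.\<close>

definition coxeter_rels :: "'a set \<Rightarrow> ('a \<Rightarrow> 'a \<Rightarrow> nat) \<Rightarrow> ('a gword \<times> 'a gword) set" where
  "coxeter_rels I m =
     {([(i, True), (i, True)], []) | i. i \<in> I} \<union>
     {(concat (replicate (m i j) [(i, True), (j, True)]), []) | i j. i \<in> I \<and> j \<in> I \<and> i \<noteq> j}"

definition coxeter_group :: "'a set \<Rightarrow> ('a \<Rightarrow> 'a \<Rightarrow> nat) \<Rightarrow> 'a gword set monoid" where
  "coxeter_group I m = presented_group I (coxeter_rels I m)"

definition coxeter_gens :: "'a set \<Rightarrow> ('a \<Rightarrow> 'a \<Rightarrow> nat) \<Rightarrow> 'a gword set set" where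
  "coxeter_gens I m = pres_gen I (coxeter_rels I m) ` I"

definition D_edges :: "nat \<Rightarrow> nat set set" where
  "D_edges n = {{i, i + 1} | i. 1 \<le> i \<and> i \<le> n - 2} \<union> {{n - 2, n}}"

definition D_matrix :: "nat \<Rightarrow> nat \<Rightarrow> nat \<Rightarrow> nat" where
  "D_matrix n i j = (if {i, j} \<in> D_edges n then 3 else 2)"

definition W_D :: "nat \<Rightarrow> nat gword set monoid" where
  "W_D n = coxeter_group {1..n} (D_matrix n)"

definition S_D :: "nat \<Rightarrow> nat gword set set" where
  "S_D n = coxeter_gens {1..n} (D_matrix n)"

lemma coxeter_rels_wf: "coxeter_rels I m \<subseteq> gwords I \<times> gwords I"
  by (auto simp: coxeter_rels_def gwords_def split: if_splits)


section \<open>Absolute order, quasi-Coxeter elements and interval groups\<close>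

definition list_mult :: "('a, 'b) monoid_scheme \<Rightarrow> 'a list \<Rightarrow> 'a" where
  "list_mult G ts = foldr (\<otimes>\<^bsub>G\<^esub>) ts \<one>\<^bsub>G\<^esub>"

text \<open>Meaningful only for \<open>g \<in> generate G A\<close>; otherwise the \<open>LEAST\<close> ranges over nothing.\<close>

definition word_length :: "('a, 'b) monoid_scheme \<Rightarrow> 'a set \<Rightarrow> 'a \<Rightarrow> nat" where
  "word_length G A g =
    (LEAST k. \<exists>ts. length ts = k \<and> set ts \<subseteq> A \<union> m_inv G ` A \<and> list_mult G ts = g)"

definition reflections :: "('a, 'b) monoid_scheme \<Rightarrow> 'a set \<Rightarrow> 'a set" where
  "reflections W S = {u \<otimes>\<^bsub>W\<^esub> s \<otimes>\<^bsub>W\<^esub> inv\<^bsub>W\<^esub> u | u s. u \<in> carrier W \<and> s \<in> S}"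

definition refl_length :: "('a, 'b) monoid_scheme \<Rightarrow> 'a set \<Rightarrow> 'a \<Rightarrow> nat" where
  "refl_length W S = word_length W (reflections W S)"

definition abs_le :: "('a, 'b) monoid_scheme \<Rightarrow> 'a set \<Rightarrow> 'a \<Rightarrow> 'a \<Rightarrow> bool" where
  "abs_le W S u v \<longleftrightarrow>
    refl_length W S v = refl_length W S u + refl_length W S (inv\<^bsub>W\<^esub> u \<otimes>\<^bsub>W\<^esub> v)"

definition abs_interval :: "('a, 'b) monoid_scheme \<Rightarrow> 'a set \<Rightarrow> 'a \<Rightarrow> 'a set" where
  "abs_interval W S w = {u \<in> carrier W. abs_le W S u w}"

definition coxeter_element :: "('a, 'b) monoid_scheme \<Rightarrow> 'a set \<Rightarrow> 'a \<Rightarrow> bool" where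
  "coxeter_element W S c \<longleftrightarrow> (\<exists>ss. distinct ss \<and> set ss = S \<and> c = list_mult W ss)"

definition quasi_coxeter_element :: "('a, 'b) monoid_scheme \<Rightarrow> 'a set \<Rightarrow> 'a \<Rightarrow> bool" where
  "quasi_coxeter_element W S w \<longleftrightarrow>
    w \<in> carrier W \<and> refl_length W S w = card S \<and>
    (\<exists>ts. length ts = card S \<and> set ts \<subseteq> reflections W S \<and> w = list_mult W ts \<and>
          generate W (set ts) = carrier W)"

definition proper_quasi_coxeter_element :: "('a, 'b) monoid_scheme \<Rightarrow> 'a set \<Rightarrow> 'a \<Rightarrow> bool" where
  "proper_quasi_coxeter_element W S w \<longleftrightarrow>
    quasi_coxeter_element W S w \<and>
    \<not> (\<exists>c g. coxeter_element W S c \<and> g \<in> carrier W \<and> w = g \<otimes>\<^bsub>W\<^esub> c \<otimes>\<^bsub>W\<^esub> inv\<^bsub>W\<^esub> g)"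

text \<open>The abstract symbol \<open>d\<^sub>u\<close> is the letter \<open>(u, True)\<close>.\<close>

definition interval_rels ::
  "('a, 'b) monoid_scheme \<Rightarrow> 'a set \<Rightarrow> 'a \<Rightarrow> ('a gword \<times> 'a gword) set" where
  "interval_rels W S w =
    {([(u, True), (v, True)], [(u \<otimes>\<^bsub>W\<^esub> v, True)]) | u v.
       u \<in> abs_interval W S w \<and> v \<in> abs_interval W S w \<and> u \<otimes>\<^bsub>W\<^esub> v \<in> abs_interval W S w \<and>
       refl_length W S u + refl_length W S v = refl_length W S (u \<otimes>\<^bsub>W\<^esub> v)}"

definition interval_group :: "('a, 'b) monoid_scheme \<Rightarrow> 'a set \<Rightarrow> 'a \<Rightarrow> 'a gword set monoid" where
  "interval_group W S w = presented_group (abs_interval W S w) (interval_rels W S w)"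

lemma interval_rels_wf:
  "interval_rels W S w \<subseteq> gwords (abs_interval W S w) \<times> gwords (abs_interval W S w)"
  by (auto simp: interval_rels_def)


section \<open>The braid group on \<open>n\<close> strands\<close>

definition braid_rels :: "nat \<Rightarrow> (nat gword \<times> nat gword) set" where
  "braid_rels n =
     {([(i, True), (i + 1, True), (i, True)], [(i + 1, True), (i, True), (i + 1, True)]) | i.
        1 \<le> i \<and> i \<le> n - 2} \<union>
     {([(i, True), (j, True)], [(j, True), (i, True)]) | i j.
        i \<in> {1..n - 1} \<and> j \<in> {1..n - 1} \<and> (i + 2 \<le> j \<or> j + 2 \<le> i)}"

definition braid_group :: "nat \<Rightarrow> nat gword set monoid" where
  "braid_group n = presented_group {1..n - 1} (braid_rels n)"

lemma braid_rels_wf: "braid_rels n \<subseteq> gwords {1..n - 1} \<times> gwords {1..n - 1}"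
  by (auto simp: braid_rels_def)

end

theory Submission
  imports Defs "HOL-Library.Sublist" "HOL-Combinatorics.Permutations"
    "HOL-Algebra.Elementary_Groups"
begin

text \<open>The group \<open>W\<close> of type \<open>D\<^sub>n\<close> acts faithfully by signed permutations of \<open>\<plusminus>1, \<dots>, \<plusminus>n\<close> with an even number of
sign changes, its reflections being the maps \<open>u \<leftrightarrow> v, -u \<leftrightarrow> -v\<close> (\<open>rho_injective\<close>, \<open>T_eq_refl\<close>). A quasi-Coxeter
element \<open>w\<close> is a product of two negative cycles of lengths \<open>m \<le> k\<close> with \<open>m + k = n\<close>, and it is conjugate to
a Coxeter element when \<open>m = 1\<close>; so \<open>m \<ge> 2\<close> and \<open>k \<ge> 3\<close> when \<open>w\<close> is proper
(\<open>quasi_coxeter_two_negative_cycles\<close>, \<open>coxeter_if_short_cycle\<close>).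

Such a \<open>w\<close> has a reduced word \<open>x y p\<^sub>0 \<dots> p\<^bsub>m-2\<^esub> q\<^sub>0 \<dots> q\<^bsub>k-2\<^esub>\<close> whose diagram is the square \<open>x, p\<^sub>0, y, q\<^sub>0\<close> with
tails \<open>p\<^sub>1, p\<^sub>2, \<dots>\<close> and \<open>q\<^sub>1, q\<^sub>2, \<dots>\<close>. In the interval group, letters joined in the diagram satisfy the braid
relation and the others commute. Moreover conjugation by \<open>d\<^sub>w\<close> takes \<open>d\<^sub>u\<close> to
\<open>d\<^sub>v\<close> for \<open>v = w u w\<^sup>-\<^sup>1\<close>; hence a power of \<open>d\<^sub>w\<close> is central, and
\<open>d\<^sub>w\<close> shifts the reflections \<open>q\<^sub>j\<close> cyclically, with period \<open>k\<close>. All reflections arise from the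
letters by conjugation inside the interval group (\<open>T_reachable\<close>), so a homomorphism that takes one
value \<open>z\<close> on all the letters takes the value \<open>z\<^sup>l\<close> at \<open>d\<^sub>u\<close>, where \<open>l\<close> is the reflection length of \<open>u\<close>.

Let \<open>\<phi>\<close> be an epimorphism onto the braid group and \<open>X = \<phi> d\<^sub>w\<close>. By the previous remark the exponent sum of
\<open>X\<close> is \<open>\<plusminus>n\<close>, and some power of \<open>X\<close> is central. Project the braid group to the group of pairs consisting of
the strand permutation and of the winding numbers of all pairs of strands. In this quotient a
central power of \<open>X\<close> winds all pairs of strands equally often. Comparing this with a power of \<open>X\<close> that fixes
two strands, and therefore turns them around each other an even number of half turns, one finds that
\<open>n - 1\<close> divides the length of every nontrivial cycle of strands. Hence \<open>X\<^bsup>n-1\<^esup>\<close> fixes all strands, and it is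
central in the quotient (\<open>root_of_central\<close>).

Conjugation by \<open>X\<^bsup>n-1\<^esup>\<close> shifts the \<open>q\<^sub>j\<close> by \<open>n - 1 \<equiv> m - 1 (mod k)\<close>, so \<open>q\<^sub>0\<close> gets the same image as some later
\<open>q\<^sub>j\<close>. But \<open>x\<close> commutes with \<open>q\<^sub>j\<close> and braids with \<open>q\<^sub>0\<close>, which forces equal images of \<open>x\<close> and \<open>q\<^sub>0\<close>; the
collapse spreads over the whole diagram because \<open>m \<ge> 2\<close> closes the square
(\<open>constant_if_power_central\<close>). The image of the interval group in the quotient is then cyclic, whereas the quotient is
not commutative.\<close>


section \<open>Groups of bijections\<close>

definition bij_group :: "('a \<Rightarrow> 'a) monoid" where
  "bij_group = \<lparr>carrier = {f. bij f}, monoid.mult = (\<circ>), one = id\<rparr>"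

lemma bij_group_simps [simp]:
  "f \<in> carrier bij_group \<longleftrightarrow> bij f"
  "f \<otimes>\<^bsub>bij_group\<^esub> g = f \<circ> g"
  "\<one>\<^bsub>bij_group\<^esub> = id"
  by (auto simp: bij_group_def)

lemma group_bij_group [simp]: "group bij_group"
proof (rule groupI)
  fix f :: "'a \<Rightarrow> 'a"
  assume "f \<in> carrier bij_group"
  then show "\<exists>g\<in>carrier bij_group. g \<otimes>\<^bsub>bij_group\<^esub> f = \<one>\<^bsub>bij_group\<^esub>"
    by (intro bexI[of _ "inv_into UNIV f"]) (auto simp: bij_is_inj bij_imp_bij_inv)
qed (auto simp: bij_comp o_assoc)

lemma bij_group_pow [simp]: "f [^]\<^bsub>bij_group\<^esub> (k::nat) = f ^^ k"
proof (induction k)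
  case 0
  show ?case by (simp add: monoid.nat_pow_0 group.is_monoid)
next
  case (Suc k)
  then show ?case
    by (simp add: monoid.nat_pow_Suc group.is_monoid funpow_Suc_right del: funpow.simps)
qed

lemma list_mult_simps [simp]:
  "list_mult G [] = \<one>\<^bsub>G\<^esub>"
  "list_mult G (t # ts) = t \<otimes>\<^bsub>G\<^esub> list_mult G ts"
  by (simp_all add: list_mult_def)


section \<open>Computing in a presented group\<close>

lemma carrier_presented_group: "carrier (presented_group X R) = gwords X // pres_rel X R"
  by (simp add: presented_group_def)

lemma one_presented_group: "\<one>\<^bsub>presented_group X R\<^esub> = pres_rel X R `` {[]}"
  by (simp add: presented_group_def)

lemma pres_gen_closed: "x \<in> X \<Longrightarrow> pres_gen X R x \<in> carrier (presented_group X R)"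
  by (simp add: carrier_presented_group pres_gen_def quotientI)

lemma inv_pres_gen:
  assumes "x \<in> X"
  shows "inv\<^bsub>presented_group X R\<^esub> pres_gen X R x = pres_rel X R `` {[(x, False)]}"
proof (rule group.inv_equality[OF group_presented_group])
  have "([] @ [(x, False), (x, \<not> False)] @ [], [] @ []) \<in> pres_rel X R"
    using assms by (intro pres_rel.cancel) auto
  then show "pres_rel X R `` {[(x, False)]} \<otimes>\<^bsub>presented_group X R\<^esub> pres_gen X R x
      = \<one>\<^bsub>presented_group X R\<^esub>"
    using assms
    by (simp add: pres_gen_def presented_group_mult one_presented_group
        equiv_class_eq[OF equiv_pres_rel])
qed (use assms in \<open>auto simp: carrier_presented_group pres_gen_def intro: quotientI\<close>)

lemma gword_eval_pres_gen:
  "u \<in> gwords X \<Longrightarrow>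
    gword_eval (presented_group X R) (pres_gen X R) u = pres_rel X R `` {u}"
proof (induction u)
  case Nil
  then show ?case by (simp add: gword_eval_def one_presented_group)
next
  case (Cons p u)
  obtain x b where p: "p = (x, b)" by (cases p)
  have "(if b then pres_gen X R x else inv\<^bsub>presented_group X R\<^esub> pres_gen X R x)
      = pres_rel X R `` {[(x, b)]}"
    using Cons.prems p by (simp add: inv_pres_gen) (simp add: pres_gen_def)
  then show ?case
    using Cons p presented_group_mult[of "[(x, b)]" X u R]
    by (simp add: gword_eval_def)
qed

lemma pres_gen_rel:
  assumes "(r, r') \<in> R" "r \<in> gwords X" "r' \<in> gwords X"
  shows "gword_eval (presented_group X R) (pres_gen X R) r
       = gword_eval (presented_group X R) (pres_gen X R) r'"
  using assms pres_rel.rel[of "[]" X "[]" r r' R]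
  by (simp add: gword_eval_pres_gen equiv_class_eq[OF equiv_pres_rel])

lemma presented_group_induct [consumes 1, case_names one gen inv_gen]:
  assumes "A \<in> carrier (presented_group X R)"
    and "P \<one>\<^bsub>presented_group X R\<^esub>"
    and gen: "\<And>x B. x \<in> X \<Longrightarrow> B \<in> carrier (presented_group X R) \<Longrightarrow> P B
          \<Longrightarrow> P (pres_gen X R x \<otimes>\<^bsub>presented_group X R\<^esub> B)"
    and inv_gen: "\<And>x B. x \<in> X \<Longrightarrow> B \<in> carrier (presented_group X R) \<Longrightarrow> P B
          \<Longrightarrow> P (inv\<^bsub>presented_group X R\<^esub> pres_gen X R x \<otimes>\<^bsub>presented_group X R\<^esub> B)"
  shows "P A"
proof -
  obtain u where u: "u \<in> gwords X" "A = pres_rel X R `` {u}"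
    using assms(1) by (auto simp: carrier_presented_group elim!: quotientE)
  have "P (pres_rel X R `` {u})"
    using u(1)
  proof (induction u)
    case Nil
    then show ?case using assms(2) by (simp add: one_presented_group)
  next
    case (Cons p u)
    obtain x b where p: "p = (x, b)" by (cases p)
    have *: "pres_rel X R `` {p # u}
        = pres_rel X R `` {[(x, b)]} \<otimes>\<^bsub>presented_group X R\<^esub> pres_rel X R `` {u}"
      using Cons.prems p by (simp add: presented_group_mult)
    have "pres_rel X R `` {u} \<in> carrier (presented_group X R)"
      using Cons.prems by (simp add: carrier_presented_group quotientI)
    then show ?case
      using Cons gen[of x] inv_gen[of x] p unfolding *
      by (cases b) (simp_all add: inv_pres_gen, simp add: pres_gen_def)
  qed
  then show ?thesis using u by simp
qed


section \<open>Reflection length and the absolute order\<close>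

locale reflection_group = group W for W (structure) +
  fixes S
  assumes S_closed: "S \<subseteq> carrier W"
    and S_square: "s \<in> S \<Longrightarrow> s \<otimes> s = \<one>"
    and generate_S: "generate W S = carrier W"
begin

abbreviation T where "T \<equiv> reflections W S"
abbreviation len where "len \<equiv> refl_length W S"

lemma T_closed: "t \<in> T \<Longrightarrow> t \<in> carrier W"
  using S_closed by (auto simp: reflections_def)

lemma S_subset_T: "S \<subseteq> T"
proof
  fix s assume "s \<in> S"
  moreover have "s = \<one> \<otimes> s \<otimes> inv \<one>" using \<open>s \<in> S\<close> S_closed by auto
  ultimately show "s \<in> T" unfolding reflections_def by blast
qed

lemma conj_mult:
  assumes "x \<in> carrier W" "y \<in> carrier W" "g \<in> carrier W"
  shows "g \<otimes> (x \<otimes> y) \<otimes> inv g = (g \<otimes> x \<otimes> inv g) \<otimes> (g \<otimes> y \<otimes> inv g)"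
  using assms by (simp add: m_assoc) (simp add: m_assoc[symmetric])

lemma T_square:
  assumes "t \<in> T" shows "t \<otimes> t = \<one>"
proof -
  obtain u s where us: "u \<in> carrier W" "s \<in> S" "t = u \<otimes> s \<otimes> inv u"
    using assms by (auto simp: reflections_def)
  then show ?thesis using conj_mult[of s s u] S_closed S_square by auto
qed

lemma T_inv: "t \<in> T \<Longrightarrow> inv t = t"
  using T_square T_closed by (intro inv_equality) auto

lemma T_conj:
  assumes "t \<in> T" "g \<in> carrier W"
  shows "g \<otimes> t \<otimes> inv g \<in> T"
proof -
  obtain u s where us: "u \<in> carrier W" "s \<in> S" "t = u \<otimes> s \<otimes> inv u"
    using assms by (auto simp: reflections_def)
  then have "g \<otimes> t \<otimes> inv g = (g \<otimes> u) \<otimes> s \<otimes> inv (g \<otimes> u)"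
    using assms S_closed by (auto simp: m_assoc inv_mult_group)
  then show ?thesis using us assms unfolding reflections_def by blast
qed

lemma T_conj': "t \<in> T \<Longrightarrow> g \<in> carrier W \<Longrightarrow> inv g \<otimes> t \<otimes> g \<in> T"
  using T_conj[of t "inv g"] by simp

lemma list_mult_closed: "set ts \<subseteq> carrier W \<Longrightarrow> list_mult W ts \<in> carrier W"
  by (induction ts) auto

lemma list_mult_append:
  "set ts \<subseteq> carrier W \<Longrightarrow> set us \<subseteq> carrier W \<Longrightarrow>
    list_mult W (ts @ us) = list_mult W ts \<otimes> list_mult W us"
  by (induction ts) (auto simp: list_mult_closed m_assoc)

lemma T_list_mult_closed: "set ts \<subseteq> T \<Longrightarrow> list_mult W ts \<in> carrier W"
  using T_closed by (intro list_mult_closed) auto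

lemma T_list_mult_append:
  "set ts \<subseteq> T \<Longrightarrow> set us \<subseteq> T \<Longrightarrow>
    list_mult W (ts @ us) = list_mult W ts \<otimes> list_mult W us"
  using T_closed by (intro list_mult_append) auto

lemma list_mult_conj:
  assumes "set ts \<subseteq> T" "g \<in> carrier W"
  shows "list_mult W (map (\<lambda>t. g \<otimes> t \<otimes> inv g) ts) = g \<otimes> list_mult W ts \<otimes> inv g"
  using assms
proof (induction ts)
  case (Cons t ts)
  then show ?case
    using conj_mult[of t "list_mult W ts" g] T_closed T_list_mult_closed by auto
qed auto

lemma T_word_exists:
  assumes "g \<in> carrier W"
  shows "\<exists>ts. set ts \<subseteq> T \<and> list_mult W ts = g"
proof -
  have "g \<in> generate W S" using assms generate_S by simp
  then show ?thesis
  proof (induction rule: generate.induct)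
    case one
    then show ?case by (intro exI[of _ "[]"]) auto
  next
    case (incl s)
    then show ?case using S_subset_T T_closed by (intro exI[of _ "[s]"]) auto
  next
    case (inv s)
    then have "s \<in> T" using S_subset_T by blast
    then show ?case using T_inv T_closed by (intro exI[of _ "[s]"]) auto
  next
    case (eng a b)
    then obtain ts us where "set ts \<subseteq> T" "list_mult W ts = a" "set us \<subseteq> T" "list_mult W us = b"
      by blast
    then show ?case by (intro exI[of _ "ts @ us"]) (auto simp: T_list_mult_append)
  qed
qed

lemma len_eq_Least: "len g = (LEAST k. \<exists>ts. length ts = k \<and> set ts \<subseteq> T \<and> list_mult W ts = g)"
proof -
  have "m_inv W ` T = T" using T_inv by force
  then show ?thesis by (simp add: refl_length_def word_length_def)
qed

lemma len_le: "set ts \<subseteq> T \<Longrightarrow> len (list_mult W ts) \<le> length ts"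
  unfolding len_eq_Least by (rule Least_le) blast

lemma reduced_word_exists:
  assumes "g \<in> carrier W"
  shows "\<exists>ts. length ts = len g \<and> set ts \<subseteq> T \<and> list_mult W ts = g"
proof -
  have "\<exists>k. \<exists>ts. length ts = k \<and> set ts \<subseteq> T \<and> list_mult W ts = g"
    using T_word_exists[OF assms] by blast
  then show ?thesis unfolding len_eq_Least by (rule LeastI_ex)
qed

lemma len_mult:
  assumes "g \<in> carrier W" "h \<in> carrier W"
  shows "len (g \<otimes> h) \<le> len g + len h"
proof -
  obtain ts us where "length ts = len g" "set ts \<subseteq> T" "list_mult W ts = g"
    "length us = len h" "set us \<subseteq> T" "list_mult W us = h"
    using reduced_word_exists assms by meson
  then show ?thesis using len_le[of "ts @ us"] by (simp add: T_list_mult_append)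
qed

lemma len_one: "len \<one> = 0"
  using len_le[of "[]"] by simp

lemma len_zero:
  assumes "g \<in> carrier W" "len g = 0"
  shows "g = \<one>"
  using reduced_word_exists[OF assms(1)] assms(2) by auto

lemma len_conj_le:
  assumes "u \<in> carrier W" "g \<in> carrier W"
  shows "len (g \<otimes> u \<otimes> inv g) \<le> len u"
proof -
  obtain ts where ts: "length ts = len u" "set ts \<subseteq> T" "list_mult W ts = u"
    using reduced_word_exists assms by meson
  have "set (map (\<lambda>t. g \<otimes> t \<otimes> inv g) ts) \<subseteq> T"
    using ts T_conj assms by auto
  from len_le[OF this] show ?thesis
    using ts list_mult_conj[OF ts(2) assms(2)] by simp
qed

lemma conj_inv_cancel:
  "u \<in> carrier W \<Longrightarrow> g \<in> carrier W \<Longrightarrow> inv g \<otimes> (g \<otimes> u \<otimes> inv g) \<otimes> g = u"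
  by (simp add: m_assoc) (simp add: m_assoc[symmetric])

lemma len_conj:
  assumes "u \<in> carrier W" "g \<in> carrier W"
  shows "len (g \<otimes> u \<otimes> inv g) = len u"
proof (rule antisym)
  show "len (g \<otimes> u \<otimes> inv g) \<le> len u" using assms by (rule len_conj_le)
  have "len (inv g \<otimes> (g \<otimes> u \<otimes> inv g) \<otimes> inv (inv g)) \<le> len (g \<otimes> u \<otimes> inv g)"
    using assms by (intro len_conj_le) auto
  then show "len u \<le> len (g \<otimes> u \<otimes> inv g)"
    using assms by (simp add: conj_inv_cancel)
qed

lemma len_conj': "u \<in> carrier W \<Longrightarrow> g \<in> carrier W \<Longrightarrow> len (inv g \<otimes> u \<otimes> g) = len u"
  using len_conj[of u "inv g"] by simp

lemma interval_closed: "u \<in> abs_interval W S w \<Longrightarrow> u \<in> carrier W"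
  by (simp add: abs_interval_def)

lemma interval_iff_factor:
  assumes "u \<in> carrier W" "v \<in> carrier W" "w = u \<otimes> v"
  shows "u \<in> abs_interval W S w \<longleftrightarrow> len w = len u + len v"
proof -
  have "inv u \<otimes> w = v" using assms by (simp add: m_assoc[symmetric])
  then show ?thesis using assms by (simp add: abs_interval_def abs_le_def)
qed

text \<open>Conjugation moves the left factor \<open>x\<close> to the right of \<open>y\<close> without changing its length, so that \<open>y\<close>
  too becomes a length-additive prefix of \<open>w\<close>.\<close>

lemma interval_factors:
  assumes "x \<in> carrier W" "y \<in> carrier W" "x \<otimes> y \<in> abs_interval W S w"
    and "len (x \<otimes> y) = len x + len y" and "w \<in> carrier W"
  shows "x \<in> abs_interval W S w" "y \<in> abs_interval W S w"
proof -
  define z where "z = inv (x \<otimes> y) \<otimes> w"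
  have z: "z \<in> carrier W" "w = x \<otimes> y \<otimes> z"
    using assms unfolding z_def by (simp_all add: m_assoc[symmetric])
  have lw: "len w = len x + len y + len z"
    using assms z interval_iff_factor[of "x \<otimes> y" z w] by simp
  have "len w \<le> len x + len (y \<otimes> z)" "len (y \<otimes> z) \<le> len y + len z"
    using len_mult[of x "y \<otimes> z"] len_mult[of y z] z assms by (auto simp: m_assoc)
  then show "x \<in> abs_interval W S w"
    using interval_iff_factor[of x "y \<otimes> z" w] assms z lw by (simp add: m_assoc)
  define x' where "x' = inv y \<otimes> x \<otimes> y"
  have x': "x' \<in> carrier W" "len x' = len x" "w = y \<otimes> (x' \<otimes> z)"
    using assms z unfolding x'_def by (simp_all add: len_conj' m_assoc[symmetric])
  have "len w \<le> len y + len (x' \<otimes> z)" "len (x' \<otimes> z) \<le> len x' + len z"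
    using len_mult[of y "x' \<otimes> z"] len_mult[of x' z] x' z assms by auto
  then show "y \<in> abs_interval W S w"
    using interval_iff_factor[of y "x' \<otimes> z" w] assms z x' lw by simp
qed

lemma interval_conj:
  assumes "u \<in> abs_interval W S w" "w \<in> carrier W"
  shows "w \<otimes> u \<otimes> inv w \<in> abs_interval W S w"
proof -
  define v where "v = inv u \<otimes> w"
  have u: "u \<in> carrier W" using assms interval_closed by blast
  then have v: "v \<in> carrier W" "w = u \<otimes> v"
    using assms unfolding v_def by (simp_all add: m_assoc[symmetric])
  then have lw: "len w = len u + len v" using assms u interval_iff_factor by blast
  have "w = (w \<otimes> u \<otimes> inv w) \<otimes> (w \<otimes> v \<otimes> inv w)"
    using u v assms conj_mult[of u v w] by (simp add: m_assoc)
  then show ?thesis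
    using interval_iff_factor[of "w \<otimes> u \<otimes> inv w" "w \<otimes> v \<otimes> inv w" w] u v assms lw
    by (simp add: len_conj)
qed

lemma subseq_set_subset: "subseq us ts \<Longrightarrow> set us \<subseteq> set ts"
  by (auto dest: list_emb_set)

text \<open>Dropping letters from a word in reflections: the dropped letters can be collected on the
  right at the price of conjugating them, which does not change their number.\<close>

lemma subseq_complement:
  assumes "subseq us ts" "set ts \<subseteq> T"
  shows "\<exists>vs. set vs \<subseteq> T \<and> length us + length vs = length ts
    \<and> list_mult W ts = list_mult W us \<otimes> list_mult W vs"
  using assms
proof (induction rule: list_emb.induct)
  case (list_emb_Nil ts)
  then show ?case using T_list_mult_closed by (intro exI[of _ ts]) auto
next
  case (list_emb_Cons us ts t)
  then obtain vs where vs: "set vs \<subseteq> T" "length us + length vs = length ts"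
    "list_mult W ts = list_mult W us \<otimes> list_mult W vs" by auto
  have us: "set us \<subseteq> T"
    using subseq_set_subset[OF list_emb_Cons.hyps] list_emb_Cons.prems by auto
  define u where "u = list_mult W us"
  have u: "u \<in> carrier W" using us T_list_mult_closed u_def by blast
  have t: "t \<in> T" "t \<in> carrier W" using list_emb_Cons T_closed by auto
  show ?case
  proof (intro exI[of _ "(inv u \<otimes> t \<otimes> u) # vs"] conjI)
    show "set ((inv u \<otimes> t \<otimes> u) # vs) \<subseteq> T" using vs T_conj'[OF t(1) u] by simp
    show "list_mult W (t # ts)
        = list_mult W us \<otimes> list_mult W ((inv u \<otimes> t \<otimes> u) # vs)"
      using vs u t T_list_mult_closed[of vs]
      by (simp add: u_def[symmetric] m_assoc[symmetric])
  qed (use vs in auto)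
next
  case (list_emb_Cons2 u t us ts)
  then obtain vs where vs: "set vs \<subseteq> T" "length us + length vs = length ts"
    "list_mult W ts = list_mult W us \<otimes> list_mult W vs" by auto
  have us: "set us \<subseteq> T"
    using subseq_set_subset[OF list_emb_Cons2.hyps(2)] list_emb_Cons2.prems by auto
  then show ?case
    using list_emb_Cons2 vs T_closed T_list_mult_closed
    by (intro exI[of _ vs]) (auto simp: m_assoc)
qed

lemma subseq_interval:
  assumes "subseq us ts" "set ts \<subseteq> T" "length ts = len (list_mult W ts)"
  shows "list_mult W us \<in> abs_interval W S (list_mult W ts)" "len (list_mult W us) = length us"
proof -
  obtain vs where vs: "set vs \<subseteq> T" "length us + length vs = length ts"
    "list_mult W ts = list_mult W us \<otimes> list_mult W vs"
    using subseq_complement[OF assms(1,2)] by blast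
  have us: "set us \<subseteq> T" using subseq_set_subset[OF assms(1)] assms(2) by blast
  have c: "list_mult W us \<in> carrier W" "list_mult W vs \<in> carrier W"
    using us vs T_list_mult_closed by auto
  have "len (list_mult W us) \<le> length us" "len (list_mult W vs) \<le> length vs"
    using us vs len_le by auto
  moreover have "len (list_mult W ts) \<le> len (list_mult W us) + len (list_mult W vs)"
    using vs(3) len_mult c by simp
  ultimately have *: "len (list_mult W us) = length us" "len (list_mult W vs) = length vs"
    using assms(3) vs by auto
  show "len (list_mult W us) = length us" by fact
  show "list_mult W us \<in> abs_interval W S (list_mult W ts)"
    using interval_iff_factor[OF c vs(3)] * assms(3) vs by simp
qed

end


section \<open>Homomorphisms out of an interval group\<close>

text \<open>A homomorphism from the interval group to \<open>K\<close> is recorded by its values \<open>D u\<close> on the generators, which have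
  only to respect the defining relations. This avoids computing with words in the presented group.\<close>

locale interval_map = reflection_group W S + K: group K
  for W :: "('a, 'b) monoid_scheme" (structure) and S and K :: "('c, 'd) monoid_scheme" +
  fixes w :: 'a and D :: "'a \<Rightarrow> 'c"
  assumes w_closed: "w \<in> carrier W"
    and D_closed: "u \<in> abs_interval W S w \<Longrightarrow> D u \<in> carrier K"
    and D_mult: "u \<in> abs_interval W S w \<Longrightarrow> v \<in> abs_interval W S w
      \<Longrightarrow> u \<otimes> v \<in> abs_interval W S w
      \<Longrightarrow> refl_length W S (u \<otimes> v) = refl_length W S u + refl_length W S v
      \<Longrightarrow> D (u \<otimes> v) = D u \<otimes>\<^bsub>K\<^esub> D v"
begin

abbreviation I where "I \<equiv> abs_interval W S w"

lemma D_factor: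
  assumes "x \<in> carrier W" "y \<in> carrier W" "x \<otimes> y \<in> I" "len (x \<otimes> y) = len x + len y"
  shows "D (x \<otimes> y) = D x \<otimes>\<^bsub>K\<^esub> D y" "D x \<in> carrier K" "D y \<in> carrier K"
  using D_mult D_closed interval_factors[OF assms w_closed] assms by auto

lemma one_in_I: "\<one> \<in> I"
  using w_closed interval_iff_factor[of \<one> w w] by (simp add: len_one)

lemma w_in_I: "w \<in> I"
  using w_closed interval_iff_factor[of w \<one> w] by (simp add: len_one)

lemma D_one: "D \<one> = \<one>\<^bsub>K\<^esub>"
proof -
  have "D \<one> \<otimes>\<^bsub>K\<^esub> D \<one> = D \<one>"
    using D_mult[OF one_in_I one_in_I] one_in_I by (simp add: len_one)
  then show ?thesis using D_closed[OF one_in_I] K.l_cancel_one by blast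
qed

lemma D_commute:
  assumes "t \<in> carrier W" "s \<in> carrier W" "t \<otimes> s \<in> I" "len (t \<otimes> s) = len t + len s"
    and "t \<otimes> s = s \<otimes> t"
  shows "D t \<otimes>\<^bsub>K\<^esub> D s = D s \<otimes>\<^bsub>K\<^esub> D t"
  using D_factor(1)[of t s] D_factor(1)[of s t] assms by simp

text \<open>Both \<open>t s = s r\<close> and \<open>t s = r t\<close> for the third reflection \<open>r\<close> of the dihedral group of \<open>t\<close> and \<open>s\<close>, and all
  these factorisations are length-additive.\<close>

lemma D_braid:
  assumes ts: "t \<in> T" "s \<in> T" and len1: "len t = 1" "len s = 1"
    and I: "t \<otimes> s \<in> I" "len (t \<otimes> s) = 2" and braid: "t \<otimes> s \<otimes> t = s \<otimes> t \<otimes> s"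
  shows "D t \<otimes>\<^bsub>K\<^esub> D s \<otimes>\<^bsub>K\<^esub> D t = D s \<otimes>\<^bsub>K\<^esub> D t \<otimes>\<^bsub>K\<^esub> D s"
proof -
  define r where "r = s \<otimes> t \<otimes> s"
  have c: "t \<in> carrier W" "s \<in> carrier W" "r \<in> carrier W" using ts T_closed r_def by auto
  have "len r = 1" using len_conj[of t s] c T_inv[OF ts(2)] len1 by (simp add: r_def)
  have sr: "s \<otimes> r = t \<otimes> s"
    using c T_square[OF ts(2)] by (simp add: r_def m_assoc[symmetric])
  have rt: "r \<otimes> t = t \<otimes> s"
    using c T_square[OF ts(1)] by (simp add: r_def braid[symmetric] m_assoc)
  have 1: "D t \<otimes>\<^bsub>K\<^esub> D s = D s \<otimes>\<^bsub>K\<^esub> D r"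
    using D_factor(1)[of t s] D_factor(1)[of s r] c I sr len1 \<open>len r = 1\<close> by simp
  have 2: "D r \<otimes>\<^bsub>K\<^esub> D t = D t \<otimes>\<^bsub>K\<^esub> D s"
    using D_factor(1)[of t s] D_factor(1)[of r t] c I rt len1 \<open>len r = 1\<close> by simp
  have Dc: "D t \<in> carrier K" "D s \<in> carrier K" "D r \<in> carrier K"
    using D_factor(2,3)[of t s] D_factor(2,3)[of r t] c I rt len1 \<open>len r = 1\<close> by auto
  have "D t \<otimes>\<^bsub>K\<^esub> D s \<otimes>\<^bsub>K\<^esub> D t = D s \<otimes>\<^bsub>K\<^esub> (D r \<otimes>\<^bsub>K\<^esub> D t)"
    using 1 Dc by (simp add: K.m_assoc)
  then show ?thesis using 2 Dc by (simp add: K.m_assoc)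
qed

text \<open>For \<open>v = w u\<^sup>-\<^sup>1\<close> both \<open>w = v u\<close> and \<open>w = (w u w\<^sup>-\<^sup>1) v\<close> are length-additive, so conjugation by
  \<open>D w\<close> realises conjugation by \<open>w\<close>.\<close>

lemma D_conj_w:
  assumes "u \<in> I"
  shows "D w \<otimes>\<^bsub>K\<^esub> D u = D (w \<otimes> u \<otimes> inv w) \<otimes>\<^bsub>K\<^esub> D w"
proof -
  have u: "u \<in> carrier W" using assms interval_closed by blast
  define v where "v = w \<otimes> inv u"
  define u' where "u' = w \<otimes> u \<otimes> inv w"
  have c: "v \<in> carrier W" "u' \<in> carrier W" using u w_closed v_def u'_def by auto
  have w1: "v \<otimes> u = w" using u w_closed v_def by (simp add: m_assoc)
  have w2: "u' \<otimes> v = w"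
    using u w_closed v_def u'_def by (simp add: m_assoc) (simp add: m_assoc[symmetric])
  have "w = u \<otimes> (inv u \<otimes> v \<otimes> u)"
    using w1 u c by (simp add: m_assoc[symmetric])
  then have "len w = len u + len v"
    using assms interval_iff_factor[of u "inv u \<otimes> v \<otimes> u" w] u c by (simp add: len_conj')
  then have l: "len w = len u' + len v" "len w = len v + len u"
    using len_conj[OF u w_closed] by (simp_all add: u'_def)
  have "D w = D u' \<otimes>\<^bsub>K\<^esub> D v" "D w = D v \<otimes>\<^bsub>K\<^esub> D u"
    "D u' \<in> carrier K" "D v \<in> carrier K" "D u \<in> carrier K"
    using D_factor[of u' v] D_factor[of v u] c u w1 w2 l w_in_I by auto
  then have "D w \<otimes>\<^bsub>K\<^esub> D u = D u' \<otimes>\<^bsub>K\<^esub> D w" by (metis K.m_assoc)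
  then show ?thesis by (simp add: u'_def)
qed

lemma D_power_conj_w:
  assumes "u \<in> I"
  shows "D w [^]\<^bsub>K\<^esub> (k::nat) \<otimes>\<^bsub>K\<^esub> D u
    = D (w [^] k \<otimes> u \<otimes> inv (w [^] k)) \<otimes>\<^bsub>K\<^esub> D w [^]\<^bsub>K\<^esub> k
    \<and> w [^] k \<otimes> u \<otimes> inv (w [^] k) \<in> I"
proof (induction k)
  case 0
  then show ?case using assms interval_closed D_closed by simp
next
  case (Suc k)
  define u' where "u' = w [^] k \<otimes> u \<otimes> inv (w [^] k)"
  have u: "u \<in> carrier W" using assms interval_closed by blast
  have u': "u' \<in> I" "D w [^]\<^bsub>K\<^esub> k \<otimes>\<^bsub>K\<^esub> D u = D u' \<otimes>\<^bsub>K\<^esub> D w [^]\<^bsub>K\<^esub> k"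
    using Suc u'_def by auto
  have eq: "w [^] Suc k \<otimes> u \<otimes> inv (w [^] Suc k) = w \<otimes> u' \<otimes> inv w"
  proof -
    have "w [^] Suc k = w \<otimes> w [^] k" using w_closed by (rule nat_pow_Suc2)
    then show ?thesis
      using u w_closed by (simp add: u'_def inv_mult_group m_assoc)
  qed
  have I: "w \<otimes> u' \<otimes> inv w \<in> I" using interval_conj u' w_closed by blast
  have c: "D w \<in> carrier K" "D u \<in> carrier K" "D u' \<in> carrier K"
    "D (w \<otimes> u' \<otimes> inv w) \<in> carrier K"
    using D_closed w_in_I assms u' I by auto
  have pw: "D w [^]\<^bsub>K\<^esub> Suc k = D w \<otimes>\<^bsub>K\<^esub> D w [^]\<^bsub>K\<^esub> k"
    using c by (intro K.nat_pow_Suc2)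
  have "D w [^]\<^bsub>K\<^esub> Suc k \<otimes>\<^bsub>K\<^esub> D u = D w \<otimes>\<^bsub>K\<^esub> (D w [^]\<^bsub>K\<^esub> k \<otimes>\<^bsub>K\<^esub> D u)"
    using c by (simp only: pw K.m_assoc K.nat_pow_closed)
  also have "\<dots> = D w \<otimes>\<^bsub>K\<^esub> D u' \<otimes>\<^bsub>K\<^esub> D w [^]\<^bsub>K\<^esub> k"
    using u' c by (simp add: K.m_assoc)
  also have "\<dots> = D (w \<otimes> u' \<otimes> inv w) \<otimes>\<^bsub>K\<^esub> (D w \<otimes>\<^bsub>K\<^esub> D w [^]\<^bsub>K\<^esub> k)"
    using D_conj_w[OF u'(1)] c by (simp add: K.m_assoc)
  also have "D w \<otimes>\<^bsub>K\<^esub> D w [^]\<^bsub>K\<^esub> k = D w [^]\<^bsub>K\<^esub> Suc k"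
    by (rule pw[symmetric])
  finally show ?case using eq I by simp
qed

end

text \<open>Each step conjugates by an element for which the interval group of the product of \<open>ts\<close> has a relation that
  realises the conjugation: by letters that follow \<open>t\<close> in \<open>ts\<close>, past which \<open>t\<close> can be moved, or by the whole
  product.\<close>

inductive_set (in group) reachable :: "'a list \<Rightarrow> 'a set" for ts where
  base: "t \<in> set ts \<Longrightarrow> t \<in> reachable ts"
| shift: "subseq (t # vs) ts \<Longrightarrow> inv (list_mult G vs) \<otimes> t \<otimes> list_mult G vs \<in> reachable ts"
| conj: "r \<in> reachable ts \<Longrightarrow>
    list_mult G ts \<otimes> r \<otimes> inv (list_mult G ts) \<in> reachable ts"

locale reduced_interval_map = interval_map +
  fixes ts
  assumes ts_T: "set ts \<subseteq> reflections W S"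
    and w_eq: "w = list_mult W ts"
    and ts_reduced: "length ts = refl_length W S w"
begin

lemma subseq_in_I: "subseq us ts \<Longrightarrow> list_mult W us \<in> I"
  and subseq_len: "subseq us ts \<Longrightarrow> len (list_mult W us) = length us"
  using subseq_interval[of us ts] ts_T w_eq ts_reduced by auto

lemma subseq_T: "subseq us ts \<Longrightarrow> set us \<subseteq> T"
  using subseq_set_subset ts_T by blast

lemma letter_I: "t \<in> set ts \<Longrightarrow> t \<in> I" and letter_len: "t \<in> set ts \<Longrightarrow> len t = 1"
proof -
  assume "t \<in> set ts"
  then have "subseq [t] ts" by (simp add: subseq_singleton_left)
  moreover have "list_mult W [t] = t" using \<open>t \<in> set ts\<close> ts_T T_closed by auto
  ultimately show "t \<in> I" "len t = 1" using subseq_in_I[of "[t]"] subseq_len[of "[t]"] by auto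
qed

lemma pair_facts:
  assumes "subseq [t, s] ts"
  shows "t \<in> T" "s \<in> T" "t \<in> carrier W" "s \<in> carrier W" "len t = 1" "len s = 1"
    "t \<otimes> s \<in> I" "len (t \<otimes> s) = 2"
proof -
  have m: "t \<in> set ts" "s \<in> set ts" using subseq_set_subset[OF assms] by auto
  then show *: "t \<in> T" "s \<in> T" "t \<in> carrier W" "s \<in> carrier W" "len t = 1" "len s = 1"
    using ts_T T_closed letter_len by auto
  have "list_mult W [t, s] = t \<otimes> s" using * by simp
  then show "t \<otimes> s \<in> I" "len (t \<otimes> s) = 2"
    using subseq_in_I[OF assms] subseq_len[OF assms] by auto
qed

lemma D_pair_commute:
  "subseq [t, s] ts \<Longrightarrow> t \<otimes> s = s \<otimes> t \<Longrightarrow> D t \<otimes>\<^bsub>K\<^esub> D s = D s \<otimes>\<^bsub>K\<^esub> D t"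
  using D_commute[of t s] pair_facts[of t s] by simp

lemma D_pair_braid:
  "subseq [t, s] ts \<Longrightarrow> t \<otimes> s \<otimes> t = s \<otimes> t \<otimes> s \<Longrightarrow>
    D t \<otimes>\<^bsub>K\<^esub> D s \<otimes>\<^bsub>K\<^esub> D t = D s \<otimes>\<^bsub>K\<^esub> D t \<otimes>\<^bsub>K\<^esub> D s"
  using D_braid[of t s] pair_facts[of t s] by simp

context
  fixes z
  assumes const: "\<And>t. t \<in> set ts \<Longrightarrow> D t = z" and z: "z \<in> carrier K"
begin

lemma D_subseq_const: "subseq us ts \<Longrightarrow> D (list_mult W us) = z [^]\<^bsub>K\<^esub> length us"
proof (induction us)
  case Nil
  then show ?case by (simp add: D_one)
next
  case (Cons t us)
  have us: "subseq us ts" using Cons.prems by (metis subseq_Cons')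
  have t: "t \<in> set ts" using subseq_set_subset[OF Cons.prems] by simp
  have c: "t \<in> carrier W" "list_mult W us \<in> carrier W"
    using t ts_T T_closed T_list_mult_closed subseq_T[OF us] by auto
  have "D (t \<otimes> list_mult W us) = D t \<otimes>\<^bsub>K\<^esub> D (list_mult W us)"
    using D_factor(1)[OF c] subseq_in_I[OF Cons.prems] subseq_len[OF Cons.prems]
      subseq_len[OF us] letter_len[OF t] by simp
  then show ?case
    using Cons.IH[OF us] const[OF t] K.nat_pow_Suc2[OF z, of "length us"] by simp
qed

text \<open>Both ways of producing new reflections conjugate a value \<open>z\<close> of \<open>D\<close> by a power of \<open>z\<close>, since \<open>D\<close> is a power of
  \<open>z\<close> on the subwords of \<open>ts\<close>.\<close>

lemma reachable_const: "r \<in> reachable ts \<Longrightarrow> r \<in> I \<and> len r = 1 \<and> D r = z"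
proof (induction rule: reachable.induct)
  case (base t)
  then show ?case using letter_I letter_len const by simp
next
  case (shift t vs)
  have vs: "subseq vs ts" using shift by (metis subseq_Cons')
  have t: "t \<in> set ts" using subseq_set_subset[OF shift] by simp
  define v where "v = list_mult W vs"
  define r where "r = inv v \<otimes> t \<otimes> v"
  have c: "t \<in> carrier W" "v \<in> carrier W" "r \<in> carrier W"
    using t ts_T T_closed T_list_mult_closed subseq_T[OF vs] by (auto simp: v_def r_def)
  have vr: "v \<otimes> r = t \<otimes> v" using c by (simp add: r_def m_assoc[symmetric])
  have lr: "len r = 1" using len_conj'[of t v] c letter_len[OF t] by (simp add: r_def)
  have tv: "t \<otimes> v \<in> I" "len (t \<otimes> v) = 1 + len v"
    using subseq_in_I[OF shift] subseq_len[OF shift] subseq_len[OF vs] by (simp_all add: v_def)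
  have "r \<in> I" using interval_factors(2)[of v r w] c vr tv lr w_closed by simp
  have "D v \<otimes>\<^bsub>K\<^esub> D r = D t \<otimes>\<^bsub>K\<^esub> D v"
    using D_factor(1)[of v r] D_factor(1)[of t v] c vr tv lr letter_len[OF t] by simp
  then have "z [^]\<^bsub>K\<^esub> length vs \<otimes>\<^bsub>K\<^esub> D r = z [^]\<^bsub>K\<^esub> length vs \<otimes>\<^bsub>K\<^esub> z"
    using D_subseq_const[OF vs] const[OF t] z by (simp add: v_def K.nat_pow_Suc2[symmetric])
  then have "D r = z" using z D_closed[OF \<open>r \<in> I\<close>] by simp
  then show ?case using \<open>r \<in> I\<close> lr by (simp add: r_def v_def)
next
  case (conj r)
  have w: "list_mult W ts = w" by (simp add: w_eq)
  have c: "r \<in> carrier W" using conj interval_closed by blast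
  have I': "w \<otimes> r \<otimes> inv w \<in> I" using interval_conj conj w_closed by blast
  have "D w = z [^]\<^bsub>K\<^esub> length ts" using D_subseq_const[of ts] w by simp
  then have "D (w \<otimes> r \<otimes> inv w) \<otimes>\<^bsub>K\<^esub> z [^]\<^bsub>K\<^esub> length ts = z \<otimes>\<^bsub>K\<^esub> z [^]\<^bsub>K\<^esub> length ts"
    using D_conj_w[of r] conj z by (simp add: K.nat_pow_Suc2[symmetric])
  then have "D (w \<otimes> r \<otimes> inv w) = z" using z D_closed[OF I'] by simp
  then show ?case using I' conj len_conj[OF c w_closed] w by simp
qed

text \<open>A reduced word of \<open>u\<close> consists of reflections, on each of which \<open>D\<close> takes the value \<open>z\<close>; its prefixes
  and suffixes stay in the interval.\<close>

lemma D_const_power: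
  assumes "T \<subseteq> reachable ts" "u \<in> I"
  shows "D u = z [^]\<^bsub>K\<^esub> len u"
  using assms(2)
proof (induction "len u" arbitrary: u)
  case 0
  then have "u = \<one>" using len_zero interval_closed by metis
  then show ?case by (simp add: D_one len_one)
next
  case (Suc k)
  have u: "u \<in> carrier W" using Suc interval_closed by blast
  obtain t us where us: "length us = k" "t \<in> T" "set us \<subseteq> T" "u = t \<otimes> list_mult W us"
    using reduced_word_exists[OF u] Suc(2)[symmetric] by (auto simp: length_Suc_conv)
  define v where "v = list_mult W us"
  have c: "t \<in> carrier W" "v \<in> carrier W"
    using us T_closed T_list_mult_closed by (auto simp: v_def)
  have t: "len t = 1" "D t = z" using reachable_const assms us by auto
  have "len v \<le> k" using len_le us by (auto simp: v_def)
  then have lv: "len v = k" "len u = len t + len v"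
    using len_mult[OF c] Suc(2) us t by (auto simp: v_def)
  then have "v \<in> I" using interval_factors(2)[of t v w] c Suc us w_closed by (simp add: v_def)
  then have "D v = z [^]\<^bsub>K\<^esub> k" using Suc(1)[of v] lv by simp
  moreover have "D u = D t \<otimes>\<^bsub>K\<^esub> D v"
    using D_factor(1)[OF c] Suc(3) us lv by (simp add: v_def)
  ultimately show ?case using t Suc(2)[symmetric] K.nat_pow_Suc2[OF z, of k] by simp
qed

end

end


section \<open>Signed permutations\<close>

text \<open>The reflection in the root \<open>e\<^sub>u - e\<^sub>v\<close>, with the convention \<open>e\<^bsub>-u\<^esub> = - e\<^sub>u\<close>.\<close>

definition sref :: "int \<Rightarrow> int \<Rightarrow> int \<Rightarrow> int" where
  "sref u v x = (if x = u then v else if x = v then u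
     else if x = - u then - v else if x = - v then - u else x)"

definition signed_perm :: "nat \<Rightarrow> (int \<Rightarrow> int) \<Rightarrow> bool" where
  "signed_perm n f \<longleftrightarrow> bij f \<and> (\<forall>x. f (- x) = - f x) \<and> (\<forall>x. \<bar>x\<bar> > int n \<longrightarrow> f x = x)"

definition letter_pair :: "nat \<Rightarrow> int \<Rightarrow> int \<Rightarrow> bool" where
  "letter_pair n u v \<longleftrightarrow> u \<noteq> 0 \<and> v \<noteq> 0 \<and> \<bar>u\<bar> \<noteq> \<bar>v\<bar> \<and> \<bar>u\<bar> \<le> int n \<and> \<bar>v\<bar> \<le> int n"

lemma sref_invol:
  "\<bar>u\<bar> \<noteq> \<bar>v\<bar> \<Longrightarrow> u \<noteq> 0 \<Longrightarrow> v \<noteq> 0 \<Longrightarrow> sref u v (sref u v x) = x"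
  by (auto simp: sref_def)

lemma sref_invol_comp:
  "\<bar>u\<bar> \<noteq> \<bar>v\<bar> \<Longrightarrow> u \<noteq> 0 \<Longrightarrow> v \<noteq> 0 \<Longrightarrow> sref u v \<circ> sref u v = id"
  by (auto simp: sref_invol)

lemma sref_sym: "sref u v = sref v u"
  by (auto simp: sref_def fun_eq_iff)

lemma sref_uminus: "\<bar>u\<bar> \<noteq> \<bar>v\<bar> \<Longrightarrow> u \<noteq> 0 \<Longrightarrow> v \<noteq> 0 \<Longrightarrow> sref (- u) (- v) = sref u v"
  by (auto simp: sref_def fun_eq_iff)

lemma sref_apply [simp]: "sref u v u = v" "sref u v v = u"
  by (auto simp: sref_def)

lemma sref_other: "\<bar>x\<bar> \<noteq> \<bar>u\<bar> \<Longrightarrow> \<bar>x\<bar> \<noteq> \<bar>v\<bar> \<Longrightarrow> sref u v x = x"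
  by (auto simp: sref_def)

lemma sref_odd: "\<bar>u\<bar> \<noteq> \<bar>v\<bar> \<Longrightarrow> u \<noteq> 0 \<Longrightarrow> v \<noteq> 0 \<Longrightarrow> sref u v (- x) = - sref u v x"
  by (auto simp: sref_def)

lemma signed_perm_sref: "letter_pair n u v \<Longrightarrow> signed_perm n (sref u v)"
  unfolding signed_perm_def letter_pair_def
  by (auto simp: sref_odd sref_invol_comp intro!: o_bij[of "sref u v"] sref_other)

lemma signed_permD:
  assumes "signed_perm n f"
  shows "bij f" "f (- x) = - f x" "f 0 = 0" "int n < \<bar>x\<bar> \<Longrightarrow> f x = x"
    "f x = f y \<longleftrightarrow> x = y" "\<bar>f x\<bar> = \<bar>f y\<bar> \<longleftrightarrow> \<bar>x\<bar> = \<bar>y\<bar>" "\<bar>f x\<bar> \<le> int n \<longleftrightarrow> \<bar>x\<bar> \<le> int n"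
    "f x = 0 \<longleftrightarrow> x = 0"
proof -
  show b: "bij f" and odd: "f (- x) = - f x" for x
    using assms by (auto simp: signed_perm_def)
  show big: "int n < \<bar>x\<bar> \<Longrightarrow> f x = x" for x using assms by (auto simp: signed_perm_def)
  show inj: "f x = f y \<longleftrightarrow> x = y" for x y using b by (simp add: bij_is_inj inj_eq)
  show f0: "f 0 = 0" using odd[of 0] by simp
  show "f x = 0 \<longleftrightarrow> x = 0" using inj[of x 0] f0 by simp
  show "\<bar>f x\<bar> = \<bar>f y\<bar> \<longleftrightarrow> \<bar>x\<bar> = \<bar>y\<bar>"
    using inj[of x y] inj[of x "- y"] odd[of y] by (simp add: abs_eq_iff)
  show "\<bar>f x\<bar> \<le> int n \<longleftrightarrow> \<bar>x\<bar> \<le> int n"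
    using big[of "f x"] big[of x] inj[of "f x" x] by (metis not_le)
qed

lemma signed_perm_id: "signed_perm n id"
  by (auto simp: signed_perm_def)

lemma signed_perm_comp: "signed_perm n f \<Longrightarrow> signed_perm n g \<Longrightarrow> signed_perm n (f \<circ> g)"
  by (auto simp: signed_perm_def bij_comp)

lemma signed_perm_pow: "signed_perm n f \<Longrightarrow> signed_perm n (f ^^ k)"
  by (induction k) (auto simp: signed_perm_id signed_perm_comp)

lemma signed_perm_letter_pair:
  "signed_perm n f \<Longrightarrow> letter_pair n u v \<Longrightarrow> letter_pair n (f u) (f v)"
  by (auto simp: letter_pair_def signed_permD)

lemma signed_perm_eqI:
  assumes "signed_perm n f" "signed_perm n g"
    and "\<And>x. x \<in> {1..int n} \<Longrightarrow> f x = g x"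
  shows "f = g"
proof
  fix x
  consider "\<bar>x\<bar> > int n" | "x = 0" | "x \<in> {1..int n}" | "- x \<in> {1..int n}" by fastforce
  then show "f x = g x"
  proof cases
    case 4
    then have "f (- x) = g (- x)" by (rule assms(3))
    then show ?thesis using assms(1,2) by (simp add: signed_permD)
  qed (use assms in \<open>simp_all add: signed_permD\<close>)
qed

lemma sref_conj:
  assumes inj: "\<And>x y. f x = f y \<longleftrightarrow> x = y" and odd: "\<And>x. f (- x) = - f x"
  shows "f \<circ> sref u v = sref (f u) (f v) \<circ> f"
proof
  fix x
  have "f x = - f y \<longleftrightarrow> x = - y" for y using inj[of x "- y"] odd[of y] by simp
  then show "(f \<circ> sref u v) x = (sref (f u) (f v) \<circ> f) x"
    by (simp add: sref_def inj odd)
qed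

lemma signed_perm_sref_conj:
  "signed_perm n f \<Longrightarrow> f \<circ> sref u v = sref (f u) (f v) \<circ> f"
  by (intro sref_conj) (simp_all add: signed_permD)

lemma sref_move:
  assumes "\<bar>u\<bar> \<noteq> \<bar>v\<bar>" "u \<noteq> 0" "v \<noteq> 0"
  shows "sref u v \<circ> sref x y = sref (sref u v x) (sref u v y) \<circ> sref u v"
  using assms by (intro sref_conj) (metis sref_invol, simp add: sref_odd)

lemma sref_commute:
  assumes "\<bar>u\<bar> \<noteq> \<bar>v\<bar>" "u \<noteq> 0" "v \<noteq> 0"
    "\<bar>x\<bar> \<noteq> \<bar>u\<bar>" "\<bar>x\<bar> \<noteq> \<bar>v\<bar>" "\<bar>y\<bar> \<noteq> \<bar>u\<bar>" "\<bar>y\<bar> \<noteq> \<bar>v\<bar>"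
  shows "sref u v \<circ> sref x y = sref x y \<circ> sref u v"
  using sref_move[OF assms(1-3), of x y] assms by (simp add: sref_other)

lemma sref_commute_opp:
  assumes "\<bar>u\<bar> \<noteq> \<bar>v\<bar>" "u \<noteq> 0" "v \<noteq> 0"
  shows "sref u v \<circ> sref u (- v) = sref u (- v) \<circ> sref u v"
proof -
  have "sref v (- u) = sref u (- v)"
    using sref_uminus[of u "- v"] assms by (simp add: sref_sym)
  then show ?thesis
    using sref_move[OF assms, of u "- v"] assms by (simp add: sref_odd)
qed

lemma sref_braid:
  assumes "\<bar>u\<bar> \<noteq> \<bar>v\<bar>" "\<bar>v\<bar> \<noteq> \<bar>x\<bar>" "\<bar>u\<bar> \<noteq> \<bar>x\<bar>" "u \<noteq> 0" "v \<noteq> 0" "x \<noteq> 0"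
  shows "sref u v \<circ> sref v x \<circ> sref u v = sref u x"
    and "sref v x \<circ> sref u v \<circ> sref v x = sref u x"
proof -
  have "sref u v \<circ> sref v x \<circ> sref u v = sref u x \<circ> (sref u v \<circ> sref u v)"
    using sref_move[of u v v x] assms by (simp add: sref_other o_assoc)
  then show "sref u v \<circ> sref v x \<circ> sref u v = sref u x"
    using assms by (simp add: sref_invol_comp)
  have "sref v x \<circ> sref u v \<circ> sref v x = sref u x \<circ> (sref v x \<circ> sref v x)"
    using sref_move[of v x u v] assms by (simp add: sref_other o_assoc)
  then show "sref v x \<circ> sref u v \<circ> sref v x = sref u x"
    using assms by (simp add: sref_invol_comp)
qed


section \<open>The Coxeter group of type D as a group of signed permutations\<close>

locale type_D =
  fixes n :: nat
  assumes n_ge: "n \<ge> 5"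
begin

abbreviation W where "W \<equiv> W_D n"

definition s :: "nat \<Rightarrow> nat gword set" where
  "s = pres_gen {1..n} (coxeter_rels {1..n} (D_matrix n))"

sublocale W: group W
  by (simp add: W_D_def coxeter_group_def group_presented_group)

lemma W_eq: "W = presented_group {1..n} (coxeter_rels {1..n} (D_matrix n))"
  by (simp add: W_D_def coxeter_group_def)

lemma S_eq: "S_D n = s ` {1..n}"
  by (simp add: S_D_def coxeter_gens_def s_def)

lemma s_closed [simp]: "i \<in> {1..n} \<Longrightarrow> s i \<in> carrier W"
  unfolding W_eq s_def by (rule pres_gen_closed)

definition adjacent :: "nat \<Rightarrow> nat \<Rightarrow> bool" where
  "adjacent i j \<longleftrightarrow> (j = i + 1 \<and> i \<le> n - 2) \<or> (i = j + 1 \<and> j \<le> n - 2)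
     \<or> (i = n - 2 \<and> j = n) \<or> (j = n - 2 \<and> i = n)"

lemma D_matrix_eq:
  assumes "i \<in> {1..n}" "j \<in> {1..n}"
  shows "D_matrix n i j = (if adjacent i j then 3 else 2)"
proof -
  have "{i, j} \<in> D_edges n \<longleftrightarrow> adjacent i j"
    using assms n_ge by (auto simp: D_edges_def adjacent_def doubleton_eq_iff)
  then show ?thesis by (simp add: D_matrix_def)
qed

lemma W_relation:
  assumes "(r, []) \<in> coxeter_rels {1..n} (D_matrix n)"
  shows "gword_eval W s r = \<one>\<^bsub>W\<^esub>"
proof -
  have "gword_eval W s r = gword_eval W s []"
    unfolding W_eq s_def
    using assms coxeter_rels_wf[of "{1..n}" "D_matrix n"] by (intro pres_gen_rel) auto
  then show ?thesis by (simp add: gword_eval_def)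
qed

lemma s_square: "i \<in> {1..n} \<Longrightarrow> s i \<otimes>\<^bsub>W\<^esub> s i = \<one>\<^bsub>W\<^esub>"
  using W_relation[of "[(i, True), (i, True)]"] by (simp add: coxeter_rels_def gword_eval_def)

lemma s_inv: "i \<in> {1..n} \<Longrightarrow> inv\<^bsub>W\<^esub> (s i) = s i"
  using s_square by (intro W.inv_equality) simp_all

lemma s_relation:
  assumes "i \<in> {1..n}" "j \<in> {1..n}" "i \<noteq> j"
  shows "gword_eval W s (concat (replicate (D_matrix n i j) [(i, True), (j, True)])) = \<one>\<^bsub>W\<^esub>"
  by (rule W_relation) (use assms in \<open>unfold coxeter_rels_def, blast\<close>)

lemma s_commute:
  assumes "i \<in> {1..n}" "j \<in> {1..n}" "\<not> adjacent i j"
  shows "s i \<otimes>\<^bsub>W\<^esub> s j = s j \<otimes>\<^bsub>W\<^esub> s i"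
proof (cases "i = j")
  case False
  have "s i \<otimes>\<^bsub>W\<^esub> s j \<otimes>\<^bsub>W\<^esub> (s i \<otimes>\<^bsub>W\<^esub> s j) = \<one>\<^bsub>W\<^esub>"
    using s_relation[OF assms(1,2) False] assms
    by (simp add: D_matrix_eq numeral_2_eq_2 gword_eval_def W.m_assoc)
  then have "inv\<^bsub>W\<^esub> (s i \<otimes>\<^bsub>W\<^esub> s j) = s i \<otimes>\<^bsub>W\<^esub> s j"
    using assms by (intro W.inv_equality) auto
  moreover have "inv\<^bsub>W\<^esub> (s i) = s i" "inv\<^bsub>W\<^esub> (s j) = s j"
    using assms s_inv by blast+
  ultimately show ?thesis using assms by (simp add: W.inv_mult_group)
qed simp

lemma s_braid:
  assumes "i \<in> {1..n}" "j \<in> {1..n}" "adjacent i j"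
  shows "s i \<otimes>\<^bsub>W\<^esub> s j \<otimes>\<^bsub>W\<^esub> s i = s j \<otimes>\<^bsub>W\<^esub> s i \<otimes>\<^bsub>W\<^esub> s j"
proof -
  have "i \<noteq> j" using assms n_ge by (auto simp: adjacent_def)
  have "(s i \<otimes>\<^bsub>W\<^esub> s j \<otimes>\<^bsub>W\<^esub> s i) \<otimes>\<^bsub>W\<^esub> (s j \<otimes>\<^bsub>W\<^esub> s i \<otimes>\<^bsub>W\<^esub> s j) = \<one>\<^bsub>W\<^esub>"
    using s_relation[OF assms(1,2) \<open>i \<noteq> j\<close>] assms
    by (simp add: D_matrix_eq numeral_3_eq_3 gword_eval_def W.m_assoc)
  then have "inv\<^bsub>W\<^esub> (s j \<otimes>\<^bsub>W\<^esub> s i \<otimes>\<^bsub>W\<^esub> s j) = s i \<otimes>\<^bsub>W\<^esub> s j \<otimes>\<^bsub>W\<^esub> s i"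
    using assms by (intro W.inv_equality) auto
  moreover have "inv\<^bsub>W\<^esub> (s i) = s i" "inv\<^bsub>W\<^esub> (s j) = s j"
    using assms s_inv by blast+
  ultimately show ?thesis using assms by (simp add: W.inv_mult_group W.m_assoc)
qed

subsection \<open>The signed permutation of an element\<close>

definition sgen :: "nat \<Rightarrow> int \<Rightarrow> int" where
  "sgen i = (if i < n then sref (int i) (int i + 1) else sref (int n - 1) (- int n))"

lemma sgen_pair:
  assumes "i \<in> {1..n}"
  obtains u v where "sgen i = sref u v" "letter_pair n u v"
  using assms n_ge that[of "int i" "int i + 1"] that[of "int n - 1" "- int n"]
  by (cases "i < n") (auto simp: sgen_def letter_pair_def)

lemma sgen_square: "i \<in> {1..n} \<Longrightarrow> sgen i \<circ> sgen i = id"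
  by (metis sgen_pair sref_invol_comp letter_pair_def)

lemma sgen_signed_perm: "i \<in> {1..n} \<Longrightarrow> signed_perm n (sgen i)"
  by (metis sgen_pair signed_perm_sref)

lemma sgen_braid:
  assumes "i \<in> {1..n}" "j \<in> {1..n}" "adjacent i j"
  shows "sgen i \<circ> sgen j \<circ> sgen i = sgen j \<circ> sgen i \<circ> sgen j"
proof -
  have *: "sgen i \<circ> sgen (i + 1) \<circ> sgen i = sgen (i + 1) \<circ> sgen i \<circ> sgen (i + 1)"
    if "1 \<le> i" "i \<le> n - 2" for i
  proof -
    have "int (i + 1) = int i + 1" "int (i + 1) + 1 = int i + 2" by simp_all
    then show ?thesis
      using sref_braid[of "int i" "int i + 1" "int i + 2"] that n_ge by (simp only: sgen_def) auto
  qed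
  have **: "sgen (n - 2) \<circ> sgen n \<circ> sgen (n - 2) = sgen n \<circ> sgen (n - 2) \<circ> sgen n"
  proof -
    have "int (n - 2) + 1 = int n - 1" "int (n - 2) = int n - 2"
      using n_ge by (simp_all add: of_nat_diff)
    then show ?thesis
      using sref_braid[of "int n - 2" "int n - 1" "- int n"] n_ge by (simp add: sgen_def)
  qed
  show ?thesis
    using assms *[of i] *[of j] ** n_ge by (auto simp: adjacent_def)
qed

lemma sgen_commute:
  assumes "i \<in> {1..n}" "j \<in> {1..n}" "\<not> adjacent i j"
  shows "sgen i \<circ> sgen j = sgen j \<circ> sgen i"
proof -
  have *: "sgen i \<circ> sgen j = sgen j \<circ> sgen i"
    if ij: "i \<in> {1..n}" "j \<in> {1..n}" "\<not> adjacent i j" "i < j" for i j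
  proof (cases "j = n")
    case False
    then have "i + 1 < j" "j < n" using ij n_ge by (auto simp: adjacent_def)
    then show ?thesis
      using sref_commute[of "int i" "int i + 1" "int j" "int j + 1"] ij by (simp add: sgen_def)
  next
    case True
    show ?thesis
    proof (cases "i = n - 1")
      case True
      then have "int i = int n - 1" using n_ge by simp
      then show ?thesis
        using sref_commute_opp[of "int n - 1" "int n"] n_ge True \<open>j = n\<close> by (simp add: sgen_def)
    next
      case False
      then have "i + 1 < n - 1" using ij n_ge \<open>j = n\<close> by (auto simp: adjacent_def)
      then show ?thesis
        using sref_commute[of "int i" "int i + 1" "int n - 1" "- int n"] \<open>j = n\<close> ij
        by (simp add: sgen_def)
    qed
  qed
  consider "i < j" | "i = j" | "j < i" by linarith
  then show ?thesis
    using *[OF assms] *[OF assms(2,1)] assms(3) by cases (auto simp: adjacent_def)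
qed

text \<open>The Coxeter relations hold for the maps \<open>sgen i\<close>: these are involutions, and a product of two
  involutions has order dividing \<open>3\<close> or \<open>2\<close> if they braid or commute.\<close>

lemma rho_exists: "\<exists>h \<in> hom W bij_group. \<forall>i\<in>{1..n}. h (s i) = sgen i"
  unfolding W_eq s_def
proof (rule group.presented_group_universal[OF group_bij_group])
  show "sgen \<in> {1..n} \<rightarrow> carrier bij_group"
    using sgen_signed_perm by (auto simp: signed_perm_def)
next
  fix r r' assume "(r, r') \<in> coxeter_rels {1..n} (D_matrix n)"
  then consider i where "i \<in> {1..n}" "r = [(i, True), (i, True)]" "r' = []"
    | i j where "i \<in> {1..n}" "j \<in> {1..n}" "i \<noteq> j"
      "r = concat (replicate (D_matrix n i j) [(i, True), (j, True)])" "r' = []"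
    by (auto simp: coxeter_rels_def)
  then show "gword_eval bij_group sgen r = gword_eval bij_group sgen r'"
  proof cases
    case 1
    then show ?thesis using sgen_square by (simp add: gword_eval_def)
  next
    case (2 i j)
    have c: "sgen k (sgen k x) = x" if "k \<in> {1..n}" for k x
      using sgen_square[OF that] by (metis comp_apply id_apply)
    show ?thesis
    proof (cases "adjacent i j")
      case True
      have "sgen i (sgen j (sgen i x)) = sgen j (sgen i (sgen j x))" for x
        using sgen_braid[OF 2(1,2) True] by (metis comp_apply)
      then show ?thesis
        using 2 c True by (simp add: D_matrix_eq numeral_3_eq_3 gword_eval_def fun_eq_iff)
    next
      case False
      have "sgen i (sgen j x) = sgen j (sgen i x)" for x
        using sgen_commute[OF 2(1,2) False] by (metis comp_apply)
      then show ?thesis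
        using 2 c False by (simp add: D_matrix_eq numeral_2_eq_2 gword_eval_def fun_eq_iff)
    qed
  qed
qed

definition rho :: "nat gword set \<Rightarrow> int \<Rightarrow> int" where
  "rho = (SOME h. h \<in> hom W bij_group \<and> (\<forall>i\<in>{1..n}. h (s i) = sgen i))"

lemma rho_hom: "rho \<in> hom W bij_group" and rho_s: "i \<in> {1..n} \<Longrightarrow> rho (s i) = sgen i"
  using someI_ex[of "\<lambda>h. h \<in> hom W bij_group \<and> (\<forall>i\<in>{1..n}. h (s i) = sgen i)"] rho_exists
  unfolding rho_def by blast+

sublocale rho: group_hom W bij_group rho
  by (intro group_hom.intro group_hom_axioms.intro rho_hom W.group_axioms group_bij_group)

lemma rho_mult [simp]:
  "x \<in> carrier W \<Longrightarrow> y \<in> carrier W \<Longrightarrow> rho (x \<otimes>\<^bsub>W\<^esub> y) = rho x \<circ> rho y"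
  using rho.hom_mult by simp

lemma rho_one [simp]: "rho \<one>\<^bsub>W\<^esub> = id"
  using rho.hom_one by simp

text \<open>As the generators are involutions, products of generators without inverses suffice.\<close>

lemma W_induct [consumes 1, case_names one gen]:
  assumes "g \<in> carrier W" "P \<one>\<^bsub>W\<^esub>"
    and gen: "\<And>i g. i \<in> {1..n} \<Longrightarrow> g \<in> carrier W \<Longrightarrow> P g \<Longrightarrow> P (s i \<otimes>\<^bsub>W\<^esub> g)"
  shows "P g"
proof -
  have s: "pres_gen {1..n} (coxeter_rels {1..n} (D_matrix n)) = s" by (simp add: s_def)
  show ?thesis
    using assms(1)[unfolded W_eq]
    by (induction rule: presented_group_induct, unfold s W_eq[symmetric])
       (use assms(2) gen s_inv in simp_all)
qed

lemma rho_signed_perm: "g \<in> carrier W \<Longrightarrow> signed_perm n (rho g)"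
proof (induction rule: W_induct)
  case one
  show ?case unfolding rho_one by (rule signed_perm_id)
next
  case (gen i g)
  then show ?case
    unfolding rho_mult[OF s_closed[OF gen(1)] gen(2)] rho_s[OF gen(1)]
    by (intro signed_perm_comp sgen_signed_perm)
qed


subsection \<open>Faithfulness\<close>


text \<open>Coset enumeration multiplies many generators from the left; as functions, they compose without
  associativity bookkeeping.\<close>

definition act :: "nat \<Rightarrow> nat gword set \<Rightarrow> nat gword set" where
  "act i y = s i \<otimes>\<^bsub>W\<^esub> y"

lemma act_closed [simp]: "i \<in> {1..n} \<Longrightarrow> y \<in> carrier W \<Longrightarrow> act i y \<in> carrier W"
  by (simp add: act_def)

lemma act_act [simp]: "i \<in> {1..n} \<Longrightarrow> y \<in> carrier W \<Longrightarrow> act i (act i y) = y"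
  by (simp add: act_def W.m_assoc[symmetric] s_square)

lemma act_commute:
  "i \<in> {1..n} \<Longrightarrow> j \<in> {1..n} \<Longrightarrow> \<not> adjacent i j \<Longrightarrow> y \<in> carrier W \<Longrightarrow>
    act i (act j y) = act j (act i y)"
  by (simp add: act_def W.m_assoc[symmetric] s_commute[of i j])

lemma act_braid:
  "i \<in> {1..n} \<Longrightarrow> j \<in> {1..n} \<Longrightarrow> adjacent i j \<Longrightarrow> y \<in> carrier W \<Longrightarrow>
    act i (act j (act i y)) = act j (act i (act j y))"
  using s_braid[of i j] by (simp add: act_def W.m_assoc[symmetric])

text \<open>\<open>up k j\<close> is left multiplication by \<open>s\<^bsub>j-1\<^esub> \<dots> s\<^bsub>k\<^esub>\<close>, which carries the letter \<open>k\<close> to \<open>j\<close>;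
  \<open>down k d\<close> is left multiplication by \<open>s\<^bsub>n-d\<^esub> \<dots> s\<^bsub>n-1\<^esub> s\<^bsub>n\<^esub> s\<^bsub>n-2\<^esub> \<dots> s\<^bsub>k\<^esub>\<close>, which carries \<open>k\<close> to
  \<open>-(n-d)\<close>. They represent the cosets of \<open>\<langle>s\<^bsub>k+1\<^esub>, \<dots>, s\<^bsub>n\<^esub>\<rangle>\<close> in \<open>\<langle>s\<^bsub>k\<^esub>, \<dots>, s\<^bsub>n\<^esub>\<rangle>\<close>.\<close>

primrec up :: "nat \<Rightarrow> nat \<Rightarrow> nat gword set \<Rightarrow> nat gword set" where
  "up k 0 h = h"
| "up k (Suc j) h = (if k \<le> j then act j (up k j h) else h)"

primrec down :: "nat \<Rightarrow> nat \<Rightarrow> nat gword set \<Rightarrow> nat gword set" where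
  "down k 0 h = act n (up k (n - 1) h)"
| "down k (Suc d) h = act (n - Suc d) (down k d h)"

lemma up_self [simp]: "up k k h = h"
  by (cases k) auto

lemma up_step: "k \<le> j \<Longrightarrow> up k (j + 1) h = act j (up k j h)"
  by simp

lemma up_pos: "k < j \<Longrightarrow> up k j h = act (j - 1) (up k (j - 1) h)"
  by (cases j) auto

lemma up_closed [simp]:
  "1 \<le> k \<Longrightarrow> j \<le> n \<Longrightarrow> h \<in> carrier W \<Longrightarrow> up k j h \<in> carrier W"
  by (induction j) auto

lemma down_closed [simp]:
  "1 \<le> k \<Longrightarrow> d < n \<Longrightarrow> h \<in> carrier W \<Longrightarrow> down k d h \<in> carrier W"
  using n_ge by (induction d) auto

lemma up_commute:
  assumes "1 \<le> k" "i \<in> {1..n}" "h \<in> carrier W" "j \<le> n"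
    and "\<And>l. k \<le> l \<Longrightarrow> l < j \<Longrightarrow> \<not> adjacent i l"
  shows "act i (up k j h) = up k j (act i h)"
  using assms(4,5)
proof (induction j)
  case (Suc j)
  show ?case
  proof (cases "k \<le> j")
    case True
    then have "act i (act j (up k j h)) = act j (act i (up k j h))"
      using Suc.prems assms by (intro act_commute) auto
    then show ?thesis using Suc True by simp
  qed simp
qed simp

text \<open>Inside \<open>s\<^bsub>j-1\<^esub> \<dots> s\<^bsub>k\<^esub>\<close> the generator \<open>s\<^sub>i\<close> meets \<open>s\<^bsub>i+1\<^esub> s\<^sub>i\<close>, and \<open>s\<^sub>i s\<^bsub>i+1\<^esub> s\<^sub>i = s\<^bsub>i+1\<^esub> s\<^sub>i s\<^bsub>i+1\<^esub>\<close>
  lets it come out on the right as \<open>s\<^bsub>i+1\<^esub>\<close>.\<close>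

lemma up_shift:
  assumes "1 \<le> k" "k \<le> i" "h \<in> carrier W" "i + 1 < j" "j \<le> n"
  shows "act i (up k j h) = up k j (act (i + 1) h)"
  using assms(4,5)
proof (induction j)
  case (Suc j)
  show ?case
  proof (cases "i + 1 = j")
    case True
    have c: "up k i h \<in> carrier W" using assms Suc.prems by simp
    have "act i (up k (Suc j) h) = act i (act (i + 1) (act i (up k i h)))"
      using True[symmetric] assms(2) by simp
    also have "\<dots> = act (i + 1) (act i (act (i + 1) (up k i h)))"
      using assms Suc.prems True c by (intro act_braid) (auto simp: adjacent_def)
    also have "act (i + 1) (up k i h) = up k i (act (i + 1) h)"
      using assms Suc.prems True n_ge by (intro up_commute) (auto simp: adjacent_def)
    finally show ?thesis using True[symmetric] assms(2) by simp
  next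
    case False
    have "act i (act j (up k j h)) = act j (act i (up k j h))"
      using assms Suc.prems False n_ge by (intro act_commute) (auto simp: adjacent_def)
    then show ?thesis using Suc False assms(2) by simp
  qed
qed simp

text \<open>The generator \<open>s\<^sub>i\<close> is pushed through \<open>s\<^bsub>n-d\<^esub> \<dots> s\<^sub>n\<close> into \<open>s\<^bsub>n-2\<^esub> \<dots> s\<^sub>k\<close>, where \<open>up_shift\<close> applies. For
  \<open>i = n - 2\<close> it meets \<open>s\<^sub>n\<close> instead, because of the fork of the diagram, and comes out as \<open>s\<^sub>n\<close>.\<close>

lemma down_shift:
  assumes "1 \<le> k" "k \<le> i" "i + 1 < n - d"
  shows "\<exists>i'\<in>{k + 1..n}. \<forall>h\<in>carrier W. act i (down k d h) = down k d (act i' h)"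
  using assms(3)
proof (induction d)
  case 0
  show ?case
  proof (cases "i = n - 2")
    case True
    have i: "n - 1 = i + 1" "i \<in> {1..n}" "adjacent i n" "n = i + 2"
      using True n_ge assms by (auto simp: adjacent_def)
    have upn: "up k (n - 1) h = act i (up k i h)" for h
      using up_pos[of k "n - 1"] True assms 0 by (simp add: numeral_2_eq_2)
    have "act i (down k 0 h) = down k 0 (act n h)" if h: "h \<in> carrier W" for h
    proof -
      have c: "up k i h \<in> carrier W"
        using assms h True by (intro up_closed) auto
      have "act i (down k 0 h) = act i (act n (act i (up k i h)))"
        by (simp only: down.simps upn)
      also have "\<dots> = act n (act i (act n (up k i h)))"
        using i c by (intro act_braid) auto
      also have "act n (up k i h) = up k i (act n h)"
        using True n_ge assms h by (intro up_commute) (auto simp: adjacent_def)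
      finally show ?thesis by (simp only: down.simps upn)
    qed
    then show ?thesis using assms True n_ge by (intro bexI[of _ n]) auto
  next
    case False
    have "act i (down k 0 h) = down k 0 (act (i + 1) h)" if h: "h \<in> carrier W" for h
    proof -
      have "act i (act n (up k (n - 1) h)) = act n (act i (up k (n - 1) h))"
        using 0 False assms h by (intro act_commute) (auto simp: adjacent_def)
      then show ?thesis using up_shift[of k i h "n - 1"] 0 False assms h by simp
    qed
    then show ?thesis using assms 0 by (intro bexI[of _ "i + 1"]) auto
  qed
next
  case (Suc d)
  have "i + 1 < n - d" using Suc.prems by arith
  with Suc.IH obtain i' where i': "i' \<in> {k + 1..n}"
    "\<And>h. h \<in> carrier W \<Longrightarrow> act i (down k d h) = down k d (act i' h)" by blast
  have "act i (down k (Suc d) h) = down k (Suc d) (act i' h)" if h: "h \<in> carrier W" for h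
  proof -
    have "act i (act (n - Suc d) (down k d h)) = act (n - Suc d) (act i (down k d h))"
      using Suc.prems assms h by (intro act_commute) (auto simp: adjacent_def)
    then show ?thesis using i' h by simp
  qed
  then show ?case using i' by blast
qed

text \<open>A braid move inside \<open>s\<^bsub>n-d\<^esub> \<dots> s\<^bsub>n-1\<^esub>\<close> turns \<open>s\<^sub>i\<close> into \<open>s\<^bsub>i-1\<^esub>\<close>, to which \<open>down_shift\<close> applies.\<close>

lemma down_above:
  assumes "1 \<le> k" "k \<le> n - d" "n - d < i" "i < n"
  shows "\<exists>i'\<in>{k + 1..n}. \<forall>h\<in>carrier W. act i (down k d h) = down k d (act i' h)"
  using assms(2,3)
proof (induction d)
  case 0
  then show ?case using assms by simp
next
  case (Suc d)
  show ?case
  proof (cases "n - Suc d + 1 = i")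
    case True
    then obtain e where e: "d = Suc e" using assms by (cases d) auto
    have i: "n - Suc e = i" "n - Suc d = i - 1" "i - 1 + 1 < n - e" "k \<le> i - 1" "e < n"
      "i - 1 \<in> {1..n}" "i \<in> {1..n}" "adjacent i (i - 1)"
      using True e Suc.prems assms by (auto simp: adjacent_def)
    obtain i' where i': "i' \<in> {k + 1..n}"
      "\<And>h. h \<in> carrier W \<Longrightarrow> act (i - 1) (down k e h) = down k e (act i' h)"
      using down_shift[OF assms(1) i(4,3)] by blast
    have "act i (down k (Suc d) h) = down k (Suc d) (act i' h)" if h: "h \<in> carrier W" for h
    proof -
      have "act i (act (i - 1) (act i (down k e h))) = act (i - 1) (act i (act (i - 1) (down k e h)))"
        using i h assms by (intro act_braid) auto
      then show ?thesis using i' h e i by simp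
    qed
    then show ?thesis using i' by blast
  next
    case False
    then obtain i' where i': "i' \<in> {k + 1..n}"
      "\<And>h. h \<in> carrier W \<Longrightarrow> act i (down k d h) = down k d (act i' h)"
      using Suc by force
    have "act i (down k (Suc d) h) = down k (Suc d) (act i' h)" if h: "h \<in> carrier W" for h
    proof -
      have "act i (act (n - Suc d) (down k d h)) = act (n - Suc d) (act i (down k d h))"
        using Suc.prems False assms h by (intro act_commute) (auto simp: adjacent_def)
      then show ?thesis using i' h by simp
    qed
    then show ?thesis using i' by blast
  qed
qed

text \<open>Two braid moves at the fork turn \<open>s\<^sub>n s\<^bsub>n-2\<^esub> s\<^bsub>n-1\<^esub> s\<^sub>n s\<^bsub>n-2\<^esub>\<close> into \<open>s\<^bsub>n-2\<^esub> s\<^bsub>n-1\<^esub> s\<^sub>n s\<^bsub>n-2\<^esub> s\<^bsub>n-1\<^esub>\<close>.\<close>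

lemma down_last:
  assumes "1 \<le> k" "k \<le> n - d" "2 \<le> d" "h \<in> carrier W"
  shows "act n (down k d h) = down k d (act (n - 1) h)"
  using assms(2,3)
proof (induction d)
  case (Suc d)
  show ?case
  proof (cases "d = 1")
    case True
    define p where "p = n - 2"
    have p: "n - 1 = p + 1" "n = p + 2" "p \<in> {1..n}" "k \<le> p" "adjacent n p"
      "adjacent p (p + 1)" "\<not> adjacent n (p + 1)" "p + 1 \<in> {1..n}" "n \<in> {1..n}"
      using n_ge Suc.prems assms True by (auto simp: p_def adjacent_def)
    define u where "u = up k p h"
    have u: "u \<in> carrier W"
      unfolding u_def p_def using assms by (intro up_closed) auto
    have dn: "down k (Suc d) h' = act p (act (p + 1) (act n (act p (up k p h'))))" for h'
    proof -
      have "n - Suc (Suc 0) = p" "n - Suc 0 = p + 1" using p(2) by simp_all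
      moreover have "up k (p + 1) h' = act p (up k p h')" using up_step p by blast
      ultimately show ?thesis using True by (simp only: One_nat_def down.simps)
    qed
    have "act n (down k (Suc d) h) = act n (act p (act (p + 1) (act n (act p u))))"
      by (simp only: dn u_def)
    also have "act (p + 1) (act n (act p u)) = act n (act (p + 1) (act p u))"
      by (rule act_commute[symmetric]) (use p(3,7,8,9) u in simp_all)
    also have "act n (act p (act n (act (p + 1) (act p u))))
        = act p (act n (act p (act (p + 1) (act p u))))"
      by (rule act_braid) (use p(3,5,6,7,8,9) u in simp_all)
    also have "act p (act (p + 1) (act p u)) = act (p + 1) (act p (act (p + 1) u))"
      by (rule act_braid) (use p(3,5,6,7,8,9) u in simp_all)
    also have "act n (act (p + 1) (act p (act (p + 1) u)))
        = act (p + 1) (act n (act p (act (p + 1) u)))"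
      by (rule act_commute) (use p(3,5,6,7,8,9) u in simp_all)
    also have "act (p + 1) u = up k p (act (p + 1) h)"
      unfolding u_def using p_def n_ge assms
      by (intro up_commute) (auto simp: adjacent_def)
    finally show ?thesis by (simp only: dn p(1))
  next
    case False
    have "act n (act (n - Suc d) (down k d h)) = act (n - Suc d) (act n (down k d h))"
      using Suc.prems False assms by (intro act_commute) (auto simp: adjacent_def)
    then show ?thesis using Suc False assms by simp
  qed
qed simp

text \<open>The subgroup \<open>\<langle>s\<^sub>k, \<dots>, s\<^sub>n\<rangle>\<close>, generated by left multiplications only since the generators are
  involutions.\<close>

inductive_set parabolic :: "nat \<Rightarrow> nat gword set set" for k where
  one: "\<one>\<^bsub>W\<^esub> \<in> parabolic k"
| step: "h \<in> parabolic k \<Longrightarrow> i \<in> {k..n} \<Longrightarrow> act i h \<in> parabolic k"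

lemma parabolic_closed: "1 \<le> k \<Longrightarrow> h \<in> parabolic k \<Longrightarrow> h \<in> carrier W"
  by (rotate_tac, induction rule: parabolic.induct) auto

lemma parabolic_Suc_closed: "h \<in> parabolic (k + 1) \<Longrightarrow> h \<in> carrier W"
  by (rule parabolic_closed) simp_all

lemma parabolic_one: "parabolic 1 = carrier W"
proof
  show "parabolic 1 \<subseteq> carrier W" using parabolic_closed by auto
  show "carrier W \<subseteq> parabolic 1"
  proof
    fix g assume "g \<in> carrier W"
    then show "g \<in> parabolic 1"
    proof (induction rule: W_induct)
      case (gen i g)
      then show ?case using parabolic.step[of g 1 i] by (simp add: act_def)
    qed (rule parabolic.one)
  qed
qed

definition coset_union :: "nat \<Rightarrow> nat gword set set" where
  "coset_union k = {up k j h | j h. j \<in> {k..n} \<and> h \<in> parabolic (k + 1)} \<union>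
     {down k d h | d h. d \<le> n - k \<and> h \<in> parabolic (k + 1)}"

lemma coset_unionI:
  "j \<in> {k..n} \<Longrightarrow> h \<in> parabolic (k + 1) \<Longrightarrow> up k j h \<in> coset_union k"
  "d \<le> n - k \<Longrightarrow> h \<in> parabolic (k + 1) \<Longrightarrow> down k d h \<in> coset_union k"
  unfolding coset_union_def by blast+

text \<open>Left multiplication by \<open>s\<^sub>i\<close> either permutes the coset representatives, when it moves the letter to
  which the representative carries \<open>k\<close>, or it can be pushed through the representative into the subgroup.\<close>

lemma coset_union_act:
  assumes k: "1 \<le> k" "k \<le> n - 2" and i: "i \<in> {k..n}" and g: "g \<in> coset_union k"
  shows "act i g \<in> coset_union k"
proof -
  consider (up) j h where "j \<in> {k..n}" "h \<in> parabolic (k + 1)" "g = up k j h"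
    | (down) d h where "d \<le> n - k" "h \<in> parabolic (k + 1)" "g = down k d h"
    using g unfolding coset_union_def by blast
  then show ?thesis
  proof cases
    case up
    have h: "h \<in> carrier W" using up parabolic_Suc_closed by simp
    have p: "act l h \<in> parabolic (k + 1)" if "l \<in> {k + 1..n}" for l
      using parabolic.step[OF up(2) that] .
    have pn: "act n (up k (n - 1) h) = down k 0 h" by simp
    consider "i = j" "i < n" | "j = i + 1" "i < n" | "i > j" "i < n" | "i + 1 < j" "i < n"
      | "i = n" "j + 2 \<le> n" | "i = n" "j = n - 1" | "i = n" "j = n"
      using i up(1) by fastforce
    then show ?thesis
    proof cases
      case 1
      then show ?thesis using up coset_unionI(1)[of "i + 1" k h] i by simp
    next
      case 2
      have "act i (act i (up k i h)) = up k i h" using h k i up 2 by (intro act_act) auto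
      then show ?thesis using 2 up i coset_unionI(1)[of i k h] by simp
    next
      case 3
      have "act i (up k j h) = up k j (act i h)"
        using 3 h k i up n_ge by (intro up_commute) (auto simp: adjacent_def)
      then show ?thesis using 3 up i p coset_unionI(1)[of j k] by simp
    next
      case 4
      have "act i (up k j h) = up k j (act (i + 1) h)"
        using 4 h k i up by (intro up_shift) auto
      then show ?thesis using 4 up i p coset_unionI(1)[of j k] by simp
    next
      case 5
      have "act i (up k j h) = up k j (act i h)"
        using 5 h k i up n_ge by (intro up_commute) (auto simp: adjacent_def)
      then show ?thesis using 5 up i k p coset_unionI(1)[of j k] n_ge by simp
    next
      case 6
      then show ?thesis using up coset_unionI(2)[of 0 k h] by simp
    next
      case 7
      have "up k n h = act (n - 1) (up k (n - 1) h)"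
        using k n_ge by (intro up_pos) simp
      then have "act n (up k n h) = act n (act (n - 1) (up k (n - 1) h))" by simp
      also have "\<dots> = act (n - 1) (act n (up k (n - 1) h))"
        using h k n_ge by (intro act_commute) (auto simp: adjacent_def)
      also have "\<dots> = down k 1 h" by simp
      finally show ?thesis using 7 up coset_unionI(2)[of 1 k h] k n_ge by simp
    qed
  next
    case down
    have h: "h \<in> carrier W" using down parabolic_Suc_closed by simp
    have p: "act l h \<in> parabolic (k + 1)" if "l \<in> {k + 1..n}" for l
      using parabolic.step[OF down(2) that] .
    have dk: "k \<le> n - d" "d < n" using down k n_ge by auto
    consider "i = n - d" "d \<ge> 1" | "i + 1 = n - d" | "i + 1 < n - d" | "n - d < i" "i < n"
      | "i = n" "d \<ge> 2" | "i = n" "d = 0" | "i = n" "d = 1"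
      using i dk by fastforce
    then show ?thesis
    proof cases
      case 1
      then obtain e where e: "d = Suc e" by (cases d) auto
      have "act i (act i (down k e h)) = down k e h"
        using h k i dk e by (intro act_act) auto
      then show ?thesis using 1 e down coset_unionI(2)[of e k h] by simp
    next
      case 2
      then have "n - Suc d = i" by simp
      then have "act i (down k d h) = down k (Suc d) h" by simp
      moreover have "Suc d \<le> n - k" using 2 i by simp arith
      ultimately show ?thesis using down coset_unionI(2)[of "Suc d" k h] by simp
    next
      case 3
      obtain i' where "i' \<in> {k + 1..n}" "act i (down k d h) = down k d (act i' h)"
        using down_shift[OF k(1) _ 3] i h by auto
      then show ?thesis using p down coset_unionI(2)[of d k] by simp
    next
      case 4
      obtain i' where "i' \<in> {k + 1..n}" "act i (down k d h) = down k d (act i' h)"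
        using down_above[OF k(1) dk(1) 4] i h by auto
      then show ?thesis using p down coset_unionI(2)[of d k] by simp
    next
      case 5
      then have "act i (down k d h) = down k d (act (n - 1) h)"
        using down_last[OF k(1) dk(1) _ h] by simp
      then show ?thesis using p down coset_unionI(2)[of d k] k n_ge by simp
    next
      case 6
      have "act n (act n (up k (n - 1) h)) = up k (n - 1) h"
        using h k n_ge by (intro act_act) auto
      then show ?thesis using 6 down coset_unionI(1)[of "n - 1" k h] k n_ge by simp
    next
      case 7
      have u: "up k n h = act (n - 1) (up k (n - 1) h)"
        using k n_ge by (intro up_pos) simp
      have "act n (act (n - 1) (act n (up k (n - 1) h)))
          = act n (act n (act (n - 1) (up k (n - 1) h)))"
        by (rule arg_cong[of _ _ "act n"], rule act_commute)
           (use h k n_ge in \<open>auto simp: adjacent_def\<close>)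
      also have "\<dots> = up k n h" unfolding u using h k n_ge by (intro act_act) auto
      finally show ?thesis using 7 down coset_unionI(1)[of n k h] k n_ge by simp
    qed
  qed
qed

lemma parabolic_subset_coset_union:
  assumes k: "1 \<le> k" "k \<le> n - 2"
  shows "parabolic k \<subseteq> coset_union k"
proof
  fix g assume "g \<in> parabolic k"
  then show "g \<in> coset_union k"
  proof (induction rule: parabolic.induct)
    case one
    then show ?case
      using coset_unionI(1)[OF _ parabolic.one, of k k] k n_ge by simp
  next
    case (step h i)
    then show ?case using coset_union_act k by blast
  qed
qed

lemma rho_act: "i \<in> {1..n} \<Longrightarrow> y \<in> carrier W \<Longrightarrow> rho (act i y) x = sgen i (rho y x)"
  by (simp add: act_def rho_s)

lemma sgen_apply:
  "1 \<le> j \<Longrightarrow> j < n \<Longrightarrow> sgen j (int j) = int j + 1"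
  "1 \<le> j \<Longrightarrow> j < n \<Longrightarrow> sgen j (- int j - 1) = - int j"
  "sgen n (int n - 1) = - int n"
  using n_ge by (auto simp: sgen_def sref_def)

lemma rho_parabolic_fixes:
  "1 \<le> k \<Longrightarrow> k \<le> n - 2 \<Longrightarrow> h \<in> parabolic (k + 1) \<Longrightarrow> rho h (int k) = int k"
proof (rotate_tac 2, induction rule: parabolic.induct)
  case (step h i)
  have "h \<in> carrier W" using step parabolic_Suc_closed by simp
  then have "rho (act i h) (int k) = sgen i (int k)" using step rho_act by simp
  also have "\<dots> = int k"
    using step.prems step.hyps n_ge by (auto simp: sgen_def intro!: sref_other)
  finally show ?case .
qed simp

lemma rho_up:
  assumes "1 \<le> k" "k \<le> n - 2" "h \<in> parabolic (k + 1)" "k \<le> j" "j \<le> n"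
  shows "rho (up k j h) (int k) = int j"
  using assms(4,5)
proof (induction j)
  case (Suc j)
  have h: "h \<in> carrier W" using assms parabolic_Suc_closed by simp
  show ?case
  proof (cases "k = Suc j")
    case True
    then show ?thesis using rho_parabolic_fixes[OF assms(1-3)] by simp
  next
    case False
    then have "rho (up k (Suc j) h) (int k) = sgen j (rho (up k j h) (int k))"
      using Suc.prems assms h by (simp add: rho_act)
    then show ?thesis using False Suc assms sgen_apply(1)[of j] by simp
  qed
qed (use assms in simp)

lemma rho_down:
  assumes "1 \<le> k" "k \<le> n - 2" "h \<in> parabolic (k + 1)" "d \<le> n - k"
  shows "rho (down k d h) (int k) = - int (n - d)"
  using assms(4)
proof (induction d)
  case 0
  have h: "h \<in> carrier W" using assms parabolic_Suc_closed by simp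
  have "rho (up k (n - 1) h) (int k) = int n - 1"
    using rho_up[OF assms(1-3), of "n - 1"] assms n_ge by simp
  then show ?case
    using assms h n_ge by (simp add: rho_act sgen_apply)
next
  case (Suc d)
  have h: "h \<in> carrier W" using assms parabolic_Suc_closed by simp
  have "rho (down k (Suc d) h) (int k) = sgen (n - Suc d) (rho (down k d h) (int k))"
    using Suc.prems assms h by (simp add: rho_act)
  also have "rho (down k d h) (int k) = - int (n - Suc d) - 1"
    using Suc assms by simp
  also have "sgen (n - Suc d) \<dots> = - int (n - Suc d)"
    using Suc.prems assms n_ge by (intro sgen_apply) auto
  finally show ?case .
qed

text \<open>The coset of an element is determined by the image of the letter \<open>k\<close>.\<close>

lemma parabolic_stabiliser:
  assumes k: "1 \<le> k" "k \<le> n - 2" and g: "g \<in> parabolic k" "rho g = id"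
  shows "g \<in> parabolic (k + 1)"
proof -
  have "g \<in> coset_union k" using parabolic_subset_coset_union k g by blast
  then consider (up) j h where "j \<in> {k..n}" "h \<in> parabolic (k + 1)" "g = up k j h"
    | (down) d h where "d \<le> n - k" "h \<in> parabolic (k + 1)" "g = down k d h"
    unfolding coset_union_def by blast
  then show ?thesis
  proof cases
    case up
    then have "j = k" using rho_up[OF k up(2), of j] g by simp
    then show ?thesis using up by simp
  next
    case down
    then show ?thesis using rho_down[OF k down(2), of d] g k by simp
  qed
qed

lemma kernel_in_parabolic:
  assumes "g \<in> carrier W" "rho g = id" "1 \<le> k" "k \<le> n - 1"
  shows "g \<in> parabolic k"
  using assms(3,4)
proof (induction k rule: nat_induct_at_least)
  case base
  then show ?case using parabolic_one assms by simp
next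
  case (Suc k)
  then show ?case using parabolic_stabiliser[of k g] assms by simp
qed

lemma parabolic_last:
  assumes "g \<in> parabolic (n - 1)"
  shows "g \<in> {\<one>\<^bsub>W\<^esub>, s (n - 1), s n, s (n - 1) \<otimes>\<^bsub>W\<^esub> s n}"
  using assms
proof (induction rule: parabolic.induct)
  case (step h i)
  define p where "p = n - 1"
  have p: "p \<in> {1..n}" "n \<in> {1..n}" "\<not> adjacent p n" "i = p \<or> i = n"
    using step(2) n_ge by (auto simp: adjacent_def p_def)
  then have [simp]: "s n \<in> carrier W" "s p \<in> carrier W" by (blast intro: s_closed)+
  have c: "s n \<otimes>\<^bsub>W\<^esub> s p = s p \<otimes>\<^bsub>W\<^esub> s n"
    using p s_commute by blast
  have sq: "s n \<otimes>\<^bsub>W\<^esub> s n = \<one>\<^bsub>W\<^esub>" "s p \<otimes>\<^bsub>W\<^esub> s p = \<one>\<^bsub>W\<^esub>"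
    using p s_square by blast+
  have "s p \<otimes>\<^bsub>W\<^esub> (s p \<otimes>\<^bsub>W\<^esub> s n) = s n" "s n \<otimes>\<^bsub>W\<^esub> (s n \<otimes>\<^bsub>W\<^esub> s p) = s p"
    by (simp_all add: W.m_assoc[symmetric] sq)
  then show ?case
    using step.IH p(4) sq c unfolding act_def p_def[symmetric]
    by (elim disjE insertE emptyE) simp_all
qed simp

text \<open>An element of the kernel fixes all letters, so it descends through the chain of stabilisers down to the
  Klein four-group \<open>\<langle>s\<^bsub>n-1\<^esub>, s\<^sub>n\<rangle>\<close>, on which \<open>rho\<close> is visibly injective.\<close>

lemma rho_injective:
  assumes "g \<in> carrier W" "h \<in> carrier W" "rho g = rho h"
  shows "g = h"
proof -
  let ?x = "inv\<^bsub>W\<^esub> h \<otimes>\<^bsub>W\<^esub> g"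
  have x: "?x \<in> carrier W" using assms by simp
  have "rho ?x = rho (inv\<^bsub>W\<^esub> h \<otimes>\<^bsub>W\<^esub> h)"
    using assms rho_mult[of "inv\<^bsub>W\<^esub> h" g] rho_mult[of "inv\<^bsub>W\<^esub> h" h] by simp
  then have id: "rho ?x = id" using assms by simp
  have "?x \<in> parabolic (n - 1)" using kernel_in_parabolic[OF x id, of "n - 1"] n_ge by simp
  then have x4: "?x \<in> {\<one>\<^bsub>W\<^esub>, s (n - 1), s n, s (n - 1) \<otimes>\<^bsub>W\<^esub> s n}" by (rule parabolic_last)
  have r: "rho (s (n - 1)) = sref (int n - 1) (int n)" "rho (s n) = sref (int n - 1) (- int n)"
    using n_ge by (simp_all add: rho_s sgen_def of_nat_diff)
  have "rho (s (n - 1)) (int n) \<noteq> int n" "rho (s n) (int n) \<noteq> int n"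
    "rho (s (n - 1) \<otimes>\<^bsub>W\<^esub> s n) (int n) \<noteq> int n"
    using n_ge unfolding rho_mult[OF s_closed s_closed] by (simp_all add: r[unfolded One_nat_def] sref_def)
  then have "?x = \<one>\<^bsub>W\<^esub>" using x4 id by (metis id_apply insertE emptyE)
  then have "h \<otimes>\<^bsub>W\<^esub> ?x = h" using assms by simp
  then show ?thesis using assms by (simp add: W.m_assoc[symmetric])
qed


subsection \<open>Reflections\<close>


sublocale R: reflection_group W "S_D n"
proof
  show "S_D n \<subseteq> carrier W" by (auto simp: S_eq)
  show "t \<otimes>\<^bsub>W\<^esub> t = \<one>\<^bsub>W\<^esub>" if "t \<in> S_D n" for t using that s_square by (auto simp: S_eq)
  have "g \<in> generate W (S_D n)" if "g \<in> carrier W" for g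
    using that
  proof (induction rule: W_induct)
    case (gen i g)
    have "s i \<in> generate W (S_D n)" using gen by (intro generate.incl) (simp add: S_eq)
    then show ?case using gen generate.eng by metis
  qed (rule generate.one)
  moreover have "S_D n \<subseteq> carrier W" by (auto simp: S_eq)
  ultimately show "generate W (S_D n) = carrier W"
    using W.generate_in_carrier by blast
qed

lemma rho_conj_sref:
  assumes "g \<in> carrier W" "t \<in> carrier W" "rho t = sref u v"
  shows "rho (g \<otimes>\<^bsub>W\<^esub> t \<otimes>\<^bsub>W\<^esub> inv\<^bsub>W\<^esub> g) = sref (rho g u) (rho g v)"
proof -
  have "rho (g \<otimes>\<^bsub>W\<^esub> t \<otimes>\<^bsub>W\<^esub> inv\<^bsub>W\<^esub> g) = rho g \<circ> sref u v \<circ> rho (inv\<^bsub>W\<^esub> g)"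
    using assms by simp
  also have "\<dots> = sref (rho g u) (rho g v) \<circ> (rho g \<circ> rho (inv\<^bsub>W\<^esub> g))"
    using signed_perm_sref_conj[OF rho_signed_perm[OF assms(1)]] by (simp add: o_assoc)
  also have "rho g \<circ> rho (inv\<^bsub>W\<^esub> g) = id"
    using assms(1) rho_mult[of g "inv\<^bsub>W\<^esub> g"] by simp
  finally show ?thesis by simp
qed

lemma rho_T:
  assumes "t \<in> R.T"
  shows "\<exists>u v. letter_pair n u v \<and> rho t = sref u v"
proof -
  obtain g i where g: "g \<in> carrier W" "i \<in> {1..n}" "t = g \<otimes>\<^bsub>W\<^esub> s i \<otimes>\<^bsub>W\<^esub> inv\<^bsub>W\<^esub> g"
    using assms by (auto simp: reflections_def S_eq)
  obtain u v where uv: "sgen i = sref u v" "letter_pair n u v" using sgen_pair[OF g(2)] .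
  then have "rho t = sref (rho g u) (rho g v)"
    using rho_conj_sref[OF g(1) s_closed[OF g(2)]] g by (simp add: rho_s)
  then show ?thesis using signed_perm_letter_pair[OF rho_signed_perm[OF g(1)] uv(2)] by blast
qed

definition is_refl :: "int \<Rightarrow> int \<Rightarrow> bool" where
  "is_refl u v \<longleftrightarrow> (\<exists>t\<in>R.T. rho t = sref u v)"

lemma is_refl_sym: "is_refl u v \<Longrightarrow> is_refl v u"
  by (simp add: is_refl_def sref_sym)

lemma is_refl_uminus: "letter_pair n u v \<Longrightarrow> is_refl u v \<Longrightarrow> is_refl (- u) (- v)"
  by (simp add: is_refl_def sref_uminus letter_pair_def)

lemma is_refl_trans:
  assumes "is_refl u v" "is_refl v x" "letter_pair n u v" "letter_pair n v x" "\<bar>u\<bar> \<noteq> \<bar>x\<bar>"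
  shows "is_refl u x"
proof -
  obtain t r where tr: "t \<in> R.T" "rho t = sref u v" "r \<in> R.T" "rho r = sref v x"
    using assms(1,2) by (auto simp: is_refl_def)
  have "rho (t \<otimes>\<^bsub>W\<^esub> r \<otimes>\<^bsub>W\<^esub> inv\<^bsub>W\<^esub> t) = sref u x"
    using rho_conj_sref[of t r v x] tr R.T_closed assms
    by (simp add: letter_pair_def sref_other)
  then show ?thesis using tr R.T_conj R.T_closed unfolding is_refl_def by blast
qed

lemma is_refl_simple: "i \<in> {1..n} \<Longrightarrow> sgen i = sref u v \<Longrightarrow> is_refl u v"
  using R.S_subset_T rho_s unfolding is_refl_def S_eq by fastforce

lemma is_refl_pos:
  assumes "1 \<le> i" "i < j" "j \<le> n"
  shows "is_refl (int i) (int j)"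
  using assms(2,3)
proof (induction j)
  case (Suc j)
  have step: "is_refl (int j) (int (Suc j))" if "1 \<le> j"
    using Suc.prems that by (intro is_refl_simple[of j]) (auto simp: sgen_def add.commute)
  show ?case
  proof (cases "i = j")
    case True
    then show ?thesis using step assms by simp
  next
    case False
    then have "is_refl (int i) (int j)" using Suc by simp
    then show ?thesis
      using is_refl_trans[of "int i" "int j" "int (Suc j)"] step Suc.prems False assms
      by (simp add: letter_pair_def)
  qed
qed simp

lemma is_refl_neg_last:
  assumes "1 \<le> i" "i < n"
  shows "is_refl (int i) (- int n)"
proof -
  have last: "is_refl (int (n - 1)) (- int n)"
    using n_ge by (intro is_refl_simple[of n]) (auto simp: sgen_def of_nat_diff)
  show ?thesis
  proof (cases "i = n - 1")
    case False
    then show ?thesis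
      using is_refl_trans[OF is_refl_pos[of i "n - 1"] last] assms n_ge
      by (simp add: letter_pair_def)
  qed (use last in simp)
qed

lemma is_refl_neg:
  assumes "1 \<le> i" "i < j" "j \<le> n"
  shows "is_refl (int i) (- int j)"
proof (cases "j = n")
  case True
  then show ?thesis using is_refl_neg_last assms by simp
next
  case False
  have "is_refl (- int n) (- int j)"
    using is_refl_uminus[OF _ is_refl_sym[OF is_refl_pos[of j n]]] assms False
    by (simp add: letter_pair_def)
  then show ?thesis
    using is_refl_trans[OF is_refl_neg_last[of i], of "- int j"] assms False
    by (simp add: letter_pair_def)
qed

text \<open>Conjugation composes letter pairs (\<open>is_refl_trans\<close>), and the pairs of the simple reflections connect
  all letters.\<close>

lemma is_refl_letter_pair:
  assumes "letter_pair n u v"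
  shows "is_refl u v"
proof -
  have *: "is_refl u v" if "letter_pair n u v" "\<bar>u\<bar> < \<bar>v\<bar>" for u v
  proof -
    define i j where "i = nat \<bar>u\<bar>" and "j = nat \<bar>v\<bar>"
    have ij: "1 \<le> i" "i < j" "j \<le> n" "u = int i \<or> u = - int i" "v = int j \<or> v = - int j"
      using that by (auto simp: letter_pair_def i_def j_def)
    have "letter_pair n (int i) (int j)" "letter_pair n (int i) (- int j)"
      using ij by (auto simp: letter_pair_def)
    then have "is_refl (- int i) (- int j)" "is_refl (- int i) (int j)"
      using is_refl_uminus is_refl_pos[OF ij(1-3)] is_refl_neg[OF ij(1-3)] by fastforce+
    then show ?thesis using is_refl_pos[OF ij(1-3)] is_refl_neg[OF ij(1-3)] ij by auto
  qed
  have "letter_pair n v u" "\<bar>u\<bar> < \<bar>v\<bar> \<or> \<bar>v\<bar> < \<bar>u\<bar>" using assms by (auto simp: letter_pair_def)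
  then show ?thesis using *[of u v] *[of v u] is_refl_sym assms by blast
qed

text \<open>Well defined on letter pairs: some reflection acts as \<open>sref u v\<close> by \<open>is_refl_letter_pair\<close>, and only one
  does since \<open>rho\<close> is injective.\<close>

definition reflection :: "int \<Rightarrow> int \<Rightarrow> nat gword set" where
  "reflection u v = (SOME t. t \<in> R.T \<and> rho t = sref u v)"

lemma refl_T: "letter_pair n u v \<Longrightarrow> reflection u v \<in> R.T"
  and rho_refl: "letter_pair n u v \<Longrightarrow> rho (reflection u v) = sref u v"
  using someI_ex[of "\<lambda>t. t \<in> R.T \<and> rho t = sref u v"] is_refl_letter_pair
  unfolding reflection_def is_refl_def by blast+

lemma refl_closed: "letter_pair n u v \<Longrightarrow> reflection u v \<in> carrier W"
  using refl_T R.T_closed by blast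

lemma refl_eqI: "letter_pair n u v \<Longrightarrow> t \<in> carrier W \<Longrightarrow> rho t = sref u v \<Longrightarrow> reflection u v = t"
  using rho_injective[of "reflection u v" t] rho_refl refl_closed by simp

lemma T_eq_refl: "t \<in> R.T \<Longrightarrow> \<exists>u v. letter_pair n u v \<and> t = reflection u v"
  using rho_T refl_eqI R.T_closed by metis

lemma refl_sym: "letter_pair n u v \<Longrightarrow> reflection u v = reflection v u"
  by (simp add: reflection_def sref_sym)

lemma refl_uminus: "letter_pair n u v \<Longrightarrow> reflection (- u) (- v) = reflection u v"
  by (simp add: reflection_def sref_uminus letter_pair_def)

lemma refl_conj:
  assumes "letter_pair n u v" "g \<in> carrier W"
  shows "g \<otimes>\<^bsub>W\<^esub> reflection u v \<otimes>\<^bsub>W\<^esub> inv\<^bsub>W\<^esub> g = reflection (rho g u) (rho g v)"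
  using assms signed_perm_letter_pair[OF rho_signed_perm]
  by (intro refl_eqI[symmetric] rho_conj_sref rho_refl) (auto simp: refl_closed)

lemma refl_commute:
  assumes "letter_pair n u v" "letter_pair n x y"
    "\<bar>x\<bar> \<noteq> \<bar>u\<bar>" "\<bar>x\<bar> \<noteq> \<bar>v\<bar>" "\<bar>y\<bar> \<noteq> \<bar>u\<bar>" "\<bar>y\<bar> \<noteq> \<bar>v\<bar>"
  shows "reflection u v \<otimes>\<^bsub>W\<^esub> reflection x y = reflection x y \<otimes>\<^bsub>W\<^esub> reflection u v"
  using assms sref_commute[of u v x y]
  by (intro rho_injective) (auto simp: refl_closed rho_refl letter_pair_def)

lemma refl_braid:
  assumes "letter_pair n u v" "letter_pair n v x" "\<bar>u\<bar> \<noteq> \<bar>x\<bar>"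
  shows "reflection u v \<otimes>\<^bsub>W\<^esub> reflection v x \<otimes>\<^bsub>W\<^esub> reflection u v = reflection v x \<otimes>\<^bsub>W\<^esub> reflection u v \<otimes>\<^bsub>W\<^esub> reflection v x"
  using assms sref_braid[of u v x]
  by (intro rho_injective) (simp_all add: refl_closed rho_refl letter_pair_def)

lemma card_S: "card (S_D n) = n"
proof -
  have "inj_on sgen {1..n}"
  proof (rule inj_onI)
    fix i j assume ij: "i \<in> {1..n}" "j \<in> {1..n}" "sgen i = sgen j"
    have *: "\<not> (i < j \<and> sgen i = sgen j)" if "i \<in> {1..n}" "j \<in> {1..n}" for i j
    proof
      assume a: "i < j \<and> sgen i = sgen j"
      then have "sgen i (int i) = int i + 1" using that by (simp add: sgen_def)
      moreover have "sgen j (int i) \<noteq> int i + 1"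
        using that a by (auto simp: sgen_def sref_def)
      ultimately show False using a by simp
    qed
    then show "i = j" using ij *[of i j] *[of j i] by (metis linorder_neqE_nat)
  qed
  then have "inj_on s {1..n}" by (metis (no_types, lifting) inj_on_def rho_s)
  then show ?thesis by (simp add: S_eq card_image)
qed


subsection \<open>Parity\<close>

text \<open>For a signed permutation with \<open>r\<close> sign changes this is \<open>(-1)\<^sup>r\<close>.\<close>

definition parity :: "(int \<Rightarrow> int) \<Rightarrow> int" where
  "parity f = (\<Prod>i\<in>{1..int n}. sgn (f i))"

lemma abs_signed_perm_bij:
  assumes "signed_perm n f"
  shows "bij_betw (\<lambda>x. \<bar>f x\<bar>) {1..int n} {1..int n}"
proof -
  have "inj_on (\<lambda>x. \<bar>f x\<bar>) {1..int n}"
    by (rule inj_onI) (simp add: signed_permD(6)[OF assms])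
  moreover have "\<bar>f x\<bar> \<in> {1..int n}" if "x \<in> {1..int n}" for x
    using signed_permD(7,8)[OF assms, of x] that by auto
  then have "(\<lambda>x. \<bar>f x\<bar>) ` {1..int n} \<subseteq> {1..int n}" by blast
  ultimately show ?thesis by (simp add: bij_betw_def endo_inj_surj)
qed

lemma parity_comp:
  assumes "signed_perm n f" "signed_perm n g"
  shows "parity (f \<circ> g) = parity f * parity g"
proof -
  have "sgn (f (g i)) = sgn (f \<bar>g i\<bar>) * sgn (g i)" if "i \<in> {1..int n}" for i
    using that signed_permD(8)[OF assms(2), of i] signed_permD(2)[OF assms(1), of "g i"]
    by (cases "g i > 0") (auto simp: sgn_minus)
  then have "parity (f \<circ> g) = (\<Prod>i\<in>{1..int n}. sgn (f \<bar>g i\<bar>)) * parity g"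
    by (simp add: parity_def prod.distrib)
  also have "(\<Prod>i\<in>{1..int n}. sgn (f \<bar>g i\<bar>)) = parity f"
    unfolding parity_def
    using prod.reindex_bij_betw[OF abs_signed_perm_bij[OF assms(2)], of "\<lambda>x. sgn (f x)"] .
  finally show ?thesis .
qed

lemma parity_sgen:
  assumes "i \<in> {1..n}"
  shows "parity (sgen i) = 1"
proof (cases "i < n")
  case True
  have "sgen i x > 0" if "x \<in> {1..int n}" for x
    using that assms True by (auto simp: sgen_def sref_def)
  then show ?thesis unfolding parity_def by (intro prod.neutral) auto
next
  case False
  have e: "{1..int n} = {1..int n - 2} \<union> {int n - 1, int n}" using n_ge by auto
  have "(\<Prod>x\<in>{1..int n - 2}. sgn (sgen i x)) = 1"
    using False by (intro prod.neutral) (auto simp: sgen_def sref_def)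
  moreover have "(\<Prod>x\<in>{int n - 1, int n}. sgn (sgen i x)) = 1"
    using False n_ge by (simp add: sgen_def sref_def)
  ultimately show ?thesis unfolding parity_def e by (subst prod.union_disjoint) auto
qed

lemma parity_rho: "g \<in> carrier W \<Longrightarrow> parity (rho g) = 1"
proof (induction rule: W_induct)
  case one
  show ?case unfolding parity_def by (intro prod.neutral) auto
next
  case (gen i g)
  then show ?case
    unfolding rho_mult[OF s_closed[OF gen(1)] gen(2)] rho_s[OF gen(1)]
      parity_comp[OF sgen_signed_perm[OF gen(1)] rho_signed_perm[OF gen(2)]]
    by (simp add: parity_sgen)
qed

definition negate :: "int \<Rightarrow> int \<Rightarrow> int" where
  "negate a x = (if \<bar>x\<bar> = \<bar>a\<bar> then - x else x)"

lemma signed_perm_neg: "\<bar>a\<bar> \<le> int n \<Longrightarrow> signed_perm n (negate a)"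
  unfolding signed_perm_def by (auto simp: negate_def fun_eq_iff intro!: o_bij[of "negate a"])

lemma parity_neg:
  assumes "a \<noteq> 0" "\<bar>a\<bar> \<le> int n"
  shows "parity (negate a) = -1"
proof -
  have "parity (negate a) = sgn (negate a \<bar>a\<bar>) * (\<Prod>x\<in>{1..int n} - {\<bar>a\<bar>}. sgn (negate a x))"
    unfolding parity_def using assms by (intro prod.remove) auto
  also have "(\<Prod>x\<in>{1..int n} - {\<bar>a\<bar>}. sgn (negate a x)) = 1"
    by (intro prod.neutral) (auto simp: negate_def)
  finally have "parity (negate a) = sgn (negate a \<bar>a\<bar>)" by simp
  moreover have "negate a \<bar>a\<bar> = - \<bar>a\<bar>" by (simp add: negate_def)
  ultimately show ?thesis using assms by simp
qed

text \<open>Sorting a signed permutation with reflections from the largest letter downwards shows that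
  parity is the only obstruction to lying in the image of \<open>rho\<close>.\<close>

lemma rho_surjective_aux:
  assumes "signed_perm n f" "parity f = 1" "k \<le> n" "\<And>x. x \<in> {int k + 1..int n} \<Longrightarrow> f x = x"
  shows "\<exists>g\<in>carrier W. rho g = f"
  using assms
proof (induction k arbitrary: f)
  case 0
  have "f = id" using 0 by (intro signed_perm_eqI) (auto intro: signed_perm_id)
  then show ?case by (intro bexI[of _ "\<one>\<^bsub>W\<^esub>"]) auto
next
  case (Suc k)
  define K where "K = int (Suc k)"
  have K: "1 \<le> K" "K \<le> int n" using Suc.prems by (auto simp: K_def)
  note f = Suc.prems(1) and D = signed_permD[OF Suc.prems(1)]
  have fK: "\<bar>f K\<bar> \<le> K" "f K \<noteq> 0"
  proof -
    show "f K \<noteq> 0" using D(8)[of K] K by simp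
    show "\<bar>f K\<bar> \<le> K"
    proof (rule ccontr)
      assume a: "\<not> \<bar>f K\<bar> \<le> K"
      have "\<bar>f K\<bar> \<le> int n" using D(7)[of K] K by simp
      then have "f \<bar>f K\<bar> = \<bar>f K\<bar>" using Suc.prems(4) a by (simp add: K_def)
      then have "\<bar>f \<bar>f K\<bar>\<bar> = \<bar>f K\<bar>" by simp
      then show False using D(6)[of "\<bar>f K\<bar>" K] a K by simp
    qed
  qed
  have reduce: "\<exists>g\<in>carrier W. rho g = f"
    if lp: "letter_pair n u v" and le: "\<bar>u\<bar> \<le> K" "\<bar>v\<bar> \<le> K"
      and h: "\<exists>g\<in>carrier W. rho g = sref u v \<circ> f" for u v f
  proof -
    obtain g where g: "g \<in> carrier W" "rho g = sref u v \<circ> f" using h by blast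
    have "rho (reflection u v \<otimes>\<^bsub>W\<^esub> g) = (sref u v \<circ> sref u v) \<circ> f"
      using g lp by (simp add: refl_closed rho_refl o_assoc)
    also have "\<dots> = f" using lp by (simp add: sref_invol_comp letter_pair_def)
    finally show ?thesis using g lp refl_closed by blast
  qed
  have sp: "signed_perm n (sref u v \<circ> f) \<and> parity (sref u v \<circ> f) = parity f"
    if "letter_pair n u v" "signed_perm n f" for u v f
    using that signed_perm_sref parity_rho[OF refl_closed[OF that(1)]]
    by (auto simp: signed_perm_comp parity_comp rho_refl)
  have fixb: "sref u v x = x" if "\<bar>u\<bar> \<le> K" "\<bar>v\<bar> \<le> K" "x \<in> {K + 1..int n}" for u v x
    using that by (intro sref_other) auto
  consider "f K = K" | "f K \<noteq> K" "f K \<noteq> - K" | "f K = - K" "K > 1" | "f K = - K" "K = 1"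
    using K by fastforce
  then show ?case
  proof cases
    case 1
    have "f x = x" if "x \<in> {int k + 1..int n}" for x
      using that 1 Suc.prems(4)[of x] by (cases "x = K") (auto simp: K_def)
    then show ?thesis using Suc.IH[of f] Suc.prems by simp
  next
    case 2
    then have lp: "letter_pair n K (f K)" using K fK by (auto simp: letter_pair_def)
    have "\<exists>g\<in>carrier W. rho g = sref K (f K) \<circ> f"
    proof (rule Suc.IH[of "sref K (f K) \<circ> f"])
      show "(sref K (f K) \<circ> f) x = x" if "x \<in> {int k + 1..int n}" for x
        using that fixb[of K "f K" x] fK Suc.prems(4)[of x] K by (cases "x = K") (auto simp: K_def)
    qed (use sp[OF lp f] Suc.prems(2,3) in \<open>blast, metis, linarith\<close>)
    then show ?thesis using reduce[OF lp] fK K by auto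
  next
    case 3
    have lp: "letter_pair n 1 (- K)" "letter_pair n 1 K" using K 3 by (auto simp: letter_pair_def)
    have "\<exists>g\<in>carrier W. rho g = sref 1 K \<circ> (sref 1 (- K) \<circ> f)"
    proof (rule Suc.IH[of "sref 1 K \<circ> (sref 1 (- K) \<circ> f)"])
      show "(sref 1 K \<circ> (sref 1 (- K) \<circ> f)) x = x" if "x \<in> {int k + 1..int n}" for x
        using that fixb[of 1 K x] fixb[of 1 "- K" x] 3 Suc.prems(4)[of x] K
        by (cases "x = K") (auto simp: K_def)
    qed (use sp[OF lp(1) f] sp[OF lp(2), of "sref 1 (- K) \<circ> f"] Suc.prems(2,3) in
        \<open>blast, metis, linarith\<close>)
    then have "\<exists>g\<in>carrier W. rho g = sref 1 (- K) \<circ> f" using reduce[OF lp(2)] K by auto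
    then show ?thesis using reduce[OF lp(1)] K by auto
  next
    case 4
    have "f = negate 1"
    proof (rule signed_perm_eqI[OF f])
      show "signed_perm n (negate 1)" using n_ge by (intro signed_perm_neg) auto
      show "f x = negate 1 x" if "x \<in> {1..int n}" for x
        using that 4 Suc.prems(4)[of x] by (cases "x = 1") (auto simp: negate_def K_def)
    qed
    then show ?thesis using Suc.prems(2) parity_neg[of 1] n_ge by simp
  qed
qed

lemma rho_surjective: "signed_perm n f \<Longrightarrow> parity f = 1 \<Longrightarrow> \<exists>g\<in>carrier W. rho g = f"
  using rho_surjective_aux[of f n] by simp


subsection \<open>Cycles as products of reflections\<close>

text \<open>The element \<open>path_elt a m\<close> acts as the positive cycle \<open>a\<^sub>0 \<mapsto> a\<^sub>1 \<mapsto> \<dots> \<mapsto> a\<^bsub>m-1\<^esub> \<mapsto> a\<^sub>0\<close>; its word has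
  \<open>m - 1\<close> letters.\<close>

definition path_word :: "(nat \<Rightarrow> int) \<Rightarrow> nat \<Rightarrow> nat gword set list" where
  "path_word a m = map (\<lambda>i. reflection (a i) (a (Suc i))) [0..<m - 1]"

definition path_elt :: "(nat \<Rightarrow> int) \<Rightarrow> nat \<Rightarrow> nat gword set" where
  "path_elt a m = list_mult W (path_word a m)"

definition distinct_letters :: "(nat \<Rightarrow> int) \<Rightarrow> nat \<Rightarrow> bool" where
  "distinct_letters a m \<longleftrightarrow> inj_on (\<lambda>i. \<bar>a i\<bar>) {..<m} \<and> (\<forall>i<m. a i \<noteq> 0 \<and> \<bar>a i\<bar> \<le> int n)"

lemma distinct_letters_pair:
  "distinct_letters a m \<Longrightarrow> i < m \<Longrightarrow> j < m \<Longrightarrow> i \<noteq> j \<Longrightarrow> letter_pair n (a i) (a j)"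
  by (auto simp: distinct_letters_def letter_pair_def inj_on_def)

lemma path_word_T: "distinct_letters a m \<Longrightarrow> set (path_word a m) \<subseteq> R.T"
  by (auto simp: path_word_def intro!: refl_T distinct_letters_pair)

lemma path_elt_closed: "distinct_letters a m \<Longrightarrow> path_elt a m \<in> carrier W"
  unfolding path_elt_def by (intro R.T_list_mult_closed path_word_T)

lemma rho_path_elt:
  assumes "distinct_letters a (Suc m)"
  shows "(\<forall>i<m. rho (path_elt a (Suc m)) (a i) = a (Suc i)) \<and> rho (path_elt a (Suc m)) (a m) = a 0
    \<and> (\<forall>x. (\<forall>i\<le>m. \<bar>x\<bar> \<noteq> \<bar>a i\<bar>) \<longrightarrow> rho (path_elt a (Suc m)) x = x)"
  using assms
proof (induction m)
  case 0
  then show ?case by (simp add: path_elt_def path_word_def)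
next
  case (Suc m)
  have d: "distinct_letters a (Suc m)"
    using Suc.prems by (auto simp: distinct_letters_def inj_on_def)
  have lp: "letter_pair n (a m) (a (Suc m))" using Suc.prems by (intro distinct_letters_pair) auto
  have ne: "\<bar>a i\<bar> \<noteq> \<bar>a j\<bar>" if "i < Suc (Suc m)" "j < Suc (Suc m)" "i \<noteq> j" for i j
    using distinct_letters_pair[OF Suc.prems that] by (simp add: letter_pair_def)
  have "path_elt a (Suc (Suc m)) = path_elt a (Suc m) \<otimes>\<^bsub>W\<^esub> reflection (a m) (a (Suc m))"
    using path_word_T[OF d] R.T_list_mult_append[of "path_word a (Suc m)" "[reflection (a m) (a (Suc m))]"]
      refl_T[OF lp] refl_closed[OF lp]
    by (simp add: path_elt_def path_word_def)
  then have *: "rho (path_elt a (Suc (Suc m))) x = rho (path_elt a (Suc m)) (sref (a m) (a (Suc m)) x)" for x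
    using path_elt_closed[OF d] refl_closed[OF lp] rho_refl[OF lp] by simp
  show ?case
  proof (intro conjI allI impI)
    fix i assume "i < Suc m"
    then consider "i < m" | "i = m" by linarith
    then show "rho (path_elt a (Suc (Suc m))) (a i) = a (Suc i)"
    proof cases
      case 1
      then have "sref (a m) (a (Suc m)) (a i) = a i" using ne by (intro sref_other) auto
      then show ?thesis using * Suc.IH[OF d] 1 by simp
    next
      case 2
      have "\<forall>i\<le>m. \<bar>a (Suc m)\<bar> \<noteq> \<bar>a i\<bar>" using ne by auto
      then show ?thesis using * Suc.IH[OF d] 2 by simp
    qed
  next
    show "rho (path_elt a (Suc (Suc m))) (a (Suc m)) = a 0" using * Suc.IH[OF d] by simp
  next
    fix x assume x: "\<forall>i\<le>Suc m. \<bar>x\<bar> \<noteq> \<bar>a i\<bar>"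
    then have "sref (a m) (a (Suc m)) x = x" by (intro sref_other) auto
    then show "rho (path_elt a (Suc (Suc m))) x = x" using * Suc.IH[OF d] x by simp
  qed
qed

end


section \<open>Counting the cycles of a product of transpositions\<close>

lemma transpose_image_eq_iff: "transpose a b ` A = A \<longleftrightarrow> (a \<in> A \<longleftrightarrow> b \<in> A)"
proof
  assume A: "transpose a b ` A = A"
  have "transpose a b a \<in> A" if "a \<in> A" using that A by blast
  moreover have "transpose a b b \<in> A" if "b \<in> A" using that A by blast
  ultimately show "a \<in> A \<longleftrightarrow> b \<in> A" by auto
next
  assume *: "a \<in> A \<longleftrightarrow> b \<in> A"
  have closed: "transpose a b x \<in> A" if "x \<in> A" for x
    using that * by (metis transpose_apply_first transpose_apply_second transpose_apply_other)
  show "transpose a b ` A = A"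
  proof (intro equalityI subsetI)
    fix x assume "x \<in> A"
    then have "transpose a b (transpose a b x) \<in> transpose a b ` A" using closed by blast
    then show "x \<in> transpose a b ` A" by simp
  qed (use closed in blast)
qed

lemma card_transpose_image_Int:
  assumes "finite A" "(a \<in> A) \<noteq> (b \<in> A)" "(a \<in> B) \<noteq> (b \<in> B)"
  shows "card (transpose a b ` A \<inter> B) \<noteq> card (A \<inter> B)"
proof -
  have *: "card (transpose a b ` A \<inter> B) \<noteq> card (A \<inter> B)"
    if ab: "a \<in> A" "b \<notin> A" "(a \<in> B) \<noteq> (b \<in> B)" for a b
  proof -
    have t: "transpose a b ` A = insert b (A - {a})"
      using ab by (auto simp: Transposition.transpose_def image_iff)
    show ?thesis
    proof (cases "a \<in> B")
      case True
      then have "transpose a b ` A \<inter> B = A \<inter> B - {a}" using t ab by auto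
      then show ?thesis using True ab assms(1) card_Diff1_less[of "A \<inter> B" a] by auto
    next
      case False
      then have "transpose a b ` A \<inter> B = insert b (A \<inter> B)" using t ab by auto
      then show ?thesis using ab assms(1) by simp
    qed
  qed
  show ?thesis
    using assms *[of a b] *[of b a] by (metis transpose_commute)
qed

definition transposition_product :: "('a \<times> 'a) list \<Rightarrow> 'a \<Rightarrow> 'a" where
  "transposition_product ps = foldr (\<lambda>(a, b) g. transpose a b \<circ> g) ps id"

lemma transposition_product_simps [simp]:
  "transposition_product [] = id"
  "transposition_product ((a, b) # ps) = transpose a b \<circ> transposition_product ps"
  by (simp_all add: transposition_product_def)

lemma bij_transposition_product: "bij (transposition_product ps)"
proof (induction ps)
  case Nil
  show ?case unfolding transposition_product_simps by (rule bij_id)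
next
  case (Cons p ps)
  then show ?case
    by (cases p) (simp only: transposition_product_simps, intro bij_comp bij_transpose)
qed

lemma transposition_product_invariant:
  "\<forall>(a, b)\<in>set ps. a \<in> A \<longleftrightarrow> b \<in> A \<Longrightarrow> transposition_product ps ` A = A"
proof (induction ps)
  case (Cons p ps)
  obtain a b where p: "p = (a, b)" by (cases p)
  have "transpose a b ` (transposition_product ps ` A) = A"
    using Cons transpose_image_eq_iff[of a b A] by (simp add: p)
  then show ?case by (simp only: p transposition_product_simps image_comp)
qed simp

text \<open>The symmetric difference with \<open>A0\<close> exchanges \<open>\<G>\<close> and its complement in \<open>\<F>\<close>.\<close>

lemma card_symdiff_half:
  assumes "finite \<F>" "\<G> \<subseteq> \<F>" "A0 \<in> \<F>"
    and "\<And>A. A \<in> \<F> \<Longrightarrow> (A - A0) \<union> (A0 - A) \<in> \<F>"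
    and "\<And>A. A \<in> \<F> \<Longrightarrow> A \<in> \<G> \<longleftrightarrow> (A - A0) \<union> (A0 - A) \<notin> \<G>"
  shows "card \<F> = 2 * card \<G>"
proof -
  let ?d = "\<lambda>A. (A - A0) \<union> (A0 - A)"
  have inv: "?d (?d A) = A" for A by blast
  have "bij_betw ?d \<G> (\<F> - \<G>)"
  proof (rule bij_betw_byWitness[where f' = ?d])
    show "?d ` \<G> \<subseteq> \<F> - \<G>" using assms by blast
    show "?d ` (\<F> - \<G>) \<subseteq> \<G>" using assms by blast
  qed (use inv in auto)
  then have "card \<G> = card (\<F> - \<G>)" by (rule bij_betw_same_card)
  then show ?thesis
    using assms(1,2) card_Diff_subset[of \<G> \<F>] card_mono[of \<F> \<G>] finite_subset[of \<G> \<F>] by linarith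
qed

text \<open>Since a permutation with \<open>c\<close> cycles has \<open>2\<^sup>c\<close> invariant sets, this says that a product of \<open>r\<close> transpositions
  whose graph on \<open>V\<close> has \<open>d\<close> components has at most \<open>r - |V| + 2 d\<close> cycles. A new transposition \<open>(a b)\<close> at most
  doubles the number of invariant sets if \<open>a\<close> and \<open>b\<close> lie in one component. If not, a component \<open>A0\<close>
  separates \<open>a\<close> from \<open>b\<close>; then the transposition merges two components and two cycles, and both counts are
  halved.\<close>

theorem card_invariant_sets:
  fixes ps :: "('a \<times> 'a) list"
  assumes "finite V"
  shows "card {A. A \<subseteq> V \<and> transposition_product ps ` A = A} * 2 ^ card V
    \<le> 2 ^ length ps * (card {A. A \<subseteq> V \<and> (\<forall>(a, b)\<in>set ps. a \<in> A \<longleftrightarrow> b \<in> A)})\<^sup>2"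
proof (induction ps)
  case Nil
  have "card {A. A \<subseteq> V} = 2 ^ card V" using assms card_Pow[of V] by (simp add: Pow_def)
  then show ?case by (simp add: power2_eq_square)
next
  case (Cons p ps)
  obtain a b where p: "p = (a, b)" by (cases p)
  define \<pi> where "\<pi> = transposition_product ps"
  define N where "N = {A. A \<subseteq> V \<and> \<pi> ` A = A}"
  define N' where "N' = {A. A \<subseteq> V \<and> transposition_product (p # ps) ` A = A}"
  define M where "M = {A. A \<subseteq> V \<and> (\<forall>(a, b)\<in>set ps. a \<in> A \<longleftrightarrow> b \<in> A)}"
  define M' where "M' = {A. A \<subseteq> V \<and> (\<forall>(a, b)\<in>set (p # ps). a \<in> A \<longleftrightarrow> b \<in> A)}"
  let ?d = "\<lambda>B A. (A - B) \<union> (B - A)"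
  define P where "P = {A \<in> N. a \<in> A \<longleftrightarrow> b \<in> A}"
  have fin: "finite N" "finite N'" "finite M" "finite M'" "finite P"
    using assms by (auto simp: N_def N'_def M_def M'_def P_def)
  have inj: "inj \<pi>" using bij_transposition_product \<pi>_def bij_is_inj by blast
  have N'_iff: "A \<in> N' \<longleftrightarrow> A \<subseteq> V \<and> \<pi> ` A = transpose a b ` A" for A
  proof -
    have "transposition_product (p # ps) ` A = transpose a b ` (\<pi> ` A)"
      by (simp only: p \<pi>_def image_comp transposition_product_simps)
    moreover have "transpose a b ` (\<pi> ` A) = A \<longleftrightarrow> \<pi> ` A = transpose a b ` A"
    proof
      assume "transpose a b ` (\<pi> ` A) = A"
      then have "transpose a b ` A = transpose a b ` (transpose a b ` (\<pi> ` A))" by simp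
      then show "\<pi> ` A = transpose a b ` A" by (simp add: image_image)
    qed (simp add: image_image)
    ultimately show ?thesis by (simp add: N'_def)
  qed
  have N'P: "A \<in> N' \<longleftrightarrow> A \<in> N" if "a \<in> A \<longleftrightarrow> b \<in> A" for A
    using transpose_image_eq_iff[of a b A] that N'_iff by (simp add: N_def)
  have d\<pi>: "\<pi> ` ?d A B = ?d (\<pi> ` A) (\<pi> ` B)" for A B
    by (simp only: image_Un image_set_diff[OF inj])
  have dt: "transpose a b ` ?d A B = ?d (transpose a b ` A) (transpose a b ` B)" for A B
    by (simp only: image_Un image_set_diff[OF bij_is_inj[OF bij_transpose]])
  have dN: "?d A B \<in> N" if "A \<in> N" "B \<in> N" for A B
    using that d\<pi>[of A B] by (auto simp only: N_def mem_Collect_eq)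
  have dN': "?d A B \<in> N" if "A \<in> N'" "B \<in> N'" "(a \<in> A) \<noteq> (b \<in> A)" "(a \<in> B) \<noteq> (b \<in> B)" for A B
  proof -
    have e: "\<pi> ` A = transpose a b ` A" "\<pi> ` B = transpose a b ` B" "A \<subseteq> V" "B \<subseteq> V"
      using that(1,2) by (simp_all only: N'_iff)
    have m: "?d A B \<in> N'"
      unfolding N'_iff d\<pi> dt e(1,2) using e(3,4) by blast
    have eq: "a \<in> ?d A B \<longleftrightarrow> b \<in> ?d A B" using that(3,4) by blast
    show ?thesis using m unfolding N'P[OF eq] .
  qed
  have "card N' * 2 ^ card V \<le> 2 ^ (Suc (length ps)) * (card M')\<^sup>2"
  proof (cases "\<forall>A\<in>M. a \<in> A \<longleftrightarrow> b \<in> A")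
    case True
    then have "M' = M" by (auto simp: M_def M'_def p)
    have "card N' \<le> 2 * card P"
    proof (cases "N' \<subseteq> P")
      case True
      then show ?thesis using fin card_mono[of P N'] by simp
    next
      case False
      then obtain A0 where A0: "A0 \<in> N'" "(a \<in> A0) \<noteq> (b \<in> A0)"
        using N'P by (auto simp: P_def)
      have "card (N' - P) \<le> card P"
      proof (rule card_inj_on_le[where f = "?d A0"])
        show "inj_on (?d A0) (N' - P)" by (rule inj_onI) blast
        show "?d A0 ` (N' - P) \<subseteq> P"
        proof
          fix B assume "B \<in> ?d A0 ` (N' - P)"
          then obtain A where A: "A \<in> N'" "A \<notin> P" "B = ?d A0 A" by blast
          then have "(a \<in> A) \<noteq> (b \<in> A)" using N'P by (auto simp: P_def)
          then show "B \<in> P" using dN'[OF A0(1) A(1) A0(2)] A0 A(3) by (auto simp: P_def)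
        qed
      qed (use fin in simp)
      moreover have "P \<subseteq> N'" using N'P by (auto simp: P_def)
      ultimately show ?thesis using fin card_Diff_subset[of P N'] card_mono[of N' P] by simp
    qed
    also have "card P \<le> card N" using fin by (intro card_mono) (auto simp: P_def)
    finally have "card N' * 2 ^ card V \<le> 2 * (card N * 2 ^ card V)" by simp
    also have "\<dots> \<le> 2 * (2 ^ length ps * (card M)\<^sup>2)"
      using Cons by (simp add: N_def M_def \<pi>_def)
    finally show ?thesis using \<open>M' = M\<close> by simp
  next
    case False
    then obtain A0 where A0: "A0 \<in> M" "(a \<in> A0) \<noteq> (b \<in> A0)" by blast
    have A0N: "A0 \<in> N"
      using A0(1) transposition_product_invariant[of ps A0] by (auto simp: M_def N_def \<pi>_def)
    have "card M = 2 * card M'"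
    proof (rule card_symdiff_half[OF fin(3) _ A0(1)])
      show "M' \<subseteq> M" by (auto simp: M_def M'_def)
      show "?d A0 A \<in> M" if "A \<in> M" for A using that A0 by (auto simp: M_def)
      show "A \<in> M' \<longleftrightarrow> ?d A0 A \<notin> M'" if "A \<in> M" for A
        using that A0 by (auto simp: M_def M'_def p)
    qed
    moreover have "card N = 2 * card P"
    proof (rule card_symdiff_half[OF fin(1) _ A0N])
      show "P \<subseteq> N" by (auto simp: P_def)
      show "?d A0 A \<in> N" if "A \<in> N" for A using dN[OF A0N that] .
      then show "A \<in> P \<longleftrightarrow> ?d A0 A \<notin> P" if "A \<in> N" for A
        using that A0 by (auto simp: P_def)
    qed
    moreover have "N' \<subseteq> P"
    proof
      fix A assume A: "A \<in> N'"
      \<comment> \<open>Otherwise the transposition would change the size of \<open>A \<inter> A0\<close>, while \<open>\<pi>\<close> preserves \<open>A0\<close>.\<close>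
      have "a \<in> A \<longleftrightarrow> b \<in> A"
      proof (rule ccontr)
        assume ab: "\<not> (a \<in> A \<longleftrightarrow> b \<in> A)"
        have "finite A" using A assms finite_subset by (auto simp: N'_def)
        have "transpose a b ` A \<inter> A0 = \<pi> ` A \<inter> \<pi> ` A0"
          using A A0N by (simp add: N'_iff N_def)
        also have "\<dots> = \<pi> ` (A \<inter> A0)" using inj by (simp add: image_Int)
        finally have "card (transpose a b ` A \<inter> A0) = card (A \<inter> A0)"
          using inj by (simp add: card_image inj_on_subset)
        then show False
          using card_transpose_image_Int[OF \<open>finite A\<close>, of a b A0] ab A0(2) by blast
      qed
      then show "A \<in> P" using A N'P by (auto simp: P_def)
    qed
    then have "card N' \<le> card P" using fin by (intro card_mono) auto
    moreover have "card N * 2 ^ card V \<le> 2 ^ length ps * (card M)\<^sup>2"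
      using Cons by (simp add: N_def M_def \<pi>_def)
    ultimately have "2 * (card N' * 2 ^ card V) \<le> 2 ^ length ps * (2 * card M')\<^sup>2"
      by (smt (verit, best) mult.assoc mult_le_mono1 mult_le_mono2 order_trans)
    then show ?thesis by (simp add: power2_eq_square mult_ac)
  qed
  then show ?case by (simp add: N'_def M'_def)
qed


section \<open>The shape of quasi-Coxeter elements of type D\<close>

context type_D
begin

lemma abs_sref:
  assumes "letter_pair n u v"
  shows "\<bar>sref u v x\<bar> = transpose \<bar>u\<bar> \<bar>v\<bar> \<bar>x\<bar>"
proof -
  have uv: "\<bar>u\<bar> \<noteq> \<bar>v\<bar>" "u \<noteq> 0" "v \<noteq> 0" using assms by (auto simp: letter_pair_def)
  consider "x = u \<or> x = - u" | "x = v \<or> x = - v" | "\<bar>x\<bar> \<noteq> \<bar>u\<bar>" "\<bar>x\<bar> \<noteq> \<bar>v\<bar>"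
    by linarith
  then show ?thesis
  proof cases
    case 1
    then have "\<bar>x\<bar> = \<bar>u\<bar>" "\<bar>sref u v x\<bar> = \<bar>v\<bar>"
      using sref_odd[OF uv, of u] by (metis abs_minus sref_apply(1))+
    then show ?thesis by simp
  next
    case 2
    then have "\<bar>x\<bar> = \<bar>v\<bar>" "\<bar>sref u v x\<bar> = \<bar>u\<bar>"
      using sref_odd[OF uv, of v] by (metis abs_minus sref_apply(2))+
    then show ?thesis by simp
  next
    case 3
    then show ?thesis by (simp add: sref_other transpose_apply_other)
  qed
qed

lemma abs_list_mult:
  assumes "set ts \<subseteq> R.T"
  shows "\<exists>ps. length ps = length ts \<and> (\<forall>x. \<bar>rho (list_mult W ts) x\<bar> = transposition_product ps \<bar>x\<bar>)
    \<and> (\<forall>A. (\<forall>(a, b)\<in>set ps. a \<in> A \<longleftrightarrow> b \<in> A) \<longrightarrow> (\<forall>t\<in>set ts. \<forall>x. \<bar>x\<bar> \<in> A \<longrightarrow> \<bar>rho t x\<bar> \<in> A))"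
  using assms
proof (induction ts)
  case (Cons t ts)
  then have "set ts \<subseteq> R.T" by simp
  from Cons.IH[OF this] obtain ps where ps: "length ps = length ts"
    "\<forall>x. \<bar>rho (list_mult W ts) x\<bar> = transposition_product ps \<bar>x\<bar>"
    "\<forall>A. (\<forall>(a, b)\<in>set ps. a \<in> A \<longleftrightarrow> b \<in> A) \<longrightarrow> (\<forall>t\<in>set ts. \<forall>x. \<bar>x\<bar> \<in> A \<longrightarrow> \<bar>rho t x\<bar> \<in> A)"
    by (elim exE conjE) (rule that)
  have "t \<in> R.T" using Cons.prems by simp
  from rho_T[OF this] obtain u v where uv: "letter_pair n u v" "rho t = sref u v" by blast
  have c: "t \<in> carrier W" "list_mult W ts \<in> carrier W"
    using Cons.prems R.T_closed R.T_list_mult_closed by auto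
  have "\<bar>rho (list_mult W (t # ts)) x\<bar> = transposition_product ((\<bar>u\<bar>, \<bar>v\<bar>) # ps) \<bar>x\<bar>" for x
    using c uv ps(2) by (simp add: abs_sref)
  moreover have "\<forall>r\<in>set (t # ts). \<forall>x. \<bar>x\<bar> \<in> A \<longrightarrow> \<bar>rho r x\<bar> \<in> A"
    if A: "\<forall>(a, b)\<in>set ((\<bar>u\<bar>, \<bar>v\<bar>) # ps). a \<in> A \<longleftrightarrow> b \<in> A" for A
  proof -
    have "transpose \<bar>u\<bar> \<bar>v\<bar> x \<in> A" if "x \<in> A" for x
      using A that by (cases "x = \<bar>u\<bar>"; cases "x = \<bar>v\<bar>") auto
    moreover have "\<forall>(a, b)\<in>set ps. a \<in> A \<longleftrightarrow> b \<in> A" using A by simp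
    ultimately show ?thesis using ps(3) uv by (simp add: abs_sref)
  qed
  ultimately show ?case using ps(1)
    by (intro exI[of _ "(\<bar>u\<bar>, \<bar>v\<bar>) # ps"] conjI allI impI) simp_all
qed (intro exI[of _ "[]"], simp)

lemma generate_preserves:
  assumes "set ts \<subseteq> R.T" "\<forall>t\<in>set ts. \<forall>x. \<bar>x\<bar> \<in> A \<longrightarrow> \<bar>rho t x\<bar> \<in> A" "g \<in> generate W (set ts)"
  shows "\<forall>x. \<bar>x\<bar> \<in> A \<longrightarrow> \<bar>rho g x\<bar> \<in> A"
  using assms(3)
proof (induction rule: generate.induct)
  case (inv t)
  then have "inv\<^bsub>W\<^esub> t = t" using assms R.T_inv by blast
  then show ?case using inv assms by simp
next
  case (eng g h)
  have "set ts \<subseteq> carrier W" using assms R.T_closed by blast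
  then have "g \<in> carrier W" "h \<in> carrier W" using eng W.generate_in_carrier by blast+
  then show ?case using eng by simp
qed (use assms in auto)

text \<open>The reflections generate the transitive group \<open>W\<close>, so only the empty set and the full set are invariant
  under all of them; with \<open>n\<close> reflections on \<open>n\<close> points the product has at most two cycles.\<close>

lemma quasi_coxeter_invariant_sets:
  assumes "set ts \<subseteq> R.T" "length ts = n" "generate W (set ts) = carrier W"
  shows "card {A. A \<subseteq> {1..int n} \<and> (\<lambda>x. \<bar>rho (list_mult W ts) x\<bar>) ` A = A} \<le> 4"
proof -
  let ?V = "{1..int n}"
  obtain ps where ps: "length ps = length ts"
    "\<And>x. \<bar>rho (list_mult W ts) x\<bar> = transposition_product ps \<bar>x\<bar>"
    "\<And>A. \<forall>(a, b)\<in>set ps. a \<in> A \<longleftrightarrow> b \<in> A \<Longrightarrow> \<forall>t\<in>set ts. \<forall>x. \<bar>x\<bar> \<in> A \<longrightarrow> \<bar>rho t x\<bar> \<in> A"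
    using abs_list_mult[OF assms(1)] by blast
  let ?M = "{A. A \<subseteq> ?V \<and> (\<forall>(a, b)\<in>set ps. a \<in> A \<longleftrightarrow> b \<in> A)}"
  have "?M \<subseteq> {{}, ?V}"
  proof
    fix A assume A: "A \<in> ?M"
    have closed: "\<bar>rho g x\<bar> \<in> A" if "g \<in> carrier W" "\<bar>x\<bar> \<in> A" for g x
      using generate_preserves[OF assms(1) ps(3)] A that assms(3) by blast
    have "A = ?V" if nonempty: "A \<noteq> {}"
    proof -
      obtain x where x: "x \<in> A" "x \<in> ?V" using A nonempty by blast
      have "y \<in> A" if y: "y \<in> ?V" for y
      proof (cases "x = y")
        case False
        then have "letter_pair n x y" using x y by (auto simp: letter_pair_def)
        then show ?thesis using closed[of "reflection x y" x] x y by (simp add: refl_closed rho_refl)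
      qed (use x in simp)
      then show ?thesis using A by blast
    qed
    then show "A \<in> {{}, ?V}" by blast
  qed
  then have "card ?M \<le> card {{}, ?V}" by (intro card_mono) auto
  also have "\<dots> \<le> 2" by (simp add: card_insert_if)
  finally have "(card ?M)\<^sup>2 \<le> 2\<^sup>2" by (intro power_mono) auto
  have im: "(\<lambda>x. \<bar>rho (list_mult W ts) x\<bar>) ` A = transposition_product ps ` A" if "A \<subseteq> ?V" for A
    using that ps(2) by (intro image_cong) auto
  have "{A. A \<subseteq> ?V \<and> (\<lambda>x. \<bar>rho (list_mult W ts) x\<bar>) ` A = A}
      = {A. A \<subseteq> ?V \<and> transposition_product ps ` A = A}"
  proof (rule Collect_cong, rule conj_cong, rule HOL.refl)
    fix A assume "A \<subseteq> ?V"
    from im[OF this]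
    show "((\<lambda>x. \<bar>rho (list_mult W ts) x\<bar>) ` A = A) = (transposition_product ps ` A = A)"
      by (rule arg_cong)
  qed
  moreover have "card {A. A \<subseteq> ?V \<and> transposition_product ps ` A = A} * 2 ^ n \<le> 2 ^ n * (card ?M)\<^sup>2"
    using card_invariant_sets[of ?V ps] ps(1) assms(2) by simp
  ultimately show ?thesis using \<open>(card ?M)\<^sup>2 \<le> 2\<^sup>2\<close> by simp
qed



definition orb :: "(int \<Rightarrow> int) \<Rightarrow> int \<Rightarrow> nat \<Rightarrow> int" where
  "orb f a i = (f ^^ i) a"

lemma orb_0 [simp]: "orb f a 0 = a" and orb_Suc: "orb f a (Suc i) = f (orb f a i)"
  by (simp_all add: orb_def)

lemma orb_uminus: "signed_perm n f \<Longrightarrow> orb f (- a) i = - orb f a i"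
  by (induction i) (auto simp: orb_Suc signed_permD)

lemma orb_letter: "signed_perm n f \<Longrightarrow> a \<noteq> 0 \<Longrightarrow> \<bar>a\<bar> \<le> int n \<Longrightarrow> orb f a i \<noteq> 0 \<and> \<bar>orb f a i\<bar> \<le> int n"
  by (induction i) (auto simp: orb_Suc signed_permD)

text \<open>A cycle of \<open>f\<close> through \<open>a\<close>, of length \<open>m\<close> up to sign; the last conjunct allows positive and negative cycles.\<close>

definition cycle :: "(int \<Rightarrow> int) \<Rightarrow> int \<Rightarrow> nat \<Rightarrow> bool" where
  "cycle f a m \<longleftrightarrow> m > 0 \<and> distinct_letters (orb f a) m \<and> (orb f a m = a \<or> orb f a m = - a)"

definition support :: "(int \<Rightarrow> int) \<Rightarrow> int \<Rightarrow> nat \<Rightarrow> int set" where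
  "support f a m = (\<lambda>i. \<bar>orb f a i\<bar>) ` {..<m}"

lemma cycle_exists:
  assumes f: "signed_perm n f" and a: "a \<noteq> 0" "\<bar>a\<bar> \<le> int n"
  shows "\<exists>m. cycle f a m"
proof -
  have sub: "\<bar>orb f a i\<bar> = \<bar>orb f a j\<bar> \<Longrightarrow> i \<le> j \<Longrightarrow> \<bar>orb f a (j - i)\<bar> = \<bar>a\<bar>" for i j
  proof -
    assume *: "\<bar>orb f a i\<bar> = \<bar>orb f a j\<bar>" "i \<le> j"
    have "orb f a j = (f ^^ i) (orb f a (j - i))"
      using *(2) by (metis comp_apply funpow_add le_add_diff_inverse orb_def)
    then show "\<bar>orb f a (j - i)\<bar> = \<bar>a\<bar>"
      using * signed_permD(6)[OF signed_perm_pow[OF f], of i] by (metis orb_def)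
  qed
  have "\<not> inj_on (\<lambda>i. \<bar>orb f a i\<bar>) {0..n}"
  proof
    assume "inj_on (\<lambda>i. \<bar>orb f a i\<bar>) {0..n}"
    moreover have "\<bar>orb f a i\<bar> \<in> {1..int n}" for i using orb_letter[OF f a, of i] by auto
    ultimately have "card {0..n} \<le> card {1..int n}" by (intro card_inj_on_le) auto
    then show False by simp
  qed
  then obtain i j where "i < j" "\<bar>orb f a i\<bar> = \<bar>orb f a j\<bar>"
    unfolding inj_on_def by (metis linorder_neqE_nat)
  then have ex: "\<exists>m>0. \<bar>orb f a m\<bar> = \<bar>a\<bar>" using sub[of i j] by (intro exI[of _ "j - i"]) auto
  define m where "m = (LEAST m. m > 0 \<and> \<bar>orb f a m\<bar> = \<bar>a\<bar>)"
  have m: "m > 0" "\<bar>orb f a m\<bar> = \<bar>a\<bar>" using LeastI_ex[OF ex] by (auto simp: m_def)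
  have least: "\<bar>orb f a l\<bar> \<noteq> \<bar>a\<bar>" if "0 < l" "l < m" for l
    using that not_less_Least[of l "\<lambda>m. m > 0 \<and> \<bar>orb f a m\<bar> = \<bar>a\<bar>"] by (auto simp: m_def)
  have "inj_on (\<lambda>i. \<bar>orb f a i\<bar>) {..<m}"
  proof (rule linorder_inj_onI)
    fix i j assume ij: "i < j" "i \<in> {..<m}" "j \<in> {..<m}"
    then have "0 < j - i" "j - i < m" by auto
    from least[OF this] show "\<bar>orb f a i\<bar> \<noteq> \<bar>orb f a j\<bar>" using sub[of i j] ij by auto
  qed auto
  then show ?thesis
    using m orb_letter[OF f a] by (auto simp: cycle_def distinct_letters_def abs_eq_iff)
qed

lemma cycle_closes: "cycle f a m \<Longrightarrow> \<bar>orb f a m\<bar> = \<bar>a\<bar>"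
  unfolding cycle_def by (metis abs_minus)

lemma cycle_pos: "cycle f a m \<Longrightarrow> m > 0"
  and cycle_distinct: "cycle f a m \<Longrightarrow> distinct_letters (orb f a) m"
  by (simp_all add: cycle_def)

lemma start_in_support: "cycle f a m \<Longrightarrow> \<bar>a\<bar> \<in> support f a m"
  unfolding support_def by (intro image_eqI[of _ _ 0]) (simp_all add: cycle_pos)

lemma card_support: "cycle f a m \<Longrightarrow> card (support f a m) = m"
  using cycle_distinct[of f a m] by (simp add: support_def card_image distinct_letters_def)

lemma support_subset: "cycle f a m \<Longrightarrow> support f a m \<subseteq> {1..int n}"
  using cycle_distinct[of f a m] by (force simp: support_def distinct_letters_def)

lemma abs_f_abs: "signed_perm n f \<Longrightarrow> \<bar>f \<bar>x\<bar>\<bar> = \<bar>f x\<bar>"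
  by (simp add: signed_permD(6))

lemma support_invariant:
  assumes f: "signed_perm n f" and c: "cycle f a m"
  shows "(\<lambda>x. \<bar>f x\<bar>) ` support f a m = support f a m"
proof (rule endo_inj_surj)
  show "finite (support f a m)" by (simp add: support_def)
  show "inj_on (\<lambda>x. \<bar>f x\<bar>) (support f a m)"
    by (rule inj_onI) (auto simp: signed_permD(6)[OF f] support_def)
  show "(\<lambda>x. \<bar>f x\<bar>) ` support f a m \<subseteq> support f a m"
  proof
    fix y assume "y \<in> (\<lambda>x. \<bar>f x\<bar>) ` support f a m"
    then obtain i where i: "i < m" "y = \<bar>orb f a (Suc i)\<bar>"
      by (auto simp: support_def abs_f_abs[OF f] orb_Suc)
    show "y \<in> support f a m"
    proof (cases "Suc i = m")
      case True
      then have "y = \<bar>a\<bar>" using i(2) cycle_closes[OF c] by simp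
      then show ?thesis using start_in_support[OF c] by simp
    next
      case False
      then show ?thesis using i unfolding support_def by (intro image_eqI[of _ _ "Suc i"]) auto
    qed
  qed
qed

lemma supports_disjoint:
  assumes f: "signed_perm n f" and c: "cycle f a m" and b: "\<bar>b\<bar> \<notin> support f a m"
  shows "\<bar>orb f b j\<bar> \<notin> support f a m"
proof (induction j)
  case (Suc j)
  show ?case
  proof
    assume "\<bar>orb f b (Suc j)\<bar> \<in> support f a m"
    then obtain x where x: "x \<in> support f a m" "\<bar>f (orb f b j)\<bar> = \<bar>f x\<bar>"
      using support_invariant[OF f c] by (auto simp: orb_Suc)
    then have "\<bar>orb f b j\<bar> = \<bar>x\<bar>" using signed_permD(6)[OF f] by simp
    moreover have "\<bar>x\<bar> = x" using x(1) by (auto simp: support_def)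
    ultimately show False using Suc x by simp
  qed
qed (use b in simp)

text \<open>The positive cycle \<open>path_elt (orb f a) m\<close> differs from \<open>f\<close> on the letters of the cycle only by a
  sign where the cycle closes.\<close>

definition closing_sign :: "(int \<Rightarrow> int) \<Rightarrow> int \<Rightarrow> nat \<Rightarrow> int \<Rightarrow> int" where
  "closing_sign f a m = (if orb f a m = a then id else negate a)"

definition cycle_part :: "(int \<Rightarrow> int) \<Rightarrow> int \<Rightarrow> nat \<Rightarrow> int \<Rightarrow> int" where
  "cycle_part f a m = closing_sign f a m \<circ> rho (path_elt (orb f a) m)"

lemma cycle_letter: "cycle f a m \<Longrightarrow> a \<noteq> 0 \<and> \<bar>a\<bar> \<le> int n"
  using cycle_distinct[of f a m] cycle_pos[of f a m]
  unfolding distinct_letters_def by (metis orb_0)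

lemma path_elt_orb_closed: "cycle f a m \<Longrightarrow> path_elt (orb f a) m \<in> carrier W"
  by (intro path_elt_closed cycle_distinct)

lemma signed_perm_closing_sign: "cycle f a m \<Longrightarrow> signed_perm n (closing_sign f a m)"
  using cycle_letter signed_perm_id signed_perm_neg by (auto simp: closing_sign_def)

lemma signed_perm_cycle_part: "cycle f a m \<Longrightarrow> signed_perm n (cycle_part f a m)"
  unfolding cycle_part_def
  by (intro signed_perm_comp signed_perm_closing_sign rho_signed_perm path_elt_orb_closed)

lemma parity_cycle_part: "cycle f a m \<Longrightarrow> parity (cycle_part f a m) = parity (closing_sign f a m)"
  unfolding cycle_part_def
  using parity_comp[OF signed_perm_closing_sign rho_signed_perm[OF path_elt_orb_closed]]
    parity_rho[OF path_elt_orb_closed] by fastforce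

lemma path_elt_fixes:
  assumes c: "cycle f a m" and "\<bar>x\<bar> \<notin> support f a m"
  shows "rho (path_elt (orb f a) m) x = x"
proof -
  obtain k where k: "m = Suc k" using cycle_pos[OF c] gr0_conv_Suc by blast
  have "\<forall>i\<le>k. \<bar>x\<bar> \<noteq> \<bar>orb f a i\<bar>" using assms(2) by (auto simp: support_def k)
  then show ?thesis using rho_path_elt[of "orb f a" k] cycle_distinct[OF c] k by simp
qed

lemma cycle_part_fixes:
  assumes c: "cycle f a m" and "\<bar>x\<bar> \<notin> support f a m"
  shows "cycle_part f a m x = x"
proof -
  have "\<bar>x\<bar> \<noteq> \<bar>a\<bar>" using start_in_support[OF c] assms(2) by metis
  then show ?thesis
    using path_elt_fixes[OF assms] by (simp add: cycle_part_def closing_sign_def negate_def)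
qed

lemma cycle_part_orb:
  assumes f: "signed_perm n f" and c: "cycle f a m" and i: "i < m"
  shows "cycle_part f a m (orb f a i) = f (orb f a i)"
proof -
  obtain k where k: "m = Suc k" using cycle_pos[OF c] gr0_conv_Suc by blast
  note p = rho_path_elt[of "orb f a" k, folded k]
  have d: "distinct_letters (orb f a) m" "orb f a m = a \<or> orb f a m = - a"
    using c unfolding cycle_def by blast+
  show ?thesis
  proof (cases "i = k")
    case True
    have "rho (path_elt (orb f a) m) (orb f a i) = a" using p d True by simp
    then have "cycle_part f a m (orb f a i) = closing_sign f a m a" by (simp add: cycle_part_def)
    also have "\<dots> = orb f a m" using d(2) by (auto simp: closing_sign_def negate_def)
    finally show ?thesis using True k by (simp add: orb_Suc)
  next
    case False
    then have *: "rho (path_elt (orb f a) m) (orb f a i) = f (orb f a i)"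
      using p d i k by (simp add: orb_Suc)
    have "\<bar>orb f a (Suc i)\<bar> \<noteq> \<bar>orb f a 0\<bar>"
      using distinct_letters_pair[OF d(1), of "Suc i" 0] False i k by (simp add: letter_pair_def)
    then have "closing_sign f a m (f (orb f a i)) = f (orb f a i)"
      by (simp add: closing_sign_def negate_def orb_Suc)
    then show ?thesis using * by (simp add: cycle_part_def)
  qed
qed

lemma cycle_part_eq:
  assumes f: "signed_perm n f" and c: "cycle f a m" and x: "\<bar>x\<bar> \<in> support f a m"
  shows "cycle_part f a m x = f x"
proof -
  obtain i where i: "i < m" "\<bar>x\<bar> = \<bar>orb f a i\<bar>" using x by (auto simp: support_def)
  have odd: "cycle_part f a m (- y) = - cycle_part f a m y" for y
    using signed_permD(2)[OF signed_perm_cycle_part[OF c]] .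
  from i(2) have "x = orb f a i \<or> x = - orb f a i" by linarith
  then show ?thesis
    using cycle_part_orb[OF f c i(1)] odd[of "orb f a i"] signed_permD(2)[OF f, of "orb f a i"] by auto
qed

lemma eq_one_cycle:
  assumes f: "signed_perm n f" and c: "cycle f a m" and V: "support f a m = {1..int n}"
  shows "f = cycle_part f a m"
  using cycle_part_eq[OF f c] V f signed_perm_cycle_part[OF c]
  by (intro signed_perm_eqI) auto

lemma eq_two_cycles:
  assumes f: "signed_perm n f" and c: "cycle f a m" "cycle f b k"
    and b: "\<bar>b\<bar> \<notin> support f a m" and V: "support f a m \<union> support f b k = {1..int n}"
  shows "f = cycle_part f a m \<circ> cycle_part f b k"
proof (rule signed_perm_eqI[OF f signed_perm_comp[OF signed_perm_cycle_part signed_perm_cycle_part]])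
  fix x assume x: "x \<in> {1..int n}"
  have dis: "support f a m \<inter> support f b k = {}"
    using supports_disjoint[OF f c(1) b] by (auto simp: support_def[of f b])
  show "f x = (cycle_part f a m \<circ> cycle_part f b k) x"
  proof (cases "x \<in> support f b k")
    case True
    then have "\<bar>f x\<bar> \<in> support f b k" using support_invariant[OF f c(2)] by blast
    then have "cycle_part f a m (f x) = f x" using dis by (intro cycle_part_fixes[OF c(1)]) blast
    then show ?thesis using cycle_part_eq[OF f c(2), of x] True x by simp
  next
    case False
    moreover have "\<bar>x\<bar> = x" using x by simp
    ultimately have x': "\<bar>x\<bar> \<notin> support f b k" "\<bar>x\<bar> \<in> support f a m"
      using V x by (metis UnE)+
    show ?thesis
      by (simp add: cycle_part_fixes[OF c(2) x'(1)] cycle_part_eq[OF f c(1) x'(2)])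
  qed
qed (use c in auto)

lemma len_path_elt:
  assumes "cycle f a m"
  shows "R.len (path_elt (orb f a) m) + 1 \<le> m"
proof -
  have "R.len (path_elt (orb f a) m) \<le> m - 1"
    using R.len_le[OF path_word_T[OF cycle_distinct[OF assms]]]
    by (simp add: path_elt_def path_word_def)
  then show ?thesis using cycle_pos[OF assms] by simp
qed

definition two_negative_cycles :: "(int \<Rightarrow> int) \<Rightarrow> int \<Rightarrow> nat \<Rightarrow> int \<Rightarrow> nat \<Rightarrow> bool" where
  "two_negative_cycles f a m b k \<longleftrightarrow> signed_perm n f \<and> cycle f a m \<and> cycle f b k
     \<and> orb f a m = - a \<and> orb f b k = - b \<and> m + k = n
     \<and> support f a m \<inter> support f b k = {} \<and> support f a m \<union> support f b k = {1..int n}"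

lemma two_negative_cycles_sym: "two_negative_cycles f a m b k \<Longrightarrow> two_negative_cycles f b k a m"
  by (auto simp: two_negative_cycles_def)

text \<open>There are at most two cycles. A positive cycle of length \<open>l\<close> is a product of \<open>l - 1\<close> reflections, so \<open>w\<close>
  would be too short if all cycles were positive; and since the number of sign changes is even, the number
  of negative cycles is even.\<close>

theorem quasi_coxeter_two_negative_cycles:
  assumes "quasi_coxeter_element W (S_D n) w"
  shows "\<exists>a m b k. two_negative_cycles (rho w) a m b k"
proof -
  let ?V = "{1..int n}"
  define f where "f = rho w"
  obtain ts where ts: "length ts = n" "set ts \<subseteq> R.T" "w = list_mult W ts"
    "generate W (set ts) = carrier W" and w: "w \<in> carrier W" "R.len w = n"
    using assms unfolding quasi_coxeter_element_def card_S by blast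
  have f: "signed_perm n f" unfolding f_def using w rho_signed_perm by blast
  let ?Inv = "{A. A \<subseteq> ?V \<and> (\<lambda>x. \<bar>f x\<bar>) ` A = A}"
  have card_Inv: "card ?Inv \<le> 4"
    using quasi_coxeter_invariant_sets[OF ts(2,1,4)] by (simp only: f_def ts(3))
  obtain m where c1: "cycle f 1 m" using cycle_exists[OF f, of 1] n_ge by auto
  have neg: "parity (negate x) = -1" if "cycle f x l" for x l
    using parity_neg cycle_letter[OF that] by blast
  have pf: "parity f = 1" unfolding f_def using parity_rho w by blast
  show ?thesis
  proof (cases "support f 1 m = ?V")
    case True
    then have "m = n" using card_support[OF c1] by simp
    have eq: "f = cycle_part f 1 m" by (rule eq_one_cycle[OF f c1 True])
    have "parity (closing_sign f 1 m) = 1"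
      using parity_cycle_part[OF c1] pf eq by simp
    then have "closing_sign f 1 m = id" using neg[OF c1] by (auto simp: closing_sign_def)
    then have "rho w = rho (path_elt (orb f 1) m)" using eq by (simp add: cycle_part_def f_def)
    then have "w = path_elt (orb f 1) m" using rho_injective w path_elt_orb_closed[OF c1] by blast
    then show ?thesis using len_path_elt[OF c1] w \<open>m = n\<close> by simp
  next
    case False
    then obtain b where b: "b \<in> ?V" "b \<notin> support f 1 m" using support_subset[OF c1] by blast
    obtain k where c2: "cycle f b k" using cycle_exists[OF f, of b] b by auto
    have dis: "support f 1 m \<inter> support f b k = {}"
      using supports_disjoint[OF f c1, of b] b by (auto simp: support_def[of f b])
    have V: "support f 1 m \<union> support f b k = ?V"
    proof (rule ccontr)
      assume V: "support f 1 m \<union> support f b k \<noteq> ?V"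
      let ?A = "support f 1 m" and ?B = "support f b k"
      have ne: "?A \<noteq> {}" "?B \<noteq> {}"
        using start_in_support[OF c1] start_in_support[OF c2] by blast+
      have "?V \<in> ?Inv"
        using abs_signed_perm_bij[OF f] by (simp add: bij_betw_def)
      moreover have "?A \<in> ?Inv" "?B \<in> ?Inv"
        using support_invariant[OF f c1] support_invariant[OF f c2]
          support_subset[OF c1] support_subset[OF c2] by blast+
      moreover from this have "?A \<union> ?B \<in> ?Inv" by (simp add: image_Un)
      ultimately have "{{}, ?A, ?B, ?A \<union> ?B, ?V} \<subseteq> ?Inv" by simp
      then have "card {{}, ?A, ?B, ?A \<union> ?B, ?V} \<le> card ?Inv" by (intro card_mono) auto
      moreover have "card {{}, ?A, ?B, ?A \<union> ?B, ?V} = 5"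
      proof -
        have "?A \<noteq> ?B" "?A \<noteq> ?A \<union> ?B" "?B \<noteq> ?A \<union> ?B" "?A \<noteq> ?V" "?B \<noteq> ?V" "?A \<union> ?B \<noteq> ?V"
          "?V \<noteq> {}"
          using dis ne V support_subset[OF c1] support_subset[OF c2] b by blast+
        then show ?thesis using ne by (simp add: card_insert_if) 
      qed
      ultimately show False using card_Inv by simp
    qed
    have mk: "m + k = n"
      using card_Un_disjoint[of "support f 1 m" "support f b k"] dis V card_support[OF c1] card_support[OF c2]
      by (simp add: support_def)
    have eq: "f = cycle_part f 1 m \<circ> cycle_part f b k"
      using eq_two_cycles[OF f c1 c2 _ V] b by auto
    have par: "parity (closing_sign f 1 m) * parity (closing_sign f b k) = 1"
      using parity_comp[OF signed_perm_cycle_part[OF c1] signed_perm_cycle_part[OF c2]]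
        parity_cycle_part[OF c1] parity_cycle_part[OF c2] pf eq by simp
    have pid: "parity id = 1" using parity_rho[of "\<one>\<^bsub>W\<^esub>"] by simp
    have signs: "orb f 1 m = 1 \<longleftrightarrow> orb f b k = b"
      using par pid neg[OF c1] neg[OF c2] by (auto simp: closing_sign_def split: if_splits)
    have "orb f 1 m \<noteq> 1"
    proof
      assume *: "orb f 1 m = 1"
      have "rho w = rho (path_elt (orb f 1) m \<otimes>\<^bsub>W\<^esub> path_elt (orb f b) k)"
        using eq * signs path_elt_orb_closed[OF c1] path_elt_orb_closed[OF c2]
        by (simp add: cycle_part_def closing_sign_def f_def)
      then have "w = path_elt (orb f 1) m \<otimes>\<^bsub>W\<^esub> path_elt (orb f b) k"
        using rho_injective[OF w(1)] path_elt_orb_closed[OF c1] path_elt_orb_closed[OF c2] by simp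
      then have "R.len w \<le> R.len (path_elt (orb f 1) m) + R.len (path_elt (orb f b) k)"
        using R.len_mult path_elt_orb_closed[OF c1] path_elt_orb_closed[OF c2] by simp
      then show False using len_path_elt[OF c1] len_path_elt[OF c2] w mk by simp
    qed
    then have "two_negative_cycles f 1 m b k"
      using f c1 c2 mk dis V signs unfolding two_negative_cycles_def cycle_def by blast
    then show ?thesis unfolding f_def by blast
  qed
qed

text \<open>The product of the first two letters changes the signs of \<open>a\<close> and \<open>b\<close> and so makes both cycles negative.\<close>

definition standard_word :: "(int \<Rightarrow> int) \<Rightarrow> int \<Rightarrow> nat \<Rightarrow> int \<Rightarrow> nat \<Rightarrow> nat gword set list" where
  "standard_word f a m b k =
    reflection a b # reflection a (- b) # path_word (orb f a) m @ path_word (orb f b) k"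

lemma neg_neg_eq:
  assumes "letter_pair n a b"
  shows "sref a b \<circ> sref a (- b) = negate a \<circ> negate b"
proof -
  have *: "\<bar>a\<bar> \<noteq> \<bar>b\<bar>" "a \<noteq> 0" "b \<noteq> 0" using assms by (auto simp: letter_pair_def)
  show ?thesis
  proof
    fix x
    consider "x = a" | "x = - a" | "x = b" | "x = - b" | "\<bar>x\<bar> \<noteq> \<bar>a\<bar>" "\<bar>x\<bar> \<noteq> \<bar>b\<bar>" by linarith
    then show "(sref a b \<circ> sref a (- b)) x = (negate a \<circ> negate b) x"
      using * by cases (auto simp: sref_def negate_def)
  qed
qed

lemma two_negative_cycles_pair:
  assumes "two_negative_cycles f a m b k"
  shows "letter_pair n a b" "letter_pair n a (- b)"
proof -
  have c: "cycle f a m" "cycle f b k" "support f a m \<inter> support f b k = {}"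
    using assms by (auto simp: two_negative_cycles_def)
  have "\<bar>a\<bar> \<noteq> \<bar>b\<bar>"
    using start_in_support[OF c(1)] start_in_support[OF c(2)] c(3) by force
  then show "letter_pair n a b" "letter_pair n a (- b)"
    using cycle_letter[OF c(1)] cycle_letter[OF c(2)] by (auto simp: letter_pair_def)
qed

lemma standard_word_T:
  assumes "two_negative_cycles f a m b k"
  shows "set (standard_word f a m b k) \<subseteq> R.T"
  using assms two_negative_cycles_pair[OF assms] refl_T path_word_T[OF cycle_distinct]
  by (auto simp: standard_word_def two_negative_cycles_def)

lemma standard_word_product:
  assumes "two_negative_cycles (rho w) a m b k" "w \<in> carrier W"
  shows "w = list_mult W (standard_word (rho w) a m b k)"
proof -
  define f where "f = rho w"
  have t: "two_negative_cycles f a m b k" using assms f_def by simp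
  have f: "signed_perm n f" and c: "cycle f a m" "cycle f b k"
    and s: "orb f a m = - a" "orb f b k = - b"
    and d: "support f a m \<inter> support f b k = {}" "support f a m \<union> support f b k = {1..int n}"
    using t by (auto simp: two_negative_cycles_def)
  note lp = two_negative_cycles_pair[OF t]
  have nz: "a \<noteq> 0" "b \<noteq> 0" using lp by (auto simp: letter_pair_def)
  let ?A = "rho (path_elt (orb f a) m)" and ?B = "rho (path_elt (orb f b) k)"
  note pc = path_elt_orb_closed[OF c(1)] path_elt_orb_closed[OF c(2)]
  have bA: "\<bar>b\<bar> \<notin> support f a m" using start_in_support[OF c(2)] d by blast
  have Ab: "?A \<circ> negate b = negate b \<circ> ?A"
  proof
    fix x
    have fixb: "?A b = b" "?A (- b) = - b" using path_elt_fixes[OF c(1)] bA by auto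
    have "\<bar>?A x\<bar> = \<bar>b\<bar> \<longleftrightarrow> \<bar>x\<bar> = \<bar>b\<bar>"
      using signed_permD(6)[OF rho_signed_perm[OF pc(1)], of x b] fixb by simp
    then show "(?A \<circ> negate b) x = (negate b \<circ> ?A) x"
      using signed_permD(2)[OF rho_signed_perm[OF pc(1)]] by (simp add: negate_def)
  qed
  have "f = (negate a \<circ> ?A) \<circ> (negate b \<circ> ?B)"
    using eq_two_cycles[OF f c bA d(2)] s nz by (simp add: cycle_part_def closing_sign_def)
  also have "\<dots> = negate a \<circ> (?A \<circ> negate b) \<circ> ?B" by (simp only: o_assoc)
  also have "\<dots> = (sref a b \<circ> sref a (- b)) \<circ> ?A \<circ> ?B"
    by (simp only: neg_neg_eq[OF lp(1)] Ab o_assoc)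
  also have "\<dots> = rho (reflection a b \<otimes>\<^bsub>W\<^esub> (reflection a (- b) \<otimes>\<^bsub>W\<^esub> (path_elt (orb f a) m \<otimes>\<^bsub>W\<^esub> path_elt (orb f b) k)))"
    using pc refl_closed[OF lp(1)] refl_closed[OF lp(2)]
    by (simp only: rho_mult W.m_closed rho_refl[OF lp(1)] rho_refl[OF lp(2)] o_assoc)
  also have "reflection a b \<otimes>\<^bsub>W\<^esub> (reflection a (- b) \<otimes>\<^bsub>W\<^esub> (path_elt (orb f a) m \<otimes>\<^bsub>W\<^esub> path_elt (orb f b) k))
      = list_mult W (standard_word f a m b k)"
    unfolding standard_word_def path_elt_def list_mult_simps
      R.T_list_mult_append[OF path_word_T[OF cycle_distinct[OF c(1)]] path_word_T[OF cycle_distinct[OF c(2)]]]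
    by (rule HOL.refl)
  finally have F: "f = rho (list_mult W (standard_word f a m b k))" .
  show ?thesis
    using rho_injective[OF assms(2) R.T_list_mult_closed[OF standard_word_T[OF t]]] F
    unfolding f_def by blast
qed

subsection \<open>A fixed letter up to sign means a Coxeter element\<close>

lemma signed_permI:
  assumes odd: "\<And>x. f (- x) = - f x" and big: "\<And>x. int n < \<bar>x\<bar> \<Longrightarrow> f x = x"
    and inj: "inj_on (\<lambda>x. \<bar>f x\<bar>) {1..int n}" and letter: "\<And>x. x \<in> {1..int n} \<Longrightarrow> f x \<noteq> 0 \<and> \<bar>f x\<bar> \<le> int n"
  shows "signed_perm n f"
proof -
  let ?L = "{- int n..int n}"
  have f0: "f 0 = 0" using odd[of 0] by simp
  have abs: "\<bar>f x\<bar> = \<bar>f \<bar>x\<bar>\<bar>" for x using odd[of x] by (cases "x \<ge> 0") auto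
  have nz: "f x \<noteq> 0" "\<bar>f x\<bar> \<le> int n" if "x \<noteq> 0" "x \<in> ?L" for x
  proof -
    have "\<bar>x\<bar> \<in> {1..int n}" 
      using that unfolding atLeastAtMost_iff by linarith
    from letter[OF this] show "f x \<noteq> 0" "\<bar>f x\<bar> \<le> int n" using abs[of x] by auto
  qed
  have "inj_on f ?L"
  proof (rule inj_onI)
    fix x y assume xy: "x \<in> ?L" "y \<in> ?L" "f x = f y"
    show "x = y"
    proof (cases "x = 0 \<or> y = 0")
      case True
      then show ?thesis using xy f0 nz by metis
    next
      case False
      have "\<bar>f \<bar>x\<bar>\<bar> = \<bar>f \<bar>y\<bar>\<bar>" using xy abs by metis
      moreover have "\<bar>x\<bar> \<in> {1..int n}" "\<bar>y\<bar> \<in> {1..int n}"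
        using False xy(1,2) unfolding atLeastAtMost_iff by linarith+
      ultimately have "\<bar>x\<bar> = \<bar>y\<bar>" using inj_onD[OF inj] by blast
      moreover have "x \<noteq> - y" using odd[of y] xy nz(1)[of y] False by auto
      ultimately show ?thesis by linarith
    qed
  qed
  moreover have "f x \<in> ?L" if "x \<in> ?L" for x
    using nz(2)[of x] that f0 by (cases "x = 0") auto
  then have "f ` ?L \<subseteq> ?L" by blast
  ultimately have "bij_betw f ?L ?L" by (simp add: bij_betw_def endo_inj_surj)
  moreover have "bij_betw f (- ?L) (- ?L)"
    using big by (subst bij_betw_cong[of _ f id]) auto
  ultimately have "bij_betw f (?L \<union> - ?L) (?L \<union> - ?L)" by (rule bij_betw_combine) auto
  then show ?thesis using odd big by (simp add: signed_perm_def)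
qed

lemma s_eq_refl:
  "1 \<le> i \<Longrightarrow> i < n \<Longrightarrow> s i = reflection (int i) (int i + 1)"
  "s n = reflection (int n - 1) (- int n)"
  using n_ge refl_eqI[of "int i" "int i + 1" "s i"] refl_eqI[of "int n - 1" "- int n" "s n"]
  by (simp_all add: letter_pair_def rho_s sgen_def)

text \<open>The relabelling turns the two-cycle element with \<open>m = 1\<close> into a Coxeter element. The sign of the image of
  the letter \<open>n\<close> is left open because it has to be adjusted to make the relabelling even.\<close>

lemma relabelling_exists:
  assumes "two_negative_cycles f a 1 b k"
  shows "\<exists>g\<in>carrier W. (\<forall>i<k. rho g (int (n - 1 - i)) = orb f b i) \<and> \<bar>rho g (int n)\<bar> = \<bar>a\<bar>"
proof -
  have c: "cycle f a 1" "cycle f b k" and k: "k = n - 1" and d: "support f a 1 \<inter> support f b k = {}"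
    using assms n_ge by (auto simp: two_negative_cycles_def)
  define H where "H i = (if i = int n then a else orb f b (nat (int n - 1 - i)))" for i
  define h where "h x = (if 1 \<le> x \<and> x \<le> int n then H x else if 1 \<le> - x \<and> - x \<le> int n then - H (- x) else x)" for x
  have b_letter: "orb f b i \<noteq> 0 \<and> \<bar>orb f b i\<bar> \<le> int n" if "i < k" for i
    using cycle_distinct[OF c(2)] that by (simp add: distinct_letters_def)
  have ab: "\<bar>a\<bar> \<noteq> \<bar>orb f b i\<bar>" if "i < k" for i
    using start_in_support[OF c(1)] d that unfolding support_def[of f b] by auto
  have "signed_perm n h"
  proof (rule signed_permI)
    show "h (- x) = - h x" for x unfolding h_def by auto
    show "h x = x" if "int n < \<bar>x\<bar>" for x using that by (auto simp: h_def)
    show "h x \<noteq> 0 \<and> \<bar>h x\<bar> \<le> int n" if "x \<in> {1..int n}" for x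
    proof (cases "x = int n")
      case False
      then have "nat (int n - 1 - x) < k" using that k by (simp add: nat_less_iff of_nat_diff)
      then show ?thesis using that False b_letter by (simp add: h_def H_def)
    qed (use that cycle_letter[OF c(1)] in \<open>simp add: h_def H_def\<close>)
    show "inj_on (\<lambda>x. \<bar>h x\<bar>) {1..int n}"
    proof (rule inj_onI)
      fix x y assume xy: "x \<in> {1..int n}" "y \<in> {1..int n}" "\<bar>h x\<bar> = \<bar>h y\<bar>"
      define i j where "i = nat (int n - 1 - x)" and "j = nat (int n - 1 - y)"
      have ij: "x \<noteq> int n \<Longrightarrow> i < k" "y \<noteq> int n \<Longrightarrow> j < k" using xy k by (auto simp: i_def j_def)
      have H: "\<bar>H x\<bar> = \<bar>H y\<bar>" using xy by (simp add: h_def)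
      show "x = y"
      proof (cases "x = int n \<or> y = int n")
        case True
        then show ?thesis using H ij ab[of i] ab[of j] by (auto simp: H_def i_def j_def split: if_splits)
      next
        case False
        then have "\<bar>orb f b i\<bar> = \<bar>orb f b j\<bar>" using H by (simp add: H_def i_def j_def)
        then have "i = j"
          using cycle_distinct[OF c(2)] ij False by (auto simp: distinct_letters_def inj_on_def)
        then show ?thesis using False xy by (auto simp: i_def j_def)
      qed
    qed
  qed
  have vals: "h (int (n - 1 - i)) = orb f b i" if "i < k" for i
    using that k by (auto simp: h_def H_def of_nat_diff)
  have hn: "h (int n) = a" using n_ge by (simp add: h_def H_def)
  have pn: "\<bar>int n\<bar> \<le> int n" "int n \<noteq> 0" using n_ge by auto
  let ?h = "h \<circ> negate (int n)"
  have sp: "signed_perm n ?h"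
    using \<open>signed_perm n h\<close> signed_perm_neg[OF pn(1)] by (rule signed_perm_comp)
  have ph: "parity ?h = - parity h"
    using parity_comp[OF \<open>signed_perm n h\<close> signed_perm_neg[OF pn(1)]] parity_neg[OF pn(2,1)] by simp
  have "parity h \<in> {1, - 1}"
  proof -
    have "sgn (h x) * sgn (h x) = 1" if "x \<in> {1..int n}" for x
      using signed_permD(8)[OF \<open>signed_perm n h\<close>, of x] that by (auto simp: sgn_if)
    then have "parity h * parity h = 1"
      unfolding parity_def prod.distrib[symmetric] by (intro prod.neutral) blast
    then show ?thesis by (simp add: zmult_eq_1_iff)
  qed
  then consider "parity h = 1" | "parity ?h = 1" using ph by auto
  then show ?thesis
  proof cases
    case 1
    then show ?thesis using rho_surjective[OF \<open>signed_perm n h\<close>] vals hn by metis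
  next
    case 2
    then obtain g where g: "g \<in> carrier W" "rho g = ?h" using rho_surjective[OF sp] by blast
    have "negate (int n) (int (n - 1 - i)) = int (n - 1 - i)" for i
      using n_ge by (simp add: negate_def)
    then have "\<forall>i<k. rho g (int (n - 1 - i)) = orb f b i" using g vals by simp
    moreover have "\<bar>rho g (int n)\<bar> = \<bar>a\<bar>"
      using g hn signed_permD(2)[OF \<open>signed_perm n h\<close>, of "int n"] by (simp add: negate_def)
    ultimately show ?thesis using g by blast
  qed
qed

text \<open>For \<open>m = 1\<close> the word of the first cycle is empty, and the diagram of the standard word is the diagram
  \<open>D\<^sub>n\<close>, with fork \<open>x, y\<close>: up to relabelling its letters are the simple reflections.\<close>

lemma coxeter_if_short_cycle:
  assumes t: "two_negative_cycles (rho w) a 1 b k" and w: "w \<in> carrier W"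
  shows "\<exists>c g. coxeter_element W (S_D n) c \<and> g \<in> carrier W \<and> w = g \<otimes>\<^bsub>W\<^esub> c \<otimes>\<^bsub>W\<^esub> inv\<^bsub>W\<^esub> g"
proof -
  define f where "f = rho w"
  have k: "k = n - 1" and c: "cycle f b k" using t n_ge by (auto simp: two_negative_cycles_def f_def)
  obtain g where g: "g \<in> carrier W" "\<And>i. i < k \<Longrightarrow> rho g (int (n - 1 - i)) = orb f b i"
    "\<bar>rho g (int n)\<bar> = \<bar>a\<bar>"
    using relabelling_exists[OF t] unfolding f_def by blast
  note lp = two_negative_cycles_pair[OF t]
  let ?c = "\<lambda>t. g \<otimes>\<^bsub>W\<^esub> t \<otimes>\<^bsub>W\<^esub> inv\<^bsub>W\<^esub> g"
  have sp: "signed_perm n (rho g)" using rho_signed_perm g by blast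
  have g1: "rho g (int n - 1) = b" using g(2)[of 0] k n_ge by (simp add: of_nat_diff)
  have cp: "?c (s (n - 1)) = reflection b (rho g (int n))" "?c (s n) = reflection b (- rho g (int n))"
    using n_ge g1 refl_conj[OF _ g(1)] signed_permD(2)[OF sp]
    by (simp_all add: s_eq_refl of_nat_diff letter_pair_def)
  have cq: "?c (s (n - 2 - j)) = reflection (orb f b j) (orb f b (Suc j))" if "j < n - 2" for j
  proof -
    have e: "int (n - 2 - j) + 1 = int (n - 1 - j)" "n - 1 - Suc j = n - 2 - j"
      and lt: "1 \<le> n - 2 - j" "n - 2 - j < n" "j < k" "Suc j < k"
      using that k by auto
    have p: "letter_pair n (int (n - 2 - j)) (int (n - 1 - j))" using that by (auto simp: letter_pair_def)
    have "?c (s (n - 2 - j)) = reflection (rho g (int (n - 2 - j))) (rho g (int (n - 1 - j)))"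
      by (simp only: s_eq_refl(1)[OF lt(1,2)] e(1) refl_conj[OF p g(1)])
    also have "\<dots> = reflection (orb f b (Suc j)) (orb f b j)"
      using g(2)[OF lt(3)] g(2)[OF lt(4)] e by simp
    also have "\<dots> = reflection (orb f b j) (orb f b (Suc j))"
      using distinct_letters_pair[OF cycle_distinct[OF c] lt(4,3)] by (intro refl_sym) simp
    finally show ?thesis .
  qed
  \<comment> \<open>The sign of \<open>rho g (int n)\<close> decides which of the two fork reflections becomes \<open>x\<close>.\<close>
  define ss where "ss = (if rho g (int n) = a then [s (n - 1), s n] else [s n, s (n - 1)])
    @ map (\<lambda>j. s (n - 2 - j)) [0..<n - 2]"
  have ab: "reflection b a = reflection a b" "reflection b (- a) = reflection a (- b)"
    using lp refl_sym refl_uminus[of a "- b"] refl_sym[of "- a" b]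
    by (auto simp: letter_pair_def)
  have "rho g (int n) = a \<or> rho g (int n) = - a" using g(3) by linarith
  then have head: "map ?c (if rho g (int n) = a then [s (n - 1), s n] else [s n, s (n - 1)])
      = [reflection a b, reflection a (- b)]"
    using cp ab lp by (auto simp: letter_pair_def)
  have tail: "map ?c (map (\<lambda>j. s (n - 2 - j)) [0..<n - 2]) = path_word (orb f b) k"
    using cq k by (simp add: path_word_def numeral_2_eq_2)
  have "map ?c ss = standard_word f a 1 b k"
    unfolding ss_def map_append head tail by (simp add: standard_word_def path_word_def)
  moreover have set_ss: "set ss = S_D n"
  proof -
    have "set ss = s ` ({n - 1, n} \<union> (\<lambda>j. n - 2 - j) ` {0..<n - 2})"
      by (auto simp: ss_def)
    also have "{n - 1, n} \<union> (\<lambda>j. n - 2 - j) ` {0..<n - 2} = {1..n}"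
    proof (intro equalityI subsetI)
      fix x assume x: "x \<in> {1..n}"
      show "x \<in> {n - 1, n} \<union> (\<lambda>j. n - 2 - j) ` {0..<n - 2}"
      proof (cases "x \<le> n - 2")
        case True
        then have "x = n - 2 - (n - 2 - x)" "n - 2 - x \<in> {0..<n - 2}" using x by auto
        then show ?thesis by blast
      qed (use x in auto)
    qed (use n_ge in auto)
    finally show ?thesis by (simp add: S_eq)
  qed
  moreover have "set ss \<subseteq> R.T" using set_ss R.S_subset_T by simp
  ultimately have "w = g \<otimes>\<^bsub>W\<^esub> list_mult W ss \<otimes>\<^bsub>W\<^esub> inv\<^bsub>W\<^esub> g"
    using standard_word_product[OF t w] R.list_mult_conj[of ss g] g(1) by (metis f_def)
  moreover have "distinct ss"
    using set_ss card_S n_ge by (intro card_distinct) (simp add: ss_def)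
  ultimately show ?thesis using set_ss g(1) unfolding coxeter_element_def by blast
qed

end


section \<open>Relations in the interval group of a two-cycle element\<close>

lemma (in group) eq_of_braid_commute:
  assumes "x \<in> carrier G" "y \<in> carrier G" "x \<otimes> y \<otimes> x = y \<otimes> x \<otimes> y" "x \<otimes> y = y \<otimes> x"
  shows "x = y"
proof -
  have "x \<otimes> y \<otimes> x = x \<otimes> y \<otimes> y" using assms by metis
  then show ?thesis using assms(1,2) by simp
qed

lemma subseq_map_upt_pair: "i < j \<Longrightarrow> j < N \<Longrightarrow> subseq [F i, F j] (map F [0..<N])"
proof -
  assume ij: "i < j" "j < N"
  have "[0..<N] = [0..<i] @ [i] @ [i + 1..<j] @ [j] @ [j + 1..<N]"
    using ij upt_add_eq_append[of 0 i "N - i"] upt_add_eq_append[of "i + 1" j "N - j"]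
    by (simp add: upt_conv_Cons)
  then have "map F [0..<N] = map F [0..<i] @ [F i] @ map F [i + 1..<j] @ [F j] @ map F [j + 1..<N]"
    by simp
  moreover have "subseq ([] @ [F i] @ [] @ [F j] @ [])
      (map F [0..<i] @ [F i] @ map F [i + 1..<j] @ [F j] @ map F [j + 1..<N])"
    by (intro list_emb_append_mono) auto
  ultimately show ?thesis by simp
qed

context type_D
begin

lemma distinct_lettersI:
  assumes "\<And>i. i < m \<Longrightarrow> a i \<noteq> 0 \<and> \<bar>a i\<bar> \<le> int n"
    and "\<And>i j. i < m \<Longrightarrow> j < m \<Longrightarrow> i < j \<Longrightarrow> \<bar>a i\<bar> \<noteq> \<bar>a j\<bar>"
  shows "distinct_letters a m"
proof -
  have "inj_on (\<lambda>i. \<bar>a i\<bar>) {..<m}" using assms(2) by (intro linorder_inj_onI) auto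
  then show ?thesis using assms(1) by (simp add: distinct_letters_def)
qed

lemma distinct_letters_mono: "distinct_letters a m \<Longrightarrow> l \<le> m \<Longrightarrow> distinct_letters a l"
  by (auto simp: distinct_letters_def inj_on_def)

lemma orb_add: "(f ^^ i) (orb f a j) = orb f a (i + j)"
  by (simp add: orb_def funpow_add)

lemma orb_add_period:
  assumes "signed_perm n f" "orb f a m = - a"
  shows "orb f a (i + m) = - orb f a i"
  using orb_add[of i f a m] orb_uminus[OF assms(1), of a i] assms(2) by (simp add: orb_def)

lemma refl_conj_inv:
  assumes "letter_pair n u v" "g \<in> carrier W"
  shows "inv\<^bsub>W\<^esub> g \<otimes>\<^bsub>W\<^esub> reflection (rho g u) (rho g v) \<otimes>\<^bsub>W\<^esub> g = reflection u v"
  using assms W.inv_closed R.conj_inv_cancel[OF refl_closed[OF assms(1)] assms(2)]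
  by (simp add: refl_conj[symmetric])

lemma refl_reachable_conj:
  assumes "reflection u v \<in> W.reachable ts" "letter_pair n u v" "list_mult W ts = w" "w \<in> carrier W"
  shows "reflection ((rho w ^^ i) u) ((rho w ^^ i) v) \<in> W.reachable ts"
proof (induction i)
  case (Suc i)
  have "letter_pair n ((rho w ^^ i) u) ((rho w ^^ i) v)"
    using signed_perm_letter_pair[OF signed_perm_pow[OF rho_signed_perm]] assms by blast
  then show ?case
    using W.reachable.conj[OF Suc] assms(3,4) refl_conj by simp
qed (use assms in simp)

lemma path_word_prefix: "l \<le> m \<Longrightarrow> \<exists>zs. path_word a m = path_word a l @ zs"
proof -
  assume "l \<le> m"
  then have "[0..<m - 1] = [0..<l - 1] @ [l - 1..<m - 1]"
    using upt_add_eq_append[of 0 "l - 1" "m - l"] by (cases "l = 0") auto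
  then show ?thesis by (simp add: path_word_def)
qed

lemma path_word_prefix_subseq: "l \<le> m \<Longrightarrow> subseq (path_word a l) (path_word a m)"
  using path_word_prefix[of l m a] by (metis list_emb_append2 list_emb_prefix subseq_order.order_refl)

lemma path_word_Suc_Suc: "path_word a (Suc (Suc l)) = reflection (a 0) (a 1) # path_word (\<lambda>i. a (Suc i)) (Suc l)"
  by (simp add: path_word_def upt_conv_Cons map_Suc_upt[symmetric] del: upt_Suc)

text \<open>Reflections inside a single cycle: moving the first edge of the path past the following ones
  gives all \<open>reflection a (f\<^sup>l a)\<close>, and conjugation by \<open>w\<close> rotates these around the whole cycle.\<close>

lemma refl_start_reachable:
  assumes c: "cycle f a m" and sub: "subseq (path_word (orb f a) m) ts" and l: "0 < l" "l < m"
  shows "reflection a (orb f a l) \<in> W.reachable ts"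
proof -
  obtain k where k: "l = Suc k" using l gr0_conv_Suc by blast
  define a' where "a' = (\<lambda>i. orb f a (Suc i))"
  define v where "v = path_elt a' (Suc k)"
  have dl: "distinct_letters a' (Suc k)"
  proof (rule distinct_lettersI)
    fix i assume "i < Suc k"
    then show "a' i \<noteq> 0 \<and> \<bar>a' i\<bar> \<le> int n"
      using cycle_distinct[OF c] l k by (simp add: a'_def distinct_letters_def)
  next
    fix i j assume "i < Suc k" "j < Suc k" "i < j"
    then have "letter_pair n (orb f a (Suc i)) (orb f a (Suc j))"
      using l k by (intro distinct_letters_pair[OF cycle_distinct[OF c]]) auto
    then show "\<bar>a' i\<bar> \<noteq> \<bar>a' j\<bar>" by (simp add: a'_def letter_pair_def)
  qed
  have v: "v \<in> carrier W" unfolding v_def by (rule path_elt_closed[OF dl])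
  have pair: "letter_pair n (orb f a 0) (orb f a l)"
    using l by (intro distinct_letters_pair[OF cycle_distinct[OF c]]) auto
  have "\<forall>i\<le>k. \<bar>a\<bar> \<noteq> \<bar>a' i\<bar>"
  proof (intro allI impI)
    fix i assume "i \<le> k"
    then have "letter_pair n (orb f a 0) (orb f a (Suc i))"
      using l k by (intro distinct_letters_pair[OF cycle_distinct[OF c]]) auto
    then show "\<bar>a\<bar> \<noteq> \<bar>a' i\<bar>" by (simp add: letter_pair_def a'_def)
  qed
  then have "rho v a = a" "rho v (orb f a l) = orb f a 1"
    using rho_path_elt[OF dl] by (simp_all add: v_def a'_def k)
  moreover have "subseq (reflection a (orb f a 1) # path_word a' (Suc k)) ts"
    using subseq_order.order_trans[OF path_word_prefix_subseq[of "Suc l" m "orb f a"] sub] l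
      path_word_Suc_Suc[of "orb f a" k] by (simp add: k a'_def)
  then have "inv\<^bsub>W\<^esub> v \<otimes>\<^bsub>W\<^esub> reflection a (orb f a 1) \<otimes>\<^bsub>W\<^esub> v \<in> W.reachable ts"
    unfolding v_def path_elt_def by (rule W.reachable.shift)
  ultimately show ?thesis using refl_conj_inv[OF pair v] by simp
qed

lemma refl_cycle_reachable:
  assumes f: "f = rho w" and w: "w \<in> carrier W" "list_mult W ts = w"
    and c: "cycle f a m" "orb f a m = - a" and sub: "subseq (path_word (orb f a) m) ts"
    and uv: "letter_pair n u v" "\<bar>u\<bar> \<in> support f a m" "\<bar>v\<bar> \<in> support f a m"
  shows "reflection u v \<in> W.reachable ts"
proof -
  have sp: "signed_perm n f" using f w rho_signed_perm by blast
  have rot: "reflection (orb f a i) (orb f a (i + l)) \<in> W.reachable ts" if "0 < l" "l < m" for i l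
  proof -
    have "letter_pair n (orb f a 0) (orb f a l)"
      using that by (intro distinct_letters_pair[OF cycle_distinct[OF c(1)]]) auto
    then show ?thesis
      using refl_reachable_conj[OF refl_start_reachable[OF c(1) sub that] _ w(2,1), of i]
        orb_add[of i f a l] by (simp add: f[symmetric] orb_def)
  qed
  have *: "reflection (orb f a i) (orb f a j) \<in> W.reachable ts \<and> reflection (orb f a i) (- orb f a j) \<in> W.reachable ts"
    if ij: "i < j" "j < m" for i j
  proof
    show "reflection (orb f a i) (orb f a j) \<in> W.reachable ts" using rot[of "j - i" i] ij by simp
    have "reflection (orb f a j) (orb f a (i + m)) \<in> W.reachable ts" using rot[of "i + m - j" j] ij by simp
    moreover have "letter_pair n (orb f a i) (orb f a j)"
      using ij by (intro distinct_letters_pair[OF cycle_distinct[OF c(1)]]) auto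
    then have "reflection (orb f a j) (- orb f a i) = reflection (orb f a i) (- orb f a j)"
      using refl_uminus[of "orb f a j" "- orb f a i"] refl_sym[of "- orb f a j" "orb f a i"]
      by (simp add: letter_pair_def)
    ultimately show "reflection (orb f a i) (- orb f a j) \<in> W.reachable ts"
      using orb_add_period[OF sp c(2), of i] by simp
  qed
  obtain i j where ij: "i < m" "j < m" "\<bar>u\<bar> = \<bar>orb f a i\<bar>" "\<bar>v\<bar> = \<bar>orb f a j\<bar>"
    using uv(2,3) by (auto simp: support_def)
  then have "i \<noteq> j" using uv(1) by (auto simp: letter_pair_def)
  have main: "reflection u v \<in> W.reachable ts"
    if "letter_pair n u v" "i < j" "j < m" "\<bar>u\<bar> = \<bar>orb f a i\<bar>" "\<bar>v\<bar> = \<bar>orb f a j\<bar>" for u v i j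
  proof -
    have "u = orb f a i \<or> u = - orb f a i" "v = orb f a j \<or> v = - orb f a j" using that by linarith+
    then show ?thesis
      using *[OF that(2,3)] refl_uminus[OF that(1)] by auto
  qed
  consider "i < j" | "j < i" using \<open>i \<noteq> j\<close> by linarith
  then show ?thesis
    using main[OF uv(1), of i j] main[of v u j i] ij uv(1) refl_sym[OF uv(1)]
    by cases (auto simp: letter_pair_def)
qed

lemma standard_word_subseqs:
  "subseq (path_word (orb f a) m) (standard_word f a m b k)"
  "subseq (path_word (orb f b) k) (standard_word f a m b k)"
proof -
  let ?P = "path_word (orb f a) m" and ?Q = "path_word (orb f b) k"
  have e: "standard_word f a m b k = [reflection a b, reflection a (- b)] @ ?P @ ?Q"
    by (simp add: standard_word_def)
  have "subseq ([] @ ?P @ []) ([reflection a b, reflection a (- b)] @ ?P @ ?Q)"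
    by (intro list_emb_append_mono) auto
  then show "subseq ?P (standard_word f a m b k)" unfolding e by (simp only: append_Nil append_Nil2)
  have "subseq ([] @ [] @ ?Q) ([reflection a b, reflection a (- b)] @ ?P @ ?Q)"
    by (intro list_emb_append_mono) auto
  then show "subseq ?Q (standard_word f a m b k)" unfolding e by (simp only: append_Nil)
qed

text \<open>The path words \<open>p\<^sub>0 \<dots> p\<^bsub>i-1\<^esub>\<close> and \<open>q\<^sub>0 \<dots> q\<^bsub>j-1\<^esub>\<close> carry \<open>f\<^sup>i a\<close> to \<open>a\<close> and \<open>f\<^sup>j b\<close> to \<open>b\<close>, so moving \<open>x\<close> or \<open>y\<close> past
  them gives the reflections that join the two cycles.\<close>

lemma refl_cross_reachable:
  assumes t: "two_negative_cycles f a m b k" and ij: "i < m" "j < k"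
    and e: "e = b \<or> e = - b" "e' = orb f e j"
  shows "reflection (orb f a i) e' \<in> W.reachable (standard_word f a m b k)"
proof -
  have f: "signed_perm n f" and c: "cycle f a m" "cycle f b k" and d: "support f a m \<inter> support f b k = {}"
    using t by (auto simp: two_negative_cycles_def)
  have dl: "distinct_letters (orb f a) (Suc i)" "distinct_letters (orb f b) (Suc j)"
    using distinct_letters_mono[OF cycle_distinct[OF c(1)]]
      distinct_letters_mono[OF cycle_distinct[OF c(2)]] ij by auto
  let ?p = "path_elt (orb f a) (Suc i)" and ?q = "path_elt (orb f b) (Suc j)"
  define v where "v = ?p \<otimes>\<^bsub>W\<^esub> ?q"
  have pq: "?p \<in> carrier W" "?q \<in> carrier W" using path_elt_closed dl by blast+
  then have v: "v \<in> carrier W" by (simp add: v_def)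
  have ne: "\<bar>orb f a i'\<bar> \<noteq> \<bar>orb f b j'\<bar>" if "i' < m" "j' < k" for i' j'
    using d that unfolding support_def by auto
  have dis: "\<forall>i'\<le>j. \<bar>orb f a i\<bar> \<noteq> \<bar>orb f b i'\<bar>" "\<forall>i'\<le>i. \<bar>b\<bar> \<noteq> \<bar>orb f a i'\<bar>"
    using ne[of i] ne[of _ 0] ij by (auto simp: eq_commute)
  have "rho ?q (orb f a i) = orb f a i" "rho ?q (orb f b j) = b"
    "rho ?p (orb f a i) = a" "rho ?p b = b"
    using rho_path_elt[OF dl(1)] rho_path_elt[OF dl(2)] dis by simp_all
  then have va: "rho v (orb f a i) = a" and vb: "rho v (orb f b j) = b"
    using pq by (simp_all add: v_def)
  have e'_eq: "e' = orb f b j \<or> e' = - orb f b j" "e = b \<and> e' = orb f b j \<or> e = - b \<and> e' = - orb f b j"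
    using e orb_uminus[OF f, of b j] by auto
  have ve: "rho v e' = e"
    using e'_eq vb signed_permD(2)[OF rho_signed_perm[OF v], of "orb f b j"] by auto
  have pair: "letter_pair n (orb f a i) e'"
    using cycle_distinct[OF c(1)] cycle_distinct[OF c(2)] ij ne[OF ij] e'_eq
    by (auto simp: letter_pair_def distinct_letters_def)
  have vs: "subseq (path_word (orb f a) (Suc i) @ path_word (orb f b) (Suc j))
      (path_word (orb f a) m @ path_word (orb f b) k)"
    using ij by (intro list_emb_append_mono path_word_prefix_subseq) auto
  have "subseq (reflection a e # path_word (orb f a) (Suc i) @ path_word (orb f b) (Suc j))
      (standard_word f a m b k)"
    using e(1)
  proof
    assume "e = b"
    then show ?thesis unfolding standard_word_def
      using vs by (auto intro: subseq_Cons2 list_emb_Cons)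
  next
    assume "e = - b"
    then show ?thesis unfolding standard_word_def
      using vs by (auto intro: subseq_Cons2 list_emb_Cons)
  qed
  from W.reachable.shift[OF this]
  have "inv\<^bsub>W\<^esub> v \<otimes>\<^bsub>W\<^esub> reflection a e \<otimes>\<^bsub>W\<^esub> v \<in> W.reachable (standard_word f a m b k)"
    using R.T_list_mult_append[OF path_word_T[OF dl(1)] path_word_T[OF dl(2)]]
    by (simp add: v_def path_elt_def)
  then show ?thesis using refl_conj_inv[OF pair v] va ve by simp
qed

theorem T_reachable:
  assumes t: "two_negative_cycles (rho w) a m b k" and w: "w \<in> carrier W"
  shows "R.T \<subseteq> W.reachable (standard_word (rho w) a m b k)"
proof
  define f where "f = rho w"
  let ?ts = "standard_word (rho w) a m b k"
  fix r assume "r \<in> R.T"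
  then obtain u v where uv: "letter_pair n u v" "r = reflection u v" using T_eq_refl by blast
  have f: "signed_perm n f" and c: "cycle f a m" "cycle f b k" and neg: "orb f a m = - a" "orb f b k = - b"
    and V: "support f a m \<union> support f b k = {1..int n}"
    using t by (auto simp: two_negative_cycles_def f_def)
  have eq: "list_mult W ?ts = w" using standard_word_product[OF t w] by simp
  have cross: "reflection u v \<in> W.reachable ?ts"
    if p: "letter_pair n u v" and u: "\<bar>u\<bar> \<in> support f a m" and v: "\<bar>v\<bar> \<in> support f b k" for u v
  proof -
    obtain i j where ij: "i < m" "j < k" "\<bar>u\<bar> = \<bar>orb f a i\<bar>" "\<bar>v\<bar> = \<bar>orb f b j\<bar>"
      using u v by (auto simp: support_def)
    have r: "reflection (orb f a i) (orb f b j) \<in> W.reachable ?ts" "reflection (orb f a i) (- orb f b j) \<in> W.reachable ?ts"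
      using refl_cross_reachable[OF t ij(1,2), of b] refl_cross_reachable[OF t ij(1,2), of "- b"]
        orb_uminus[OF f, of b j] by (simp_all add: f_def)
    have "u = orb f a i \<or> u = - orb f a i" "v = orb f b j \<or> v = - orb f b j" using ij by linarith+
    then show ?thesis using r refl_uminus[OF p] by auto
  qed
  have "\<bar>u\<bar> \<in> support f a m \<union> support f b k" "\<bar>v\<bar> \<in> support f a m \<union> support f b k"
    using uv V by (auto simp: letter_pair_def)
  then consider "\<bar>u\<bar> \<in> support f a m" "\<bar>v\<bar> \<in> support f a m" | "\<bar>u\<bar> \<in> support f b k" "\<bar>v\<bar> \<in> support f b k"
    | "\<bar>u\<bar> \<in> support f a m" "\<bar>v\<bar> \<in> support f b k" | "\<bar>u\<bar> \<in> support f b k" "\<bar>v\<bar> \<in> support f a m"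
    by blast
  then have "reflection u v \<in> W.reachable ?ts"
  proof cases
    case 1
    then show ?thesis
      using refl_cycle_reachable[OF f_def w eq c(1) neg(1) _ uv(1)] standard_word_subseqs(1)[where f = f and a = a and m = m and b = b and k = k]
      by (simp add: f_def)
  next
    case 2
    then show ?thesis
      using refl_cycle_reachable[OF f_def w eq c(2) neg(2) _ uv(1)] standard_word_subseqs(2)[where f = f and a = a and m = m and b = b and k = k]
      by (simp add: f_def)
  next
    case 3
    then show ?thesis using cross uv by blast
  next
    case 4
    have "letter_pair n v u" using uv by (auto simp: letter_pair_def)
    then show ?thesis using cross[of v u] 4 refl_sym[OF uv(1)] by simp
  qed
  then show "r \<in> W.reachable ?ts" using uv by simp
qed

end

text \<open>The letters of the standard word are \<open>x\<close>, \<open>y\<close>, the path \<open>p 0, \<dots>, p (m - 2)\<close> of the first cycle and the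
  path \<open>q 0, \<dots>, q (k - 2)\<close> of the second. The function \<open>q\<close> is defined beyond this range, where \<open>q (k - 1)\<close>
  closes the second cycle and \<open>q\<close> becomes periodic.\<close>

locale two_cycle_map = type_D n + group K
  for n :: nat and K :: "('c, 'd) monoid_scheme" (structure) +
  fixes w a m b k D
  assumes cycles: "two_negative_cycles (rho w) a m b k"
    and map: "interval_map (W_D n) (S_D n) K w D"
    and len_w: "refl_length (W_D n) (S_D n) w = n"
begin

abbreviation f where "f \<equiv> rho w"
abbreviation ts where "ts \<equiv> standard_word f a m b k"

sublocale D: interval_map W "S_D n" K w D by (rule map)

lemma lengths: "m \<ge> 1" "k \<ge> 1" "m + k = n"
  using cycles cycle_pos by (auto simp: two_negative_cycles_def Suc_le_eq)

sublocale D: reduced_interval_map W "S_D n" K w D ts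
proof
  show "set ts \<subseteq> R.T" by (rule standard_word_T[OF cycles])
  show "w = list_mult W ts" by (rule standard_word_product[OF cycles D.w_closed])
  show "length ts = R.len w"
    using lengths len_w by (simp add: standard_word_def path_word_def)
qed

definition x where "x = reflection a b"
definition y where "y = reflection a (- b)"
definition p where "p i = reflection (orb f a i) (orb f a (Suc i))"
definition q where "q i = reflection (orb f b i) (orb f b (Suc i))"

lemma ts_eq: "ts = [x, y] @ map p [0..<m - 1] @ map q [0..<k - 1]"
  by (simp add: standard_word_def path_word_def x_def y_def p_def q_def)

lemma in_ts: "x \<in> set ts" "y \<in> set ts" "i < m - 1 \<Longrightarrow> p i \<in> set ts" "i < k - 1 \<Longrightarrow> q i \<in> set ts"
  by (auto simp: ts_eq)

lemma D_ts_closed: "t \<in> set ts \<Longrightarrow> D t \<in> carrier K"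
  using D.letter_I D.D_closed by blast

lemma subseq_pairs:
  "i < m - 1 \<Longrightarrow> subseq [x, p i] ts" "i < m - 1 \<Longrightarrow> subseq [y, p i] ts"
  "j < k - 1 \<Longrightarrow> subseq [x, q j] ts" "j < k - 1 \<Longrightarrow> subseq [y, q j] ts"
  "i < m - 1 \<Longrightarrow> j < k - 1 \<Longrightarrow> subseq [p i, q j] ts"
  "Suc i < m - 1 \<Longrightarrow> subseq [p i, p (Suc i)] ts"
  "Suc j < k - 1 \<Longrightarrow> subseq [q j, q (Suc j)] ts"
proof -
  have xy: "subseq [x] [x, y]" "subseq [y] [x, y]" "subseq [] [x, y]" by auto
  have P: "subseq [p i] (map p [0..<m - 1])" if "i < m - 1" for i
    using that by (simp add: subseq_singleton_left)
  have Q: "subseq [q i] (map q [0..<k - 1])" if "i < k - 1" for i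
    using that by (simp add: subseq_singleton_left)
  have N: "subseq [] zs" for zs :: "nat gword set list" by simp
  note app = list_emb_append_mono[OF _ list_emb_append_mono, where P = "(=)"]
  show "subseq [x, p i] ts" if "i < m - 1"
    using app[OF xy(1) P[OF that] N] by (simp only: ts_eq append.simps)
  show "subseq [y, p i] ts" if "i < m - 1"
    using app[OF xy(2) P[OF that] N] by (simp only: ts_eq append.simps)
  show "subseq [x, q j] ts" if "j < k - 1"
    using app[OF xy(1) N Q[OF that]] by (simp only: ts_eq append.simps)
  show "subseq [y, q j] ts" if "j < k - 1"
    using app[OF xy(2) N Q[OF that]] by (simp only: ts_eq append.simps)
  show "subseq [p i, q j] ts" if "i < m - 1" "j < k - 1"
    using app[OF xy(3) P[OF that(1)] Q[OF that(2)]] by (simp only: ts_eq append.simps)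
  show "subseq [p i, p (Suc i)] ts" if "Suc i < m - 1"
    using app[OF xy(3) subseq_map_upt_pair[OF lessI that, of p] N] by (simp only: ts_eq append.simps)
  show "subseq [q j, q (Suc j)] ts" if "Suc j < k - 1"
    using app[OF xy(3) N subseq_map_upt_pair[OF lessI that, of q]] by (simp only: ts_eq append.simps)
qed

lemma cyc: "cycle f a m" "cycle f b k" "signed_perm n f" "orb f b k = - b"
  using cycles by (auto simp: two_negative_cycles_def)

lemma pair_a: "i < m \<Longrightarrow> j < m \<Longrightarrow> i \<noteq> j \<Longrightarrow> letter_pair n (orb f a i) (orb f a j)"
  using distinct_letters_pair[OF cycle_distinct[OF cyc(1)]] .

lemma pair_b: "i < k \<Longrightarrow> j < k \<Longrightarrow> i \<noteq> j \<Longrightarrow> letter_pair n (orb f b i) (orb f b j)"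
  using distinct_letters_pair[OF cycle_distinct[OF cyc(2)]] .

lemma pair_ab: "i < m \<Longrightarrow> j < k \<Longrightarrow> letter_pair n (orb f a i) (orb f b j)"
proof -
  assume ij: "i < m" "j < k"
  have "support f a m \<inter> support f b k = {}" using cycles by (simp add: two_negative_cycles_def)
  then have "\<bar>orb f a i\<bar> \<noteq> \<bar>orb f b j\<bar>" using ij unfolding support_def by blast
  then show ?thesis
    using ij cycle_distinct[OF cyc(1)] cycle_distinct[OF cyc(2)]
    by (auto simp: letter_pair_def distinct_letters_def)
qed

lemma D_commute:
  "i < m - 1 \<Longrightarrow> 1 \<le> i \<Longrightarrow> D x \<otimes> D (p i) = D (p i) \<otimes> D x"
  "j < k - 1 \<Longrightarrow> 1 \<le> j \<Longrightarrow> D x \<otimes> D (q j) = D (q j) \<otimes> D x"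
  "j < k - 1 \<Longrightarrow> 1 \<le> j \<Longrightarrow> D y \<otimes> D (q j) = D (q j) \<otimes> D y"
  "i < m - 1 \<Longrightarrow> j < k - 1 \<Longrightarrow> D (p i) \<otimes> D (q j) = D (q j) \<otimes> D (p i)"
proof -
  have ab: "letter_pair n a b" using pair_ab[of 0 0] lengths by simp
  show "D x \<otimes> D (p i) = D (p i) \<otimes> D x" if i: "i < m - 1" "1 \<le> i"
  proof -
    have "i < m" "Suc i < m" "0 < m" "0 < k" using i lengths(1,2) by auto
    then have "letter_pair n (orb f a i) (orb f a (Suc i))" "letter_pair n (orb f a i) (orb f a 0)"
      "letter_pair n (orb f a (Suc i)) (orb f a 0)"
      "letter_pair n (orb f a i) (orb f b 0)" "letter_pair n (orb f a (Suc i)) (orb f b 0)"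
      using i(2) by (auto intro!: pair_a pair_ab simp del: orb_0)
    then show ?thesis using subseq_pairs(1)[OF i(1)] ab
      unfolding x_def p_def by (intro D.D_pair_commute refl_commute) (auto simp: letter_pair_def)
  qed
  have jb: "letter_pair n (orb f b j) (orb f b (Suc j))" "letter_pair n (orb f b j) (orb f b 0)"
      "letter_pair n (orb f b (Suc j)) (orb f b 0)"
      "letter_pair n (orb f a 0) (orb f b j)" "letter_pair n (orb f a 0) (orb f b (Suc j))"
    if "j < k - 1" "1 \<le> j"
  proof -
    have "j < k" "Suc j < k" "0 < m" "0 < k" using that lengths(1,2) by auto
    then show "letter_pair n (orb f b j) (orb f b (Suc j))" "letter_pair n (orb f b j) (orb f b 0)"
      "letter_pair n (orb f b (Suc j)) (orb f b 0)"
      "letter_pair n (orb f a 0) (orb f b j)" "letter_pair n (orb f a 0) (orb f b (Suc j))"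
      using that(2) by (auto intro!: pair_b pair_ab simp del: orb_0)
  qed
  show "D x \<otimes> D (q j) = D (q j) \<otimes> D x" if i: "j < k - 1" "1 \<le> j"
    using jb[OF i] subseq_pairs(3)[OF i(1)] ab
    unfolding x_def q_def by (intro D.D_pair_commute refl_commute) (auto simp: letter_pair_def)
  show "D y \<otimes> D (q j) = D (q j) \<otimes> D y" if i: "j < k - 1" "1 \<le> j"
    using jb[OF i] subseq_pairs(4)[OF i(1)] ab
    unfolding y_def q_def by (intro D.D_pair_commute refl_commute) (auto simp: letter_pair_def)
  show "D (p i) \<otimes> D (q j) = D (q j) \<otimes> D (p i)" if i: "i < m - 1" "j < k - 1"
  proof -
    have "i < m" "Suc i < m" "j < k" "Suc j < k" using i by auto
    then have "letter_pair n (orb f a i) (orb f a (Suc i))" "letter_pair n (orb f b j) (orb f b (Suc j))"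
      "letter_pair n (orb f a i) (orb f b j)" "letter_pair n (orb f a (Suc i)) (orb f b j)"
      "letter_pair n (orb f a i) (orb f b (Suc j))" "letter_pair n (orb f a (Suc i)) (orb f b (Suc j))"
      by (auto intro!: pair_a pair_b pair_ab)
    then show ?thesis using subseq_pairs(5)[OF i]
      unfolding p_def q_def by (intro D.D_pair_commute refl_commute) (auto simp: letter_pair_def)
  qed
qed

lemma D_braid:
  "1 < m \<Longrightarrow> D x \<otimes> D (p 0) \<otimes> D x = D (p 0) \<otimes> D x \<otimes> D (p 0)"
  "1 < k \<Longrightarrow> D x \<otimes> D (q 0) \<otimes> D x = D (q 0) \<otimes> D x \<otimes> D (q 0)"
  "1 < k \<Longrightarrow> D y \<otimes> D (q 0) \<otimes> D y = D (q 0) \<otimes> D y \<otimes> D (q 0)"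
  "Suc i < m - 1 \<Longrightarrow> D (p i) \<otimes> D (p (Suc i)) \<otimes> D (p i) = D (p (Suc i)) \<otimes> D (p i) \<otimes> D (p (Suc i))"
  "Suc j < k - 1 \<Longrightarrow> D (q j) \<otimes> D (q (Suc j)) \<otimes> D (q j) = D (q (Suc j)) \<otimes> D (q j) \<otimes> D (q (Suc j))"
proof -
  have ab: "letter_pair n a b" using pair_ab[of 0 0] lengths by simp
  have x': "x = reflection b a" and y': "y = reflection (- b) a"
    using ab refl_sym by (auto simp: x_def y_def letter_pair_def)
  show "D x \<otimes> D (p 0) \<otimes> D x = D (p 0) \<otimes> D x \<otimes> D (p 0)" if "1 < m"
  proof (rule D.D_pair_braid)
    show "subseq [x, p 0] ts" using that by (intro subseq_pairs) auto
    show "x \<otimes>\<^bsub>W\<^esub> p 0 \<otimes>\<^bsub>W\<^esub> x = p 0 \<otimes>\<^bsub>W\<^esub> x \<otimes>\<^bsub>W\<^esub> p 0"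
      using refl_braid[of b a "orb f a 1"] ab pair_a[of 0 1] pair_ab[of 1 0] that lengths(1,2)
      by (auto simp: x' p_def letter_pair_def)
  qed
  have qy: "q 0 = reflection (- b) (- orb f b 1)" if "1 < k"
    using pair_b[of 0 1] that refl_uminus by (simp add: q_def)
  show "D x \<otimes> D (q 0) \<otimes> D x = D (q 0) \<otimes> D x \<otimes> D (q 0)" if "1 < k"
  proof (rule D.D_pair_braid)
    show "subseq [x, q 0] ts" using that by (intro subseq_pairs) auto
    show "x \<otimes>\<^bsub>W\<^esub> q 0 \<otimes>\<^bsub>W\<^esub> x = q 0 \<otimes>\<^bsub>W\<^esub> x \<otimes>\<^bsub>W\<^esub> q 0"
      using refl_braid[of a b "orb f b 1"] ab pair_b[of 0 1] pair_ab[of 0 1] that lengths(1,2)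
      by (auto simp: x_def q_def letter_pair_def)
  qed
  show "D y \<otimes> D (q 0) \<otimes> D y = D (q 0) \<otimes> D y \<otimes> D (q 0)" if "1 < k"
  proof (rule D.D_pair_braid)
    show "subseq [y, q 0] ts" using that by (intro subseq_pairs) auto
    show "y \<otimes>\<^bsub>W\<^esub> q 0 \<otimes>\<^bsub>W\<^esub> y = q 0 \<otimes>\<^bsub>W\<^esub> y \<otimes>\<^bsub>W\<^esub> q 0"
      using refl_braid[of a "- b" "- orb f b 1"] ab pair_b[of 0 1] pair_ab[of 0 1] that lengths(1,2)
      unfolding qy[OF that] y_def by (auto simp: letter_pair_def)
  qed
  show "D (p i) \<otimes> D (p (Suc i)) \<otimes> D (p i) = D (p (Suc i)) \<otimes> D (p i) \<otimes> D (p (Suc i))"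
    if "Suc i < m - 1"
  proof (rule D.D_pair_braid)
    show "subseq [p i, p (Suc i)] ts" using that by (intro subseq_pairs) auto
    show "p i \<otimes>\<^bsub>W\<^esub> p (Suc i) \<otimes>\<^bsub>W\<^esub> p i = p (Suc i) \<otimes>\<^bsub>W\<^esub> p i \<otimes>\<^bsub>W\<^esub> p (Suc i)"
      using refl_braid[OF pair_a pair_a, of i "Suc i" "Suc (Suc i)"] pair_a[of i "Suc (Suc i)"] that
      by (auto simp: p_def letter_pair_def)
  qed
  show "D (q j) \<otimes> D (q (Suc j)) \<otimes> D (q j) = D (q (Suc j)) \<otimes> D (q j) \<otimes> D (q (Suc j))"
    if "Suc j < k - 1"
  proof (rule D.D_pair_braid)
    show "subseq [q j, q (Suc j)] ts" using that by (intro subseq_pairs) auto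
    show "q j \<otimes>\<^bsub>W\<^esub> q (Suc j) \<otimes>\<^bsub>W\<^esub> q j = q (Suc j) \<otimes>\<^bsub>W\<^esub> q j \<otimes>\<^bsub>W\<^esub> q (Suc j)"
      using refl_braid[OF pair_b pair_b, of j "Suc j" "Suc (Suc j)"] pair_b[of j "Suc (Suc j)"] that
      by (auto simp: q_def letter_pair_def)
  qed
qed

lemma all_equalI:
  assumes "D y = D x" "\<And>i. i < m - 1 \<Longrightarrow> D (p i) = D x" "\<And>j. j < k - 1 \<Longrightarrow> D (q j) = D x"
    and "t \<in> set ts"
  shows "D t = D x"
  using assms by (auto simp: ts_eq)

text \<open>In a commutative group braiding elements are equal, and the diagram is connected.\<close>

lemma constant_if_commutative:
  assumes k: "1 < k" and comm: "\<And>g h. g \<in> carrier K \<Longrightarrow> h \<in> carrier K \<Longrightarrow> g \<otimes> h = h \<otimes> g"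
    and t: "t \<in> set ts"
  shows "D t = D x"
proof -
  have eq: "D s = D r"
    if "D s \<otimes> D r \<otimes> D s = D r \<otimes> D s \<otimes> D r" "s \<in> set ts" "r \<in> set ts" for s r
    using eq_of_braid_commute[OF _ _ that(1)] comm D_ts_closed that(2,3) by blast
  have q0: "D (q 0) = D x" using eq[OF D_braid(2)] in_ts k by auto
  have Q: "D (q j) = D x" if "j < k - 1" for j
    using that
  proof (induction j)
    case (Suc j)
    then show ?case using eq[OF D_braid(5)[of j]] in_ts by auto
  qed (use q0 in simp)
  have P: "D (p i) = D x" if "i < m - 1" for i
    using that
  proof (induction i)
    case 0
    then show ?case using eq[OF D_braid(1)] in_ts by auto
  next
    case (Suc i)
    then show ?case using eq[OF D_braid(4)[of i]] in_ts by auto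
  qed
  have "D y = D x" using eq[OF D_braid(3)] q0 in_ts k by auto
  from all_equalI[OF this P Q t] show ?thesis .
qed

text \<open>If \<open>q 0\<close> and a later \<open>q j\<close> have the same image, then \<open>x\<close>, which commutes with \<open>q j\<close> and
  braids with \<open>q 0\<close>, is identified with both; the collapse then spreads along the diagram.\<close>

lemma constant_if_collision:
  assumes j: "1 \<le> j" "j < k - 1" "D (q j) = D (q 0)" and m: "1 < m" and t: "t \<in> set ts"
  shows "D t = D x"
proof -
  have eq: "D s = D r"
    if "D s \<otimes> D r \<otimes> D s = D r \<otimes> D s \<otimes> D r" "D s \<otimes> D r = D r \<otimes> D s" "s \<in> set ts" "r \<in> set ts" for s r
    using eq_of_braid_commute[OF _ _ that(1,2)] D_ts_closed that(3,4) by blast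
  have q0: "D (q 0) = D x"
    using eq[OF D_braid(2)] D_commute(2)[OF j(2,1)] j in_ts by auto
  have y: "D y = D x"
    using eq[OF D_braid(3)] D_commute(3)[OF j(2,1)] j in_ts q0 by auto
  have Q: "D (q i) = D x" if "i < k - 1" for i
    using that
  proof (induction i)
    case (Suc i)
    then show ?case using eq[OF D_braid(5)[of i]] D_commute(2)[of "Suc i"] in_ts by auto
  qed (use q0 in simp)
  have P: "D (p i) = D x" if "i < m - 1" for i
    using that
  proof (induction i)
    case 0
    then show ?case using eq[OF D_braid(1)] D_commute(4)[of 0 0] q0 j in_ts by auto
  next
    case (Suc i)
    then show ?case using eq[OF D_braid(4)[of i]] D_commute(1)[of "Suc i"] in_ts by auto
  qed
  from all_equalI[OF y P Q t] show ?thesis .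
qed

lemma q_pair: "1 < k \<Longrightarrow> letter_pair n (orb f b i) (orb f b (Suc i))"
proof (induction i)
  case 0
  then show ?case using pair_b[of 0 1] by simp
next
  case (Suc i)
  then show ?case using signed_perm_letter_pair[OF cyc(3)] by (simp add: orb_Suc)
qed

lemma q_rotate:
  assumes k: "1 < k"
  shows "q i \<in> D.I" "w [^]\<^bsub>W\<^esub> (j::nat) \<otimes>\<^bsub>W\<^esub> q i \<otimes>\<^bsub>W\<^esub> inv\<^bsub>W\<^esub> (w [^]\<^bsub>W\<^esub> j) = q (i + j)"
proof -
  note pair = q_pair[OF k]
  have step: "w \<otimes>\<^bsub>W\<^esub> q i \<otimes>\<^bsub>W\<^esub> inv\<^bsub>W\<^esub> w = q (Suc i)" for i
    using refl_conj[OF pair D.w_closed] by (simp add: q_def orb_Suc)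
  show *: "q i \<in> D.I" for i
  proof (induction i)
    case 0
    then show ?case using in_ts(4)[of 0] k D.letter_I by auto
  next
    case (Suc i)
    then show ?case using R.interval_conj[OF _ D.w_closed] step by metis
  qed
  have qc: "q i \<in> carrier W" for i using refl_closed[OF pair] by (simp add: q_def)
  show "w [^]\<^bsub>W\<^esub> (j::nat) \<otimes>\<^bsub>W\<^esub> q i \<otimes>\<^bsub>W\<^esub> inv\<^bsub>W\<^esub> (w [^]\<^bsub>W\<^esub> j) = q (i + j)"
  proof (induction j)
    case (Suc j)
    have wc: "w \<in> carrier W" "w [^]\<^bsub>W\<^esub> j \<in> carrier W" using D.w_closed by auto
    have "w [^]\<^bsub>W\<^esub> Suc j = w \<otimes>\<^bsub>W\<^esub> w [^]\<^bsub>W\<^esub> j" by (rule W.nat_pow_Suc2[OF wc(1)])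
    then have "w [^]\<^bsub>W\<^esub> Suc j \<otimes>\<^bsub>W\<^esub> q i \<otimes>\<^bsub>W\<^esub> inv\<^bsub>W\<^esub> (w [^]\<^bsub>W\<^esub> Suc j)
        = w \<otimes>\<^bsub>W\<^esub> (w [^]\<^bsub>W\<^esub> j \<otimes>\<^bsub>W\<^esub> q i \<otimes>\<^bsub>W\<^esub> inv\<^bsub>W\<^esub> (w [^]\<^bsub>W\<^esub> j)) \<otimes>\<^bsub>W\<^esub> inv\<^bsub>W\<^esub> w"
      using wc qc[of i] by (simp add: W.inv_mult_group W.m_assoc)
    then show ?case using Suc step by simp
  qed (use qc in simp)
qed

lemma q_period: "1 < k \<Longrightarrow> q (i + k) = q i"
  using orb_add_period[OF cyc(3,4), of i] orb_add_period[OF cyc(3,4), of "Suc i"]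
    refl_uminus[OF q_pair[of i]] by (simp add: q_def)

text \<open>Conjugation by the \<open>(n-1)\<close>-st power shifts the index of \<open>q\<close> by \<open>n - 1 = (m - 1) + k\<close>, so \<open>q 0\<close> and \<open>q (m - 1)\<close>
  have the same image. For \<open>m < k\<close> this is a collision between letters of the word. For \<open>m = k\<close> the reflection
  \<open>q (k - 1)\<close> is not a letter, but it is followed by \<open>q k = q 0\<close>; one more shift makes \<open>q 0\<close> and \<open>q 1\<close> collide.\<close>

theorem constant_if_power_central:
  assumes m: "1 < m" "m \<le> k" and central: "D w [^] (n - 1) \<otimes> D (q 0) = D (q 0) \<otimes> D w [^] (n - 1)"
    and t: "t \<in> set ts"
  shows "D t = D x"
proof -
  have k: "1 < k" "2 < k" using m lengths n_ge by auto
  have c: "D w \<in> carrier K" "D (q i) \<in> carrier K" for i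
    using D.D_closed D.w_in_I q_rotate(1)[OF k(1)] by blast+
  have conj: "D w [^] (i::nat) \<otimes> D (q j) = D (q (j + i)) \<otimes> D w [^] i" for i j
    using D.D_power_conj_w[OF q_rotate(1)[OF k(1)], of i j] q_rotate(2)[OF k(1)] by simp
  have "D (q 0) \<otimes> D w [^] (n - 1) = D (q (n - 1)) \<otimes> D w [^] (n - 1)"
    using conj[of "n - 1" 0] central by simp
  then have "D (q 0) = D (q (n - 1))" using c by simp
  moreover have "n - 1 = m - 1 + k" using lengths by simp
  ultimately have e: "D (q (m - 1)) = D (q 0)" using q_period[OF k(1), of "m - 1"] by simp
  show ?thesis
  proof (cases "m < k")
    case True
    then have "1 \<le> m - 1" "m - 1 < k - 1" using m by linarith+
    from constant_if_collision[OF this e m(1) t] show ?thesis .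
  next
    case False
    then have "m = k" using m by simp
    have "D (q 1) \<otimes> D w = D w \<otimes> D (q 0)" using conj[of 1 0] c by simp
    also have "\<dots> = D w \<otimes> D (q (k - 1))" using e \<open>m = k\<close> by simp
    also have "\<dots> = D (q (k - 1 + 1)) \<otimes> D w" using conj[of 1 "k - 1"] c by simp
    also have "q (k - 1 + 1) = q 0" using q_period[OF k(1), of 0] k by simp
    finally have "D (q 1) = D (q 0)" using c by simp
    then show ?thesis using k m t by (intro constant_if_collision[of 1]) simp_all
  qed
qed

end


section \<open>Strand permutations and winding numbers of braids\<close>

text \<open>For \<open>e = 1\<close> this is the action of the \<open>c\<close>-th generator of the braid group on an ordered pair of strand
  positions together with a counter of half turns: the counter is increased when the two strands cross. These
  bijections generate a group of pairs of a permutation and an integer function on the pairs of strands; working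
  with functions makes the group laws automatic.\<close>

definition wind :: "nat \<Rightarrow> int \<Rightarrow> nat \<times> nat \<times> int \<Rightarrow> nat \<times> nat \<times> int" where
  "wind c e = (\<lambda>(i, j, z). (transpose c (c + 1) i, transpose c (c + 1) j,
     z + (if {i, j} = {c, c + 1} then e else 0)))"

lemma wind_apply [simp]:
  "wind c e (i, j, z) = (transpose c (c + 1) i, transpose c (c + 1) j,
     z + (if {i, j} = {c, c + 1} then e else 0))"
  by (simp add: wind_def)

lemma transpose_pair_iff:
  "{transpose c (c + 1) i, transpose c (c + 1) j} = {c, c + 1} \<longleftrightarrow> {i, j} = {c, c + (1::nat)}"
  by (auto simp: doubleton_eq_iff transpose_eq_iff)

lemma wind_inverse: "wind c e \<circ> wind c (- e) = id"
  by (rule ext, case_tac x) (simp only: comp_apply wind_apply transpose_pair_iff id_apply, auto)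

lemma bij_wind: "bij (wind c e)"
  using wind_inverse[of c e] wind_inverse[of c "- e"] by (intro o_bij[of "wind c (- e)"]) auto

lemma inv_wind: "inv\<^bsub>bij_group\<^esub> (wind c e) = wind c (- e)"
  using wind_inverse[of c "- e"] bij_wind by (intro group.inv_equality) auto

lemma wind_commute:
  assumes "c + 2 \<le> d"
  shows "wind c 1 \<circ> wind d 1 = wind d 1 \<circ> wind c 1"
proof
  fix x :: "nat \<times> nat \<times> int"
  obtain i j z where x: "x = (i, j, z)" by (cases x)
  have t: "transpose c (c + 1) (transpose d (d + 1) l) = transpose d (d + 1) (transpose c (c + 1) l)" for l
    using assms by (auto simp: Transposition.transpose_def)
  have "{transpose d (d + 1) i, transpose d (d + 1) j} = {c, c + 1} \<longleftrightarrow> {i, j} = {c, c + 1}"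
    "{transpose c (c + 1) i, transpose c (c + 1) j} = {d, d + 1} \<longleftrightarrow> {i, j} = {d, d + 1}"
    using assms by (auto simp: doubleton_eq_iff transpose_eq_iff)
  then show "(wind c 1 \<circ> wind d 1) x = (wind d 1 \<circ> wind c 1) x"
    by (simp only: x comp_apply wind_apply t) simp
qed

lemma wind_braid:
  "wind c 1 \<circ> wind (c + 1) 1 \<circ> wind c 1 = wind (c + 1) 1 \<circ> wind c 1 \<circ> wind (c + 1) 1"
proof
  fix x :: "nat \<times> nat \<times> int"
  obtain i j z where x: "x = (i, j, z)" by (cases x)
  have cases: "l = c \<or> l = c + 1 \<or> l = c + 2 \<or> (l \<noteq> c \<and> l \<noteq> c + 1 \<and> l \<noteq> c + 2)" for l by blast
  show "(wind c 1 \<circ> wind (c + 1) 1 \<circ> wind c 1) x = (wind (c + 1) 1 \<circ> wind c 1 \<circ> wind (c + 1) 1) x"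
    using cases[of i] cases[of j]
    by (elim disjE) (simp_all add: x doubleton_eq_iff Transposition.transpose_def)
qed

lemma wind_noncommute: "wind 1 1 \<circ> wind 2 1 \<noteq> wind 2 1 \<circ> wind 1 1"
proof
  assume "wind 1 1 \<circ> wind 2 1 = wind 2 1 \<circ> wind 1 1"
  then have "(wind 1 1 \<circ> wind 2 1) (1, 1, 0) = (wind 2 1 \<circ> wind 1 1) (1, 1, 0)" by simp
  then show False by (simp add: Transposition.transpose_def)
qed

text \<open>\<open>F\<close> has strand permutation \<open>\<pi>\<close>, half-turn numbers \<open>v\<close> and exponent sum \<open>l\<close>. Two strands make an even number of
  half turns if and only if their order is the same at both ends. The total is \<open>2 l\<close> because each crossing
  is counted for both orderings of the pair.\<close>

definition winding :: "nat \<Rightarrow> (nat \<times> nat \<times> int \<Rightarrow> nat \<times> nat \<times> int) \<Rightarrow> (nat \<Rightarrow> nat) \<Rightarrow> (nat \<Rightarrow> nat \<Rightarrow> int) \<Rightarrow> int \<Rightarrow> bool" where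
  "winding n F \<pi> v l \<longleftrightarrow> \<pi> permutes {1..n} \<and> (\<forall>i j z. F (i, j, z) = (\<pi> i, \<pi> j, z + v i j))
     \<and> (\<forall>i j. \<not> (i \<in> {1..n} \<and> j \<in> {1..n} \<and> i \<noteq> j) \<longrightarrow> v i j = 0)
     \<and> (\<forall>i\<in>{1..n}. \<forall>j\<in>{1..n}. i \<noteq> j \<longrightarrow> (even (v i j) \<longleftrightarrow> (i < j \<longleftrightarrow> \<pi> i < \<pi> j)))
     \<and> (\<Sum>i\<in>{1..n}. \<Sum>j\<in>{1..n}. v i j) = 2 * l"

lemma windingD:
  assumes "winding n F \<pi> v l"
  shows "\<pi> permutes {1..n}" "F (i, j, z) = (\<pi> i, \<pi> j, z + v i j)"
    "\<not> (i \<in> {1..n} \<and> j \<in> {1..n} \<and> i \<noteq> j) \<Longrightarrow> v i j = 0"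
    "i \<in> {1..n} \<Longrightarrow> j \<in> {1..n} \<Longrightarrow> i \<noteq> j \<Longrightarrow> even (v i j) \<longleftrightarrow> (i < j \<longleftrightarrow> \<pi> i < \<pi> j)"
    "(\<Sum>i\<in>{1..n}. \<Sum>j\<in>{1..n}. v i j) = 2 * l"
  using assms unfolding winding_def by blast+

lemma winding_id: "winding n id id (\<lambda>_ _. 0) 0"
  unfolding winding_def by (simp only: permutes_id) auto

lemma winding_step:
  assumes F: "winding n F \<pi> v l" and c: "c \<in> {1..n - 1}" and e: "odd e"
  shows "\<exists>\<pi>' v'. winding n (wind c e \<circ> F) \<pi>' v' (l + e)"
proof -
  note D = windingD[OF F]
  let ?t = "transpose c (c + 1)"
  define d where "d i j = (if {i, j} = {c, c + 1} then e else 0)" for i j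
  define \<pi>' where "\<pi>' = ?t \<circ> \<pi>"
  define v' where "v' i j = v i j + d (\<pi> i) (\<pi> j)" for i j
  have t: "?t permutes {1..n}" using c by (intro permutes_swap_id) auto
  have mem: "\<pi> i \<in> {1..n} \<longleftrightarrow> i \<in> {1..n}" for i using D(1) by (rule permutes_in_image)
  have inj: "\<pi> i = \<pi> j \<longleftrightarrow> i = j" for i j using permutes_inj[OF D(1)] by (simp add: inj_eq)
  have "winding n (wind c e \<circ> F) \<pi>' v' (l + e)"
    unfolding winding_def
  proof (intro conjI allI ballI impI)
    show "\<pi>' permutes {1..n}" unfolding \<pi>'_def using D(1) t by (rule permutes_compose)
    show "(wind c e \<circ> F) (i, j, z) = (\<pi>' i, \<pi>' j, z + v' i j)" for i j z
      by (simp add: D(2) \<pi>'_def v'_def d_def)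
    show "v' i j = 0" if "\<not> (i \<in> {1..n} \<and> j \<in> {1..n} \<and> i \<noteq> j)" for i j
    proof -
      have "{\<pi> i, \<pi> j} \<noteq> {c, c + 1}"
      proof
        assume *: "{\<pi> i, \<pi> j} = {c, c + 1}"
        then have "\<pi> i = c \<and> \<pi> j = c + 1 \<or> \<pi> i = c + 1 \<and> \<pi> j = c"
          by (simp add: doubleton_eq_iff)
        moreover have "c \<in> {1..n}" "c + 1 \<in> {1..n}" "c \<noteq> c + 1" using c by auto
        ultimately have "\<pi> i \<in> {1..n}" "\<pi> j \<in> {1..n}" "\<pi> i \<noteq> \<pi> j" by metis+
        then show False using that mem inj by blast
      qed
      then show ?thesis using D(3)[OF that] by (simp add: v'_def d_def)
    qed
    show "even (v' i j) \<longleftrightarrow> (i < j \<longleftrightarrow> \<pi>' i < \<pi>' j)" if "i \<in> {1..n}" "j \<in> {1..n}" "i \<noteq> j" for i j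
    proof -
      have ne: "\<pi> i \<noteq> \<pi> j" using that inj by blast
      have "(?t x < ?t y \<longleftrightarrow> x < y) \<longleftrightarrow> {x, y} \<noteq> {c, c + 1}" if "x \<noteq> y" for x y
        using that by (auto simp: Transposition.transpose_def doubleton_eq_iff)
      from this[OF ne] D(4)[OF that] e show ?thesis
        by (auto simp: v'_def d_def \<pi>'_def)
    qed
    have "(\<Sum>i\<in>{1..n}. \<Sum>j\<in>{1..n}. d (\<pi> i) (\<pi> j)) = (\<Sum>i\<in>{1..n}. \<Sum>j\<in>{1..n}. d i j)"
    proof -
      have "(\<Sum>j\<in>{1..n}. d (\<pi> i) (\<pi> j)) = (\<Sum>j\<in>{1..n}. d (\<pi> i) j)" for i
        using sum.permute[OF D(1), of "d (\<pi> i)"] by (simp add: comp_def)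
      then show ?thesis
        using sum.permute[OF D(1), of "\<lambda>i. \<Sum>j\<in>{1..n}. d i j"] by (simp add: comp_def)
    qed
    also have "\<dots> = 2 * e"
    proof -
      have "(\<Sum>j\<in>{1..n}. d i j) = (if i = c then e else 0) + (if i = c + 1 then e else 0)" for i
      proof -
        have "(\<Sum>j\<in>{1..n}. d i j)
            = (\<Sum>j\<in>{1..n}. (if j = c + 1 then if i = c then e else 0 else 0)
                + (if j = c then if i = c + 1 then e else 0 else 0))"
          by (intro sum.cong) (auto simp: d_def doubleton_eq_iff)
        then show ?thesis using c by (simp add: sum.distrib sum.delta) auto
      qed
      then show ?thesis using c by (simp add: sum.distrib sum.delta) auto
    qed
    finally show "(\<Sum>i\<in>{1..n}. \<Sum>j\<in>{1..n}. v' i j) = 2 * (l + e)"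
      using D(5) by (simp add: v'_def sum.distrib)
  qed
  then show ?thesis by blast
qed

text \<open>Adjacent transpositions lower the first index to \<open>1\<close> and then the second one to \<open>2\<close>.\<close>

lemma adjacent_invariant_const:
  fixes v :: "nat \<Rightarrow> nat \<Rightarrow> 'a"
  assumes v: "\<And>c i j. c \<in> {1..n - 1} \<Longrightarrow> v (transpose c (c + 1) i) (transpose c (c + 1) j) = v i j"
    and ij: "1 \<le> i" "i < j" "j \<le> n"
  shows "v i j = v 1 2"
proof -
  have first: "v i j = v 1 j" if "1 \<le> i" "i < j" "j \<le> n" for i j
    using that
  proof (induction i)
    case (Suc i)
    show ?case
    proof (cases "i = 0")
      case False
      then have "v (transpose i (i + 1) (Suc i)) (transpose i (i + 1) j) = v (Suc i) j"
        using Suc.prems by (intro v) auto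
      moreover have "transpose i (i + 1) (Suc i) = i" "transpose i (i + 1) j = j"
        using Suc.prems by auto
      ultimately show ?thesis using Suc False by simp
    qed simp
  qed simp
  have second: "v 1 j = v 1 2" if "2 \<le> j" "j \<le> n" for j
    using that
  proof (induction j rule: nat_induct_at_least)
    case (Suc j)
    have "v (transpose j (j + 1) 1) (transpose j (j + 1) (Suc j)) = v 1 (Suc j)"
      using Suc.hyps Suc.prems by (intro v) auto
    moreover have "transpose j (j + 1) 1 = 1" "transpose j (j + 1) (Suc j) = j"
      using Suc.hyps by auto
    ultimately show ?case using Suc by simp
  qed simp
  show ?thesis using first[OF ij] second[of j] ij by simp
qed

text \<open>Commuting with the adjacent transpositions forces the strand permutation to be trivial and the numbers
  \<open>v i j\<close> to be invariant under the symmetric group, which acts transitively on ordered pairs.\<close>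

lemma winding_rigid:
  assumes n: "n \<ge> 3" and F: "winding n F \<pi> v l"
    and comm: "\<And>c. c \<in> {1..n - 1} \<Longrightarrow> F \<circ> wind c 1 = wind c 1 \<circ> F"
  shows "\<pi> = id" "\<exists>c. (\<forall>i\<in>{1..n}. \<forall>j\<in>{1..n}. i \<noteq> j \<longrightarrow> v i j = c) \<and> int n * (int n - 1) * c = 2 * l"
proof -
  note D = windingD[OF F]
  have inj: "\<pi> i = \<pi> j \<longleftrightarrow> i = j" for i j using permutes_inj[OF D(1)] by (simp add: inj_eq)
  have eq: "\<pi> (transpose c (c + 1) i) = transpose c (c + 1) (\<pi> i)
      \<and> (if {i, j} = {c, c + 1} then 1 else 0) + v (transpose c (c + 1) i) (transpose c (c + 1) j)
        = v i j + (if {\<pi> i, \<pi> j} = {c, c + 1} then 1 else 0)"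
    if "c \<in> {1..n - 1}" for c i j
    using fun_cong[OF comm[OF that], of "(i, j, 0)"] by (simp add: D(2))
  have "\<pi> i = i" for i
  proof (rule ccontr)
    assume ne: "\<pi> i \<noteq> i"
    then have mem: "i \<in> {1..n}" "\<pi> i \<in> {1..n}"
      using D(1) permutes_not_in[OF D(1)] permutes_in_image[OF D(1)] by blast+
    have "\<exists>c\<in>{1..n - 1}. (i \<in> {c, c + 1}) \<noteq> (\<pi> i \<in> {c, c + 1})"
    proof -
      consider "i < n - 1" "\<pi> i \<noteq> i + 1" | "i < n - 1" "\<pi> i = i + 1" | "i > 2" "\<pi> i \<noteq> i - 1"
        | "i > 2" "\<pi> i = i - 1" | "i = n - 1" "i \<le> 2" | "i = n" "i \<le> 2"
        using mem by fastforce
      then show ?thesis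
      proof cases
        case 1
        then show ?thesis using mem ne n by (intro bexI[of _ i]) auto
      next
        case 2
        then show ?thesis using mem ne n by (intro bexI[of _ "i + 1"]) auto
      next
        case 3
        then show ?thesis using mem ne n by (intro bexI[of _ "i - 1"]) auto
      next
        case 4
        then show ?thesis using mem ne n by (intro bexI[of _ "i - 2"]) auto
      next
        case 5
        then have "i = 2" "n = 3" using n mem by auto
        then have "\<pi> i = 1 \<or> \<pi> i = 3" using mem ne by auto
        then show ?thesis
        proof
          assume "\<pi> i = 1"
          then show ?thesis using \<open>i = 2\<close> \<open>n = 3\<close> by (intro bexI[of _ 2]) auto
        next
          assume "\<pi> i = 3"
          then show ?thesis using \<open>i = 2\<close> \<open>n = 3\<close> by (intro bexI[of _ 1]) auto
        qed
      qed (use n in auto)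
    qed
    then obtain c where c: "c \<in> {1..n - 1}" "(i \<in> {c, c + 1}) \<noteq> (\<pi> i \<in> {c, c + 1})" by blast
    have e: "\<pi> (transpose c (c + 1) i) = transpose c (c + 1) (\<pi> i)" using eq[OF c(1)] by blast
    show False
    proof (cases "i \<in> {c, c + 1}")
      case True
      then have "transpose c (c + 1) (\<pi> i) = \<pi> i" "transpose c (c + 1) i \<noteq> i"
        using c(2) by auto
      then show False using e inj by metis
    next
      case False
      then have "transpose c (c + 1) (\<pi> i) \<noteq> \<pi> i" "transpose c (c + 1) i = i"
        using c(2) by auto
      then show False using e by simp
    qed
  qed
  then show id: "\<pi> = id" by auto
  have v: "v (transpose c (c + 1) i) (transpose c (c + 1) j) = v i j" if "c \<in> {1..n - 1}" for c i j
    using eq[OF that, of i j] id by (simp split: if_splits)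
  have "v (transpose 1 (1 + 1) 1) (transpose 1 (1 + 1) 2) = v 1 2" using n by (intro v) auto
  then have "v 2 1 = v 1 2" by (simp add: numeral_2_eq_2)
  have const: "v i j = v 1 2" if ij: "i \<in> {1..n}" "j \<in> {1..n}" "i \<noteq> j" for i j
  proof (cases "i < j")
    case True
    show ?thesis by (rule adjacent_invariant_const[of n v, OF v]) (use True ij in simp_all)
  next
    case False
    have "v i j = v 2 1"
      by (rule adjacent_invariant_const[of n "\<lambda>i j. v j i" j i, OF v]) (use False ij in simp_all)
    then show ?thesis using \<open>v 2 1 = v 1 2\<close> by simp
  qed
  have "(\<Sum>j\<in>{1..n}. v i j) = (int n - 1) * v 1 2" if i: "i \<in> {1..n}" for i
  proof -
    have "(\<Sum>j\<in>{1..n}. v i j) = v i i + (\<Sum>j\<in>{1..n} - {i}. v i j)"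
      using i by (intro sum.remove) auto
    also have "(\<Sum>j\<in>{1..n} - {i}. v i j) = (\<Sum>j\<in>{1..n} - {i}. v 1 2)"
      by (rule sum.cong[OF HOL.refl], rule const) (use i in auto)
    also have "\<dots> = (int n - 1) * v 1 2" using i n by (simp add: of_nat_diff)
    finally show ?thesis using D(3)[of i i] by simp
  qed
  then have "(\<Sum>i\<in>{1..n}. \<Sum>j\<in>{1..n}. v i j) = int n * ((int n - 1) * v 1 2)" by simp
  then have "int n * (int n - 1) * v 1 2 = 2 * l" using D(5) by (simp only: mult.assoc)
  then show "\<exists>c. (\<forall>i\<in>{1..n}. \<forall>j\<in>{1..n}. i \<noteq> j \<longrightarrow> v i j = c) \<and> int n * (int n - 1) * c = 2 * l"
    using const by blast
qed

lemma funpow_shift: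
  assumes "\<And>z. F (i, j, z) = (i, j, z + (d::int))"
  shows "(F ^^ k) (i, j, z) = (i, j, z + int k * d)"
  by (induction k arbitrary: z) (simp_all add: assms algebra_simps)

text \<open>Suppose that \<open>F\<^sup>L\<close> fixes two strands. They make an even number of half turns, and comparison with the
  central power shows that this number is \<open>\<plusminus> 2 L / (n - 1)\<close>; so \<open>n - 1\<close> divides \<open>L\<close>. If \<open>F\<close> moves a
  strand, take for \<open>L\<close> the length of its cycle, which is at most \<open>n\<close>: then \<open>L = n - 1\<close>. Hence \<open>F\<^bsup>n-1\<^esup>\<close> fixes all
  strands, and every pair makes \<open>\<plusminus>2\<close> half turns.\<close>

lemma root_of_central:
  assumes n: "n \<ge> 4" and l: "\<bar>l\<bar> = int n" and k: "k > 0"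
    and F: "\<And>L. \<exists>\<pi> v. winding n (F ^^ L) \<pi> v (int L * l)"
    and comm: "\<And>c. c \<in> {1..n - 1} \<Longrightarrow> (F ^^ k) \<circ> wind c 1 = wind c 1 \<circ> (F ^^ k)"
    and G: "winding n G \<pi>G vG lG"
  shows "(F ^^ (n - 1)) \<circ> G = G \<circ> (F ^^ (n - 1))"
proof -
  obtain P v where P: "\<And>L. winding n (F ^^ L) (P L) (v L) (int L * l)" using F by metis
  note D = windingD[OF P]
  have Pk: "P k = id" using winding_rigid(1)[OF _ P comm] n by simp
  obtain c where c: "\<And>i j. i \<in> {1..n} \<Longrightarrow> j \<in> {1..n} \<Longrightarrow> i \<noteq> j \<Longrightarrow> v k i j = c"
    "int n * (int n - 1) * c = 2 * (int k * l)"
    using winding_rigid(2)[OF _ P comm] n by auto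
  have P_add: "P (L + M) i = P L (P M i)" for L M i
  proof -
    have "(F ^^ (L + M)) (i, i, 0) = (F ^^ L) ((F ^^ M) (i, i, 0))" by (simp add: funpow_add)
    then show ?thesis by (simp add: D(2))
  qed
  have turn: "(int n - 1) * v L i j = 2 * int L * sgn l \<and> even (v L i j)"
    if ij: "i \<in> {1..n}" "j \<in> {1..n}" "i \<noteq> j" and fixd: "P L i = i" "P L j = j" for L i j
  proof
    show "even (v L i j)" using D(4)[OF ij, of L] fixd by simp
    have "((F ^^ L) ^^ k) (i, j, 0) = (i, j, int k * v L i j)"
      using funpow_shift[of "F ^^ L" i j "v L i j" k 0] D(2)[of L i j] fixd by simp
    moreover have "((F ^^ k) ^^ L) (i, j, 0) = (i, j, int L * c)"
      using funpow_shift[of "F ^^ k" i j c L 0] D(2)[of k i j] Pk c(1)[OF ij] by simp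
    moreover have "(F ^^ L) ^^ k = (F ^^ k) ^^ L" by (simp add: funpow_mult mult.commute)
    ultimately have kv: "int k * v L i j = int L * c" by simp
    have "int n * (int n - 1) * (int k * v L i j) = int L * (int n * (int n - 1) * c)"
      by (simp add: kv)
    also have "\<dots> = int k * (2 * int L * l)" by (simp add: c(2))
    finally have "int k * (int n * ((int n - 1) * v L i j)) = int k * (2 * int L * l)"
      by (simp add: algebra_simps)
    then have "int n * ((int n - 1) * v L i j) = 2 * int L * l" using k by simp
    also have "l = int n * sgn l" using l by (metis mult.commute sgn_mult_abs)
    finally have "int n * ((int n - 1) * v L i j) = int n * (2 * int L * sgn l)"
      by (simp add: mult_ac)
    then show "(int n - 1) * v L i j = 2 * int L * sgn l" using n by simp
  qed
  have dvd: "n - 1 dvd L"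
    if ij: "i \<in> {1..n}" "j \<in> {1..n}" "i \<noteq> j" "P L i = i" "P L j = j" for L i j
  proof -
    obtain h where h: "v L i j = 2 * h" using turn[OF ij] by (auto elim: evenE)
    then have "(int n - 1) * h = int L * sgn l" using turn[OF ij] by simp
    moreover have "sgn l = 1 \<or> sgn l = -1" using l n by (auto simp: sgn_if)
    ultimately have "int L = (int n - 1) * h \<or> int L = (int n - 1) * (- h)" by auto
    then have "(int n - 1) dvd int L" by (metis dvd_triv_left)
    moreover have "int n - 1 = int (n - 1)" using n by (simp add: of_nat_diff)
    ultimately show ?thesis by (simp only: int_dvd_int_iff)
  qed
  have mem: "P L i \<in> {1..n} \<longleftrightarrow> i \<in> {1..n}" for L i using D(1) by (rule permutes_in_image)
  have inj: "P L i = P L j \<longleftrightarrow> i = j" for L i j using permutes_inj[OF D(1)] by (simp add: inj_eq)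
  have P0: "P 0 i = i" for i using D(2)[of 0 i i 0] by simp
  have fixed: "P (n - 1) i = i" if i: "i \<in> {1..n}" for i
  proof (cases "P 1 i = i")
    case True
    have "P L i = i" for L
      by (induction L) (use P0 True P_add[of _ 1 i] in auto)
    then show ?thesis .
  next
    case False
    have "\<not> inj_on (\<lambda>L. P L i) {0..n}"
    proof
      assume "inj_on (\<lambda>L. P L i) {0..n}"
      then have "card {0..n} \<le> card {1..n}" using mem i by (intro card_inj_on_le) auto
      then show False by simp
    qed
    then obtain A B where AB: "A < B" "B \<le> n" "P A i = P B i"
      unfolding inj_on_def by (metis atLeastAtMost_iff linorder_neqE_nat)
    have "P A i = P A (P (B - A) i)" using AB P_add[of A "B - A" i] by simp
    then have per: "P (B - A) i = i" using inj by metis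
    \<comment> \<open>The second fixed strand is the image of the first one under \<open>F\<close>.\<close>
    then have "P (B - A) (P 1 i) = P 1 i"
      using P_add[of "B - A" 1 i] P_add[of 1 "B - A" i] by simp
    then have "n - 1 dvd B - A" using dvd[OF i _ _ per] mem[of 1 i] i False by metis
    then obtain h where h: "B - A = (n - 1) * h" by (elim dvdE)
    have "h = 1"
    proof (rule ccontr)
      assume "h \<noteq> 1"
      then have "h = 0 \<or> 2 \<le> h" by auto
      then show False
      proof
        assume "2 \<le> h"
        then have "(n - 1) * 2 \<le> B - A" unfolding h by (intro mult_le_mono2)
        then show False using AB n by linarith
      qed (use h AB in simp)
    qed
    then have "B - A = n - 1" using h by simp
    then show ?thesis using per by simp
  qed
  have twist: "(F ^^ (n - 1)) (i, j, z)
      = (i, j, z + (if i \<in> {1..n} \<and> j \<in> {1..n} \<and> i \<noteq> j then 2 * sgn l else 0))" for i j z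
  proof -
    have id: "P (n - 1) x = x" for x
      using fixed permutes_not_in[OF D(1)] by blast
    have "v (n - 1) i j = 2 * sgn l" if "i \<in> {1..n}" "j \<in> {1..n}" "i \<noteq> j"
    proof -
      have "(int n - 1) * v (n - 1) i j = (int n - 1) * (2 * sgn l)"
        using turn[OF that id id] n by (simp add: of_nat_diff)
      then show ?thesis using n by simp
    qed
    then show ?thesis using D(2)[of "n - 1" i j z] D(3)[of i j "n - 1"] id by auto
  qed
  show ?thesis
  proof
    fix t :: "nat \<times> nat \<times> int"
    obtain i j z where t: "t = (i, j, z)" by (cases t)
    note E = windingD[OF G]
    have "\<pi>G i \<in> {1..n} \<longleftrightarrow> i \<in> {1..n}" "\<pi>G j \<in> {1..n} \<longleftrightarrow> j \<in> {1..n}" "\<pi>G i = \<pi>G j \<longleftrightarrow> i = j"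
      using permutes_in_image[OF E(1)] permutes_inj[OF E(1)] by (auto simp: inj_eq)
    then show "((F ^^ (n - 1)) \<circ> G) t = (G \<circ> (F ^^ (n - 1))) t"
      by (simp only: t comp_apply E(2) twist) simp
  qed
qed


subsection \<open>The braid group\<close>

definition braid_gen :: "nat \<Rightarrow> nat \<Rightarrow> nat gword set" where
  "braid_gen n = pres_gen {1..n - 1} (braid_rels n)"

lemmas braid_group_induct [consumes 1, case_names one gen inv_gen] =
  presented_group_induct[where X = "{1..n - 1}" and R = "braid_rels n", folded braid_group_def braid_gen_def]
  for n

lemmas interval_group_induct [consumes 1, case_names one gen inv_gen] =
  presented_group_induct[where X = "abs_interval W S w" and R = "interval_rels W S w",
    folded interval_group_def]
  for W S w

lemma braid_hom_exists:
  assumes K: "group K" and closed: "g \<in> {1..n - 1} \<rightarrow> carrier K"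
    and braid: "\<And>i. 1 \<le> i \<Longrightarrow> i \<le> n - 2 \<Longrightarrow>
      g i \<otimes>\<^bsub>K\<^esub> (g (i + 1) \<otimes>\<^bsub>K\<^esub> g i) = g (i + 1) \<otimes>\<^bsub>K\<^esub> (g i \<otimes>\<^bsub>K\<^esub> g (i + 1))"
    and commute: "\<And>i j. i \<in> {1..n - 1} \<Longrightarrow> j \<in> {1..n - 1} \<Longrightarrow> i + 2 \<le> j \<Longrightarrow>
      g i \<otimes>\<^bsub>K\<^esub> g j = g j \<otimes>\<^bsub>K\<^esub> g i"
  shows "\<exists>h \<in> hom (braid_group n) K. \<forall>i\<in>{1..n - 1}. h (braid_gen n i) = g i"
  unfolding braid_group_def braid_gen_def
proof (rule group.presented_group_universal[OF K closed])
  interpret K: group K by (rule K)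
  have g: "g i \<in> carrier K" if "i \<in> {1..n - 1}" for i using closed that by blast
  fix r r' assume "(r, r') \<in> braid_rels n"
  then consider i where "1 \<le> i" "i \<le> n - 2" "r = [(i, True), (i + 1, True), (i, True)]"
      "r' = [(i + 1, True), (i, True), (i + 1, True)]"
    | i j where "i \<in> {1..n - 1}" "j \<in> {1..n - 1}" "i + 2 \<le> j \<or> j + 2 \<le> i"
      "r = [(i, True), (j, True)]" "r' = [(j, True), (i, True)]"
    unfolding braid_rels_def by blast
  then show "gword_eval K g r = gword_eval K g r'"
  proof cases
    case (1 i)
    then have "g i \<in> carrier K" "g (i + 1) \<in> carrier K" by (auto intro!: g)
    then show ?thesis using braid[OF 1(1,2)] 1(3,4) by (simp add: gword_eval_def)
  next
    case (2 i j)
    then have "g i \<otimes>\<^bsub>K\<^esub> g j = g j \<otimes>\<^bsub>K\<^esub> g i" using commute by metis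
    then show ?thesis using 2 g by (simp add: gword_eval_def)
  qed
qed

lemma braid_length_exists:
  "\<exists>h \<in> hom (braid_group n) integer_group. \<forall>i\<in>{1..n - 1}. h (braid_gen n i) = 1"
  by (rule braid_hom_exists) auto

lemma braid_winding_exists:
  "\<exists>h \<in> hom (braid_group n) bij_group. \<forall>i\<in>{1..n - 1}. h (braid_gen n i) = wind i 1"
proof (rule braid_hom_exists)
  show "(\<lambda>i. wind i 1) \<in> {1..n - 1} \<rightarrow> carrier bij_group" by (simp add: bij_wind)
  show "wind i 1 \<otimes>\<^bsub>bij_group\<^esub> (wind (i + 1) 1 \<otimes>\<^bsub>bij_group\<^esub> wind i 1)
      = wind (i + 1) 1 \<otimes>\<^bsub>bij_group\<^esub> (wind i 1 \<otimes>\<^bsub>bij_group\<^esub> wind (i + 1) 1)" for i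
    using wind_braid[of i] by (simp only: bij_group_simps o_assoc)
  show "wind i 1 \<otimes>\<^bsub>bij_group\<^esub> wind j 1 = wind j 1 \<otimes>\<^bsub>bij_group\<^esub> wind i 1" if "i + 2 \<le> j" for i j
    using wind_commute[OF that] by simp
qed simp

lemma winding_of_braid:
  assumes \<Theta>: "\<Theta> \<in> hom (braid_group n) bij_group" "\<And>i. i \<in> {1..n - 1} \<Longrightarrow> \<Theta> (braid_gen n i) = wind i 1"
    and len: "len \<in> hom (braid_group n) integer_group" "\<And>i. i \<in> {1..n - 1} \<Longrightarrow> len (braid_gen n i) = 1"
    and B: "B \<in> carrier (braid_group n)"
  shows "\<exists>\<pi> v. winding n (\<Theta> B) \<pi> v (len B)"
proof -
  let ?B = "braid_group n"
  interpret B: group ?B unfolding braid_group_def by (rule group_presented_group)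
  interpret \<Theta>: group_hom ?B bij_group \<Theta>
    by (intro group_hom.intro group_hom_axioms.intro B.group_axioms group_bij_group \<Theta>(1))
  interpret len: group_hom ?B integer_group len
    by (intro group_hom.intro group_hom_axioms.intro B.group_axioms group_integer_group len(1))
  have gc: "braid_gen n i \<in> carrier ?B" if "i \<in> {1..n - 1}" for i
    using that unfolding braid_gen_def braid_group_def by (rule pres_gen_closed)
  show ?thesis
    using B
  proof (induction rule: braid_group_induct)
    case one
    show ?case
      unfolding \<Theta>.hom_one len.hom_one bij_group_simps one_integer_group
      using winding_id by blast
  next
    case (gen c B)
    then obtain \<pi> v where "winding n (\<Theta> B) \<pi> v (len B)" by blast
    from winding_step[OF this gen(1), of 1]
    obtain \<pi>' v' where "winding n (wind c 1 \<circ> \<Theta> B) \<pi>' v' (len B + 1)" by auto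
    moreover have "\<Theta> (braid_gen n c \<otimes>\<^bsub>?B\<^esub> B) = wind c 1 \<circ> \<Theta> B" "len (braid_gen n c \<otimes>\<^bsub>?B\<^esub> B) = len B + 1"
      using \<Theta>.hom_mult[OF gc[OF gen(1)] gen(2)] len.hom_mult[OF gc[OF gen(1)] gen(2)]
        \<Theta>(2)[OF gen(1)] len(2)[OF gen(1)] by simp_all
    ultimately show ?case by metis
  next
    case (inv_gen c B)
    then obtain \<pi> v where "winding n (\<Theta> B) \<pi> v (len B)" by blast
    from winding_step[OF this inv_gen(1), of "-1"]
    obtain \<pi>' v' where "winding n (wind c (-1) \<circ> \<Theta> B) \<pi>' v' (len B + -1)" by auto
    moreover have "\<Theta> (inv\<^bsub>?B\<^esub> (braid_gen n c) \<otimes>\<^bsub>?B\<^esub> B) = wind c (-1) \<circ> \<Theta> B"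
      using \<Theta>.hom_mult[OF B.inv_closed[OF gc[OF inv_gen(1)]] inv_gen(2)]
        \<Theta>.hom_inv[OF gc[OF inv_gen(1)]] \<Theta>(2)[OF inv_gen(1)] inv_wind[of c 1] by simp
    moreover have "len (inv\<^bsub>?B\<^esub> (braid_gen n c) \<otimes>\<^bsub>?B\<^esub> B) = len B + -1"
      using len.hom_mult[OF B.inv_closed[OF gc[OF inv_gen(1)]] inv_gen(2)]
        len.hom_inv[OF gc[OF inv_gen(1)]] len(2)[OF inv_gen(1)] by simp
    ultimately show ?case by metis
  qed
qed

lemma commutes_if_gens_commute:
  assumes hom: "group_hom (presented_group X R) H h" and z: "z \<in> carrier H"
    and gens: "\<And>u. u \<in> X \<Longrightarrow> z \<otimes>\<^bsub>H\<^esub> h (pres_gen X R u) = h (pres_gen X R u) \<otimes>\<^bsub>H\<^esub> z"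
    and A: "A \<in> carrier (presented_group X R)"
  shows "z \<otimes>\<^bsub>H\<^esub> h A = h A \<otimes>\<^bsub>H\<^esub> z"
proof -
  interpret group_hom "presented_group X R" H h by (rule hom)
  show ?thesis
    using A
  proof (induction rule: presented_group_induct)
    case one
    then show ?case using z by simp
  next
    case (gen x B)
    then have c: "h (pres_gen X R x) \<in> carrier H" "h B \<in> carrier H" "pres_gen X R x \<in> carrier (presented_group X R)"
      using pres_gen_closed[of x X R] by auto
    have "z \<otimes>\<^bsub>H\<^esub> (h (pres_gen X R x) \<otimes>\<^bsub>H\<^esub> h B) = h (pres_gen X R x) \<otimes>\<^bsub>H\<^esub> (z \<otimes>\<^bsub>H\<^esub> h B)"
      using c z gens[OF gen(1)] by (metis H.m_assoc)
    then show ?case using gen c z by (simp add: H.m_assoc)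
  next
    case (inv_gen x B)
    define u where "u = h (pres_gen X R x)"
    have c: "u \<in> carrier H" "h B \<in> carrier H" "pres_gen X R x \<in> carrier (presented_group X R)"
      using pres_gen_closed[of x X R] inv_gen by (auto simp: u_def)
    have "z \<otimes>\<^bsub>H\<^esub> inv\<^bsub>H\<^esub> u = inv\<^bsub>H\<^esub> u \<otimes>\<^bsub>H\<^esub> z"
    proof -
      have "inv\<^bsub>H\<^esub> u \<otimes>\<^bsub>H\<^esub> (z \<otimes>\<^bsub>H\<^esub> u) \<otimes>\<^bsub>H\<^esub> inv\<^bsub>H\<^esub> u
          = inv\<^bsub>H\<^esub> u \<otimes>\<^bsub>H\<^esub> (u \<otimes>\<^bsub>H\<^esub> z) \<otimes>\<^bsub>H\<^esub> inv\<^bsub>H\<^esub> u"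
        using gens[OF inv_gen(1)] by (simp add: u_def)
      moreover have "inv\<^bsub>H\<^esub> u \<otimes>\<^bsub>H\<^esub> (z \<otimes>\<^bsub>H\<^esub> u) \<otimes>\<^bsub>H\<^esub> inv\<^bsub>H\<^esub> u = inv\<^bsub>H\<^esub> u \<otimes>\<^bsub>H\<^esub> z"
        using c z by (simp add: H.m_assoc)
      moreover have "inv\<^bsub>H\<^esub> u \<otimes>\<^bsub>H\<^esub> (u \<otimes>\<^bsub>H\<^esub> z) \<otimes>\<^bsub>H\<^esub> inv\<^bsub>H\<^esub> u = z \<otimes>\<^bsub>H\<^esub> inv\<^bsub>H\<^esub> u"
        using c z by (simp add: H.m_assoc[symmetric])
      ultimately show ?thesis by simp
    qed
    then have "z \<otimes>\<^bsub>H\<^esub> (inv\<^bsub>H\<^esub> u \<otimes>\<^bsub>H\<^esub> h B) = inv\<^bsub>H\<^esub> u \<otimes>\<^bsub>H\<^esub> (z \<otimes>\<^bsub>H\<^esub> h B)"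
      using c z by (metis H.inv_closed H.m_assoc)
    then show ?case using inv_gen c z by (simp add: u_def[symmetric] H.m_assoc)
  qed
qed

text \<open>The defining relations of the interval group hold for the images of its generators under any homomorphism.\<close>

lemma interval_map_of_hom:
  assumes W: "reflection_group W S" and K: "group K" and w: "w \<in> carrier W"
    and h: "h \<in> hom (interval_group W S w) K"
  shows "interval_map W S K w (\<lambda>u. h (pres_gen (abs_interval W S w) (interval_rels W S w) u))"
proof -
  let ?I = "abs_interval W S w" and ?R = "interval_rels W S w"
  let ?P = "presented_group ?I ?R"
  interpret W: reflection_group W S by (rule W)
  interpret K: group K by (rule K)
  interpret P: group ?P by (rule group_presented_group)
  have h: "h \<in> hom ?P K" using h by (simp add: interval_group_def)
  have c: "u \<in> ?I \<Longrightarrow> pres_gen ?I ?R u \<in> carrier ?P" for u by (rule pres_gen_closed)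
  have rel: "pres_gen ?I ?R u \<otimes>\<^bsub>?P\<^esub> pres_gen ?I ?R v = pres_gen ?I ?R (u \<otimes>\<^bsub>W\<^esub> v)"
    if "u \<in> ?I" "v \<in> ?I" "u \<otimes>\<^bsub>W\<^esub> v \<in> ?I"
      "refl_length W S (u \<otimes>\<^bsub>W\<^esub> v) = refl_length W S u + refl_length W S v" for u v
  proof -
    have "([(u, True), (v, True)], [(u \<otimes>\<^bsub>W\<^esub> v, True)]) \<in> ?R"
      using that unfolding interval_rels_def by auto
    from pres_gen_rel[OF this, of ?I] that c show ?thesis by (simp add: gword_eval_def)
  qed
  show ?thesis
  proof
    show "w \<in> carrier W" by (rule w)
    show "h (pres_gen ?I ?R u) \<in> carrier K" if "u \<in> ?I" for u using h c[OF that] by (rule hom_in_carrier)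
    show "h (pres_gen ?I ?R (u \<otimes>\<^bsub>W\<^esub> v)) = h (pres_gen ?I ?R u) \<otimes>\<^bsub>K\<^esub> h (pres_gen ?I ?R v)"
      if "u \<in> ?I" "v \<in> ?I" "u \<otimes>\<^bsub>W\<^esub> v \<in> ?I"
        "refl_length W S (u \<otimes>\<^bsub>W\<^esub> v) = refl_length W S u + refl_length W S v" for u v
      using rel[OF that] hom_mult[OF h c[OF that(1)] c[OF that(2)]] by simp
  qed
qed

lemma integer_group_pow [simp]: "x [^]\<^bsub>integer_group\<^esub> (k::nat) = int k * x"
proof -
  interpret Z: group integer_group by (rule group_integer_group)
  show ?thesis by (induction k) (simp_all add: algebra_simps)
qed

context type_D
begin

lemma two_negative_cycles_finite_order:
  assumes t: "two_negative_cycles (rho w) a m b k" and w: "w \<in> carrier W"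
  shows "w [^]\<^bsub>W\<^esub> (2 * m * k) = \<one>\<^bsub>W\<^esub>"
proof -
  define f where "f = rho w"
  have f: "signed_perm n f" and c: "cycle f a m" "cycle f b k" and neg: "orb f a m = - a" "orb f b k = - b"
    and V: "support f a m \<union> support f b k = {1..int n}"
    using t by (auto simp: two_negative_cycles_def f_def)
  have per: "orb f x (i + 2 * l * h) = orb f x i" if "orb f x l = - x" for x i l h
  proof (induction h)
    case (Suc h)
    have "orb f x (i + 2 * l * Suc h) = orb f x (i + 2 * l * h + l + l)"
      by (simp add: algebra_simps)
    also have "\<dots> = orb f x (i + 2 * l * h)"
      using orb_add_period[OF f that, of "i + 2 * l * h + l"] orb_add_period[OF f that, of "i + 2 * l * h"]
      by (simp only: minus_minus)
    finally show ?case using Suc by simp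
  qed simp
  have pow: "(f ^^ (2 * m * k)) x = x" if "x \<in> {1..int n}" for x
  proof -
    have *: "(f ^^ (2 * m * k)) x = x"
      if "orb f u l = - u" and ex: "\<exists>h. 2 * m * k = 2 * l * h" and "x = \<bar>orb f u i\<bar>" for u l i
    proof -
      obtain h where h: "2 * m * k = 2 * l * h" using ex by blast
      have "(f ^^ (2 * m * k)) (orb f u i) = orb f u (i + 2 * l * h)"
        unfolding h orb_add by (simp add: add.commute)
      then have o: "(f ^^ (2 * m * k)) (orb f u i) = orb f u i" using per[OF that(1)] by simp
      have "x = orb f u i \<or> x = - orb f u i" using that(3) by linarith
      then show ?thesis using o signed_permD(2)[OF signed_perm_pow[OF f]] by metis
    qed
    have "\<exists>h. 2 * m * k = 2 * m * h" "\<exists>h. 2 * m * k = 2 * k * h" by auto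
    moreover have "(\<exists>i. x = \<bar>orb f a i\<bar>) \<or> (\<exists>i. x = \<bar>orb f b i\<bar>)"
      using that V unfolding support_def by blast
    ultimately show ?thesis using *[OF neg(1)] *[OF neg(2)] by blast
  qed
  have "f ^^ (2 * m * k) = id"
    by (rule signed_perm_eqI[OF signed_perm_pow[OF f] signed_perm_id]) (simp add: pow)
  moreover have "rho (w [^]\<^bsub>W\<^esub> (2 * m * k)) = f ^^ (2 * m * k)"
    using rho.hom_nat_pow[OF w] by (simp add: f_def)
  ultimately show ?thesis using rho_injective w by simp
qed

end

theorem theorem1p1:
  fixes n :: nat and w :: "nat gword set"
  assumes "n \<ge> 5"
    and "proper_quasi_coxeter_element (W_D n) (S_D n) w"
  shows "epi (interval_group (W_D n) (S_D n) w) (braid_group n) = {}"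
proof (rule equals0I)
  interpret type_D n by unfold_locales (rule assms(1))
  let ?I = "abs_interval W (S_D n) w" and ?Rel = "interval_rels W (S_D n) w"
  let ?G = "interval_group W (S_D n) w" and ?B = "braid_group n"
  let ?d = "pres_gen ?I ?Rel"
  interpret G: group ?G unfolding interval_group_def by (rule group_presented_group)
  interpret B: group ?B unfolding braid_group_def by (rule group_presented_group)
  fix \<phi> assume "\<phi> \<in> epi ?G ?B"
  then have \<phi>: "\<phi> \<in> hom ?G ?B" "\<phi> ` carrier ?G = carrier ?B" by (auto simp: epi_def)
  have quasi: "quasi_coxeter_element W (S_D n) w"
    and proper: "\<not> (\<exists>c g. coxeter_element W (S_D n) c \<and> g \<in> carrier W \<and> w = g \<otimes>\<^bsub>W\<^esub> c \<otimes>\<^bsub>W\<^esub> inv\<^bsub>W\<^esub> g)"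
    using assms(2) unfolding proper_quasi_coxeter_element_def by blast+
  then have w: "w \<in> carrier W" "R.len w = n"
    unfolding quasi_coxeter_element_def card_S by blast+
  obtain a m b k where t: "two_negative_cycles (rho w) a m b k" and mk: "m \<le> k"
    using quasi_coxeter_two_negative_cycles[OF quasi] two_negative_cycles_sym by (metis linear)
  have "m \<noteq> 1" using coxeter_if_short_cycle[OF _ w(1)] t proper by blast
  moreover have "m > 0" "m + k = n" using t cycle_pos by (auto simp: two_negative_cycles_def)
  ultimately have m: "1 < m" and k: "1 < k" using mk by auto
  have G_eq: "?G = presented_group ?I ?Rel" by (simp add: interval_group_def)
  have map: "two_cycle_map n K w a m b k (\<lambda>u. h (?d u))" if "h \<in> hom ?G K" "group K" for h K
    using that interval_map_of_hom[OF R.reflection_group_axioms that(2) w(1) that(1)] t w(2)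
    by (intro two_cycle_map.intro two_cycle_map_axioms.intro type_D_axioms)
  note reach = T_reachable[OF t w(1)]

  obtain len where len: "len \<in> hom ?B integer_group" "\<And>i. i \<in> {1..n - 1} \<Longrightarrow> len (braid_gen n i) = 1"
    using braid_length_exists by blast
  obtain \<Theta> where \<Theta>: "\<Theta> \<in> hom ?B bij_group" "\<And>i. i \<in> {1..n - 1} \<Longrightarrow> \<Theta> (braid_gen n i) = wind i 1"
    using braid_winding_exists by blast
  have gens_closed: "braid_gen n i \<in> carrier ?B" if "i \<in> {1..n - 1}" for i
    using that unfolding braid_gen_def braid_group_def by (rule pres_gen_closed)
  have preimage: "\<exists>A\<in>carrier ?G. \<phi> A = C" if "C \<in> carrier ?B" for C
    using that unfolding \<phi>(2)[symmetric] by (auto elim: imageE)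
  interpret \<Theta>: group_hom ?B bij_group \<Theta>
    by (intro group_hom.intro group_hom_axioms.intro B.group_axioms group_bij_group \<Theta>(1))
  interpret len: group_hom ?B integer_group len
    by (intro group_hom.intro group_hom_axioms.intro B.group_axioms group_integer_group len(1))
  interpret \<phi>: group_hom ?G ?B \<phi>
    by (intro group_hom.intro group_hom_axioms.intro B.group_axioms G.group_axioms \<phi>(1))

  define D where "D u = \<phi> (?d u)" for u
  define X where "X = D w"
  interpret M: two_cycle_map n ?B w a m b k D
    unfolding D_def by (rule map[OF \<phi>(1) B.group_axioms])
  interpret Z: two_cycle_map n integer_group w a m b k "\<lambda>u. len (D u)"
    using map[OF hom_compose[OF \<phi>(1) len(1)] group_integer_group] by (simp add: D_def)
  interpret \<Psi>: two_cycle_map n bij_group w a m b k "\<lambda>u. \<Theta> (D u)"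
    using map[OF hom_compose[OF \<phi>(1) \<Theta>(1)] group_bij_group] by (simp add: D_def)
  have Xc: "X \<in> carrier ?B" unfolding X_def using M.D.D_closed M.D.w_in_I by blast

  \<comment> \<open>All letters have the same exponent sum \<open>l\<close>, so \<open>l\<close> divides every exponent sum; as \<open>\<phi>\<close> is onto, \<open>l = \<plusminus>1\<close>.\<close>
  have len_X: "\<bar>len X\<bar> = int n"
  proof -
    define l where "l = len (D M.x)"
    have "len (D u) = int (R.len u) * l" if "u \<in> ?I" for u
      using Z.D.D_const_power[of l, OF _ _ reach that] Z.constant_if_commutative[OF k]
      by (simp add: l_def)
    note lD = this
    have "\<exists>h. len (\<phi> A) = h * l" if "A \<in> carrier ?G" for A
      using that
    proof (induction rule: interval_group_induct)
      case one
      show ?case by (intro exI[of _ 0]) simp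
    next
      case (gen u A)
      have c: "?d u \<in> carrier ?G" unfolding G_eq using gen(1) by (rule pres_gen_closed)
      obtain h where "len (\<phi> A) = h * l" using gen by blast
      then have "len (\<phi> (?d u \<otimes>\<^bsub>?G\<^esub> A)) = (int (R.len u) + h) * l"
        using c gen(2) lD[OF gen(1)] by (simp add: D_def algebra_simps)
      then show ?case by blast
    next
      case (inv_gen u A)
      have c: "?d u \<in> carrier ?G" unfolding G_eq using inv_gen(1) by (rule pres_gen_closed)
      obtain h where "len (\<phi> A) = h * l" using inv_gen by blast
      then have "len (\<phi> (inv\<^bsub>?G\<^esub> (?d u) \<otimes>\<^bsub>?G\<^esub> A)) = (h - int (R.len u)) * l"
        using c inv_gen(2) lD[OF inv_gen(1)] by (simp add: D_def algebra_simps)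
      then show ?case by blast
    qed
    note multiple = this
    have one: "1 \<in> {1..n - 1}" using n_ge by simp
    obtain A where A: "A \<in> carrier ?G" "\<phi> A = braid_gen n 1" using preimage[OF gens_closed[OF one]] by blast
    obtain h where "len (\<phi> A) = h * l" using multiple[OF A(1)] by blast
    then have "1 = h * l" using len(2)[OF one] unfolding A(2) by metis
    then have "l dvd 1" by (metis dvd_triv_right)
    then have "\<bar>l\<bar> = 1" by simp
    then show ?thesis using lD[OF M.D.w_in_I] w(2) by (simp add: X_def abs_mult)
  qed

  define N where "N = 2 * m * k"
  have N: "N > 0" using m k by (simp add: N_def)
  have XN_D: "X [^]\<^bsub>?B\<^esub> N \<otimes>\<^bsub>?B\<^esub> D u = D u \<otimes>\<^bsub>?B\<^esub> X [^]\<^bsub>?B\<^esub> N" if "u \<in> ?I" for u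
    using M.D.D_power_conj_w[OF that, of N] two_negative_cycles_finite_order[OF t w(1)]
      R.interval_closed[OF that] by (simp add: X_def N_def)
  have XN: "X [^]\<^bsub>?B\<^esub> N \<otimes>\<^bsub>?B\<^esub> C = C \<otimes>\<^bsub>?B\<^esub> X [^]\<^bsub>?B\<^esub> N" if "C \<in> carrier ?B" for C
  proof -
    obtain A where A: "A \<in> carrier ?G" "\<phi> A = C" using preimage[OF \<open>C \<in> carrier ?B\<close>] by blast
    show ?thesis
      unfolding A(2)[symmetric]
      by (rule commutes_if_gens_commute[OF \<phi>.group_hom_axioms[unfolded G_eq] _ _ A(1)[unfolded G_eq]])
         (use Xc XN_D in \<open>simp_all add: D_def\<close>)
  qed

  have \<Theta>_pow: "\<Theta> (X [^]\<^bsub>?B\<^esub> L) = \<Theta> X ^^ L" for L :: nat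
    using \<Theta>.hom_nat_pow[OF Xc] by simp
  have len_pow: "len (X [^]\<^bsub>?B\<^esub> L) = int L * len X" for L :: nat
    using len.hom_nat_pow[OF Xc] by simp
  have winding: "\<exists>\<pi> v. winding n (\<Theta> C) \<pi> v (len C)" if "C \<in> carrier ?B" for C
    using \<Theta>(1) \<Theta>(2) len(1) len(2) that by (rule winding_of_braid)
  \<comment> \<open>\<open>\<Theta> X\<close> is a root of a central element with exponent sum \<open>\<plusminus>n\<close>, so its \<open>(n-1)\<close>-st power is central already.\<close>
  have root: "(\<Theta> X ^^ (n - 1)) \<circ> \<Theta> C = \<Theta> C \<circ> (\<Theta> X ^^ (n - 1))" if C: "C \<in> carrier ?B" for C
  proof -
    obtain \<pi> v where C': "winding n (\<Theta> C) \<pi> v (len C)" using winding[OF C] by blast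
    show ?thesis
    proof (rule root_of_central[OF _ len_X N _ _ C'])
      show "4 \<le> n" using n_ge by simp
      show "\<exists>\<pi> v. winding n (\<Theta> X ^^ L) \<pi> v (int L * len X)" for L
        using winding[of "X [^]\<^bsub>?B\<^esub> L"] Xc by (simp add: \<Theta>_pow len_pow)
      show "(\<Theta> X ^^ N) \<circ> wind c 1 = wind c 1 \<circ> (\<Theta> X ^^ N)" if "c \<in> {1..n - 1}" for c
        using arg_cong[OF XN[OF gens_closed[OF that]], of \<Theta>] Xc gens_closed[OF that]
        by (simp add: \<Theta>_pow \<Theta>(2)[OF that])
    qed
  qed

  have qI: "M.q 0 \<in> ?I" using M.q_rotate(1)[OF k] .
  have const: "\<Theta> (D u) = \<Theta> (D M.x)" if "u \<in> set M.ts" for u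
    by (rule \<Psi>.constant_if_power_central[OF m mk _ that])
       (use root[OF M.D.D_closed[OF qI]] in \<open>simp add: X_def\<close>)
  define z where "z = \<Theta> (D M.x)"
  have z: "z \<in> carrier bij_group"
    unfolding z_def using \<Psi>.D_ts_closed \<Psi>.in_ts(1) by blast
  have power: "\<Theta> (D u) = z ^^ R.len u" if "u \<in> ?I" for u
    using \<Psi>.D.D_const_power[of z, OF _ z reach that] const by (simp add: z_def)
  \<comment> \<open>The image of the interval group under \<open>\<Theta> \<circ> \<phi>\<close> is generated by powers of the single element \<open>z\<close>.\<close>
  have comm: "\<Theta> (\<phi> A) \<circ> \<Theta> (\<phi> A') = \<Theta> (\<phi> A') \<circ> \<Theta> (\<phi> A)"
    if A: "A \<in> carrier ?G" "A' \<in> carrier ?G" for A A'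
  proof -
    interpret c: group_hom ?G bij_group "\<Theta> \<circ> \<phi>"
      by (intro group_hom.intro group_hom_axioms.intro G.group_axioms group_bij_group
          hom_compose[OF \<phi>(1) \<Theta>(1)])
    have "\<Theta> (D u) \<circ> (\<Theta> \<circ> \<phi>) A = (\<Theta> \<circ> \<phi>) A \<circ> \<Theta> (D u)" if "u \<in> ?I" for u
    proof -
      have bu: "\<Theta> (D u) \<in> carrier bij_group" using \<Psi>.D.D_closed[OF that] .
      have "\<Theta> (D u) \<otimes>\<^bsub>bij_group\<^esub> (\<Theta> \<circ> \<phi>) (?d u') = (\<Theta> \<circ> \<phi>) (?d u') \<otimes>\<^bsub>bij_group\<^esub> \<Theta> (D u)"
        if "u' \<in> ?I" for u'
        using power[OF \<open>u \<in> ?I\<close>] power[OF that]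
        by (simp add: D_def[symmetric] funpow_add[symmetric] add.commute)
      from commutes_if_gens_commute[OF c.group_hom_axioms[unfolded G_eq] bu this A(1)[unfolded G_eq]] show ?thesis by simp
    qed
    then have "(\<Theta> \<circ> \<phi>) A \<otimes>\<^bsub>bij_group\<^esub> (\<Theta> \<circ> \<phi>) (?d u') = (\<Theta> \<circ> \<phi>) (?d u') \<otimes>\<^bsub>bij_group\<^esub> (\<Theta> \<circ> \<phi>) A"
      if "u' \<in> ?I" for u'
      using that by (simp add: D_def)
    from commutes_if_gens_commute[OF c.group_hom_axioms[unfolded G_eq] c.hom_closed[OF A(1)] this A(2)[unfolded G_eq]] show ?thesis by simp
  qed
  have one: "1 \<in> {1..n - 1}" and two: "2 \<in> {1..n - 1}" using n_ge by simp_all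
  obtain A where A: "A \<in> carrier ?G" "\<phi> A = braid_gen n 1" using preimage[OF gens_closed[OF one]] by blast
  obtain A' where A': "A' \<in> carrier ?G" "\<phi> A' = braid_gen n 2" using preimage[OF gens_closed[OF two]] by blast
  have "wind 1 1 \<circ> wind 2 1 = wind 2 1 \<circ> wind 1 1"
    using comm[OF A(1) A'(1)] unfolding A(2) A'(2) \<Theta>(2)[OF one] \<Theta>(2)[OF two] .
  then show False using wind_noncommute by blast
qed

end
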